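(* Let $\Gamma$ be a compact Lie group acting linearly on a symplectic vector space $(V,\omega)$, and let $\sigma_1,\sigma_2:\Gamma\to\mathbb{Z}_2=\{\pm1\}$ be group homomorphisms. Suppose that the action of $\Gamma$ on $(V,\omega)$ is $\sigma_1$-semisymplectic, and let $X:V\to V$ be an $\omega$-Hamiltonian and $\Gamma_{\sigma_2}$-equivariant vector field such that $X(0)=0$ and $L=dX_0$. Let $\mathbf{S}=\overline{\{e^{sL^T}:s\in\mathbb{R}\}}$, suppose that $\mathbf{S}$ acts symplectically on $(V,\omega)$, and let $r\ge3$. Let $H:V\to\mathbb{R}$ be the Hamiltonian function associated with $X$ such that $H(0)=0$ and $\nabla H(0)=0$, and let $H^2$ be the quadratic form associated with the Hessian of $H$ at $0$, i.e. $H^2(x)=\frac12 x^T d^2H_0\,x$. Then there exist $K^k\in\mathcal{P}^k_{\tilde\sigma_1\tilde\sigma_2}(\mathbf{S}\rtimes\Gamma)$, $k=3,\ldots,r$, such that $$K=H^2+K^3+\cdots+K^r$$ is a normal form up to order $r$ of $H$, and $X_K$ is a normal form up to order $r-1$ of $X$ that preserves the symmetries of $X$, i.e. $X_K$ is $\Gamma_{\sigma_2}$-equivariant.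
   Context: $V$ is a real vector space of dimension $2n$ with an alternating non-degenerate bilinear form $\omega$. For a smooth $H:V\to\mathbb{R}$, the $\omega$-Hamiltonian vector field $X_H$ is defined by $\omega(X_H(x),\cdot)=dH_x$ for all $x\in V$; a vector field is $\omega$-Hamiltonian if it equals $X_H$ for some smooth $H$ (its Hamiltonian function). All vector fields are smooth. Write $\rho_\gamma(x)=\gamma x$. The (linear) action of $\Gamma$ is $\sigma_1$-semisymplectic if $\omega(\gamma u,\gamma v)=\sigma_1(\gamma)\omega(u,v)$ for all $\gamma\in\Gamma$, $u,v\in V$. $X$ is $\Gamma_{\sigma_2}$-equivariant if $X(\gamma x)=\sigma_2(\gamma)\gamma X(x)$ for all $\gamma\in\Gamma$, $x\in V$. Matrices and transposes are taken with respect to a fixed basis of $V$ that is orthonormal for some $\Gamma$-invariant inner product (one exists as $\Gamma$ is compact). The closure defining $\mathbf{S}$ is taken in $GL(2n)$; $\mathbf{S}$ acts on $V$ by matrix multiplication, and it acts symplectically if $\omega(Au,Av)=\omega(u,v)$ for all $A\in\mathbf{S}$, $u,v\in V$. The semidirect product $\mathbf{S}\rtimes\Gamma$ acts on $V$ by $(e^{sL^T},\gamma)x=e^{sL^T}(\gamma x)=\gamma e^{\sigma_2(\gamma)sL^T}x$ (and in general $(A,\gamma)x=A(\gamma x)$ for $A\in\mathbf{S}$). The homomorphisms $\tilde\sigma_j:\mathbf{S}\rtimes\Gamma\to\mathbb{Z}_2$ are $\tilde\sigma_j(A,\gamma)=\sigma_j(\gamma)$, $j=1,2$, and $\tilde\sigma_1\tilde\sigma_2$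 is their pointwise product. $\mathcal{P}^k$ is the space of homogeneous polynomial functions $V\to\mathbb{R}$ of degree $k$. For a group $G$ acting on $V$ and a homomorphism $\sigma:G\to\mathbb{Z}_2$, $\mathcal{P}^k_\sigma(G)=\{f\in\mathcal{P}^k: f(gx)=\sigma(g)f(x)\ \forall g\in G,x\in V\}$; $\mathcal{P}^k(G)$ is the case $\sigma$ trivial. Normal form: let $ad^k_{H^2}:\mathcal{P}^k\to\mathcal{P}^k$, $ad^k_{H^2}(F)=\{F,H^2\}=\omega(X_F,X_{H^2})$, and let $\mathcal{D}^k$ be a complement of $ad^k_{H^2}(\mathcal{P}^k)$ in $\mathcal{P}^k$; here the complement used is $\mathcal{D}^k=\mathcal{P}^k(\mathbf{S})$. A normal form of $H$ up to order $r$ is a sum $K=H^2+K^3+\cdots+K^r$ with $K^k\in\mathcal{D}^k$ for $k=3,\ldots,r$, arising from a formal conjugacy, i.e. such that $X=X_H$ is formally conjugated to a vector field $Ly+X_{K^3}(y)+\cdots+X_{K^r}(y)+O(|y|^r)$; then $X_K(y)=Ly+X_{K^3}(y)+\cdots+X_{K^r}(y)$ is called a normal form of $X$ up to order $r-1$. A vector field $Y$ (defined near the origin, vanishing there) is formally conjugated to $X$ if a power series of $Y$ is conjugated to a power series of $X$ as formal vector fields, i.e. there is a formal power series map $\hat\xi$ with zero constant term and invertible linear part such that $d\hat\xi\cdot\hat Y=\hat X\circ\hat\xi$, where $\hat X,\hat Y$ are the Taylor series at $0$. *)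

theory Defs
  imports
    "HOL-Analysis.Analysis"
    "HOL-Algebra.Group_Action"
    "HOL-Library.Landau_Symbols"
begin

section \<open>Smooth maps and Taylor components\<close>

text \<open>Finite-dimensional real vector spaces are types of class \<open>euclidean_space\<close>. That class comes
  with an inner product of its own, which below only supplies the topology (and a norm for the
  order symbol): the inner product of the mathematical setting is a separate object.\<close>

definition dderiv :: "'a::real_normed_vector \<Rightarrow> ('a \<Rightarrow> 'b::real_normed_vector) \<Rightarrow> 'a \<Rightarrow> 'b"
  where "dderiv v f = (\<lambda>x. frechet_derivative f (at x) v)"

fun C_diff_on :: "nat \<Rightarrow> 'a::real_normed_vector set \<Rightarrow> ('a \<Rightarrow> 'b::real_normed_vector) \<Rightarrow> bool"
  where
    "C_diff_on 0 S f \<longleftrightarrow> continuous_on S f"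
  | "C_diff_on (Suc k) S f \<longleftrightarrow> (\<forall>x\<in>S. f differentiable at x) \<and> (\<forall>v. C_diff_on k S (dderiv v f))"

text \<open>Only meant for open \<open>S\<close>.\<close>

definition smooth_on :: "'a::real_normed_vector set \<Rightarrow> ('a \<Rightarrow> 'b::real_normed_vector) \<Rightarrow> bool"
  where "smooth_on S f \<longleftrightarrow> (\<forall>k. C_diff_on k S f)"

text \<open>\<open>taylor f k\<close> is the homogeneous component of degree \<open>k\<close> of the Taylor series of \<open>f\<close> at 0,
  that is \<open>x \<mapsto> d\<^sup>kf\<^sub>0(x,\<dots>,x) / k!\<close>.\<close>

definition taylor :: "('a::real_normed_vector \<Rightarrow> 'b::real_normed_vector) \<Rightarrow> nat \<Rightarrow> 'a \<Rightarrow> 'b"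
  where "taylor f k = (\<lambda>x. (1 / fact k) *\<^sub>R ((dderiv x ^^ k) f) 0)"


section \<open>Lie groups\<close>

text \<open>Smoothness on an arbitrary subset: local smooth extendability.\<close>

definition smooth_ext_on :: "'a::real_normed_vector set \<Rightarrow> ('a \<Rightarrow> 'b::real_normed_vector) \<Rightarrow> bool"
  where "smooth_ext_on A f \<longleftrightarrow>
    (\<forall>x\<in>A. \<exists>U g. open U \<and> x \<in> U \<and> smooth_on U g \<and> (\<forall>y\<in>A \<inter> U. g y = f y))"

text \<open>The charts take values in a linear subspace \<open>E\<close> of a Euclidean space, and the dimension of the
  manifold is that of \<open>E\<close>. With the type itself as model space, dimension 0, and hence every finite
  group, would be lost.\<close>

definition smooth_atlas ::
    "'g topology \<Rightarrow> 'e::euclidean_space set \<Rightarrow> ('g set \<times> ('g \<Rightarrow> 'e)) set \<Rightarrow> bool"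
  where "smooth_atlas T E \<A> \<longleftrightarrow>
    subspace E \<and> \<Union> (fst ` \<A>) = topspace T \<and>
    (\<forall>(U, \<phi>)\<in>\<A>. openin T U \<and> openin (top_of_set E) (\<phi> ` U) \<and>
       homeomorphic_map (subtopology T U) (top_of_set (\<phi> ` U)) \<phi>) \<and>
    (\<forall>(U, \<phi>)\<in>\<A>. \<forall>(W, \<psi>)\<in>\<A>. smooth_ext_on (\<phi> ` (U \<inter> W)) (\<psi> \<circ> inv_into U \<phi>))"

definition lie_group ::
    "'g monoid \<Rightarrow> 'g topology \<Rightarrow> 'e::euclidean_space set \<Rightarrow> ('g set \<times> ('g \<Rightarrow> 'e)) set \<Rightarrow> bool"
  where "lie_group G T E \<A> \<longleftrightarrow>
    group G \<and> topspace T = carrier G \<and> Hausdorff_space T \<and>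
    (\<exists>B. countable B \<and> (\<forall>U. openin T U \<longleftrightarrow> (\<exists>C\<subseteq>B. U = \<Union> C))) \<and>
    smooth_atlas T E \<A> \<and>
    continuous_map (prod_topology T T) T (\<lambda>(g, h). g \<otimes>\<^bsub>G\<^esub> h) \<and>
    continuous_map T T (\<lambda>g. inv\<^bsub>G\<^esub> g) \<and>
    (\<forall>(U, \<phi>)\<in>\<A>. \<forall>(W, \<psi>)\<in>\<A>. \<forall>(Z, \<zeta>)\<in>\<A>.
       smooth_ext_on {(\<phi> g, \<psi> h) | g h. g \<in> U \<and> h \<in> W \<and> g \<otimes>\<^bsub>G\<^esub> h \<in> Z}
         (\<lambda>(a, b). \<zeta> (inv_into U \<phi> a \<otimes>\<^bsub>G\<^esub> inv_into W \<psi> b))) \<and>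
    (\<forall>(U, \<phi>)\<in>\<A>. \<forall>(Z, \<zeta>)\<in>\<A>.
       smooth_ext_on {\<phi> g | g. g \<in> U \<and> inv\<^bsub>G\<^esub> g \<in> Z} (\<lambda>a. \<zeta> (inv\<^bsub>G\<^esub> (inv_into U \<phi> a))))"

definition compact_lie_group ::
    "'g monoid \<Rightarrow> 'g topology \<Rightarrow> 'e::euclidean_space set \<Rightarrow> ('g set \<times> ('g \<Rightarrow> 'e)) set \<Rightarrow> bool"
  where "compact_lie_group G T E \<A> \<longleftrightarrow> lie_group G T E \<A> \<and> compact_space T"

definition linear_group_action ::
    "'g monoid \<Rightarrow> 'g topology \<Rightarrow> ('g \<Rightarrow> 'v \<Rightarrow> 'v::real_normed_vector) \<Rightarrow> bool"
  where "linear_group_action G T \<rho> \<longleftrightarrow>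
    group_action G UNIV \<rho> \<and> (\<forall>g\<in>carrier G. linear (\<rho> g)) \<and>
    continuous_map (prod_topology T euclidean) euclidean (\<lambda>(g, v). \<rho> g v)"

definition Z2 :: "real monoid"
  where "Z2 = \<lparr>carrier = {1, -1}, mult = (*), one = 1\<rparr>"


section \<open>Symplectic structure and Hamiltonian vector fields\<close>

definition symplectic_form :: "('v::real_vector \<Rightarrow> 'v \<Rightarrow> real) \<Rightarrow> bool"
  where "symplectic_form \<omega> \<longleftrightarrow>
    (\<forall>u. linear (\<omega> u)) \<and> (\<forall>v. linear (\<lambda>u. \<omega> u v)) \<and>
    (\<forall>v. \<omega> v v = 0) \<and> (\<forall>u. (\<forall>v. \<omega> u v = 0) \<longrightarrow> u = 0)"

definition semisymplectic ::
    "'g monoid \<Rightarrow> ('g \<Rightarrow> 'v \<Rightarrow> 'v) \<Rightarrow> ('g \<Rightarrow> real) \<Rightarrow> ('v \<Rightarrow> 'v \<Rightarrow> real) \<Rightarrow> bool"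
  where "semisymplectic G \<rho> \<sigma> \<omega> \<longleftrightarrow>
    (\<forall>g\<in>carrier G. \<forall>u v. \<omega> (\<rho> g u) (\<rho> g v) = \<sigma> g * \<omega> u v)"

definition equivariant_vf ::
    "'g monoid \<Rightarrow> ('g \<Rightarrow> 'v \<Rightarrow> 'v) \<Rightarrow> ('g \<Rightarrow> real) \<Rightarrow> ('v \<Rightarrow> 'v::real_vector) \<Rightarrow> bool"
  where "equivariant_vf G \<rho> \<sigma> X \<longleftrightarrow>
    (\<forall>g\<in>carrier G. \<forall>x. X (\<rho> g x) = \<sigma> g *\<^sub>R \<rho> g (X x))"

text \<open>Meaningful for symplectic \<open>\<omega>\<close> and differentiable \<open>H\<close>, when the vector described exists and is
  unique.\<close>

definition ham_vf :: "('v::real_normed_vector \<Rightarrow> 'v \<Rightarrow> real) \<Rightarrow> ('v \<Rightarrow> real) \<Rightarrow> 'v \<Rightarrow> 'v"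
  where "ham_vf \<omega> H x = (THE u. \<forall>v. \<omega> u v = frechet_derivative H (at x) v)"

definition poisson ::
    "('v::real_normed_vector \<Rightarrow> 'v \<Rightarrow> real) \<Rightarrow> ('v \<Rightarrow> real) \<Rightarrow> ('v \<Rightarrow> real) \<Rightarrow> 'v \<Rightarrow> real"
  where "poisson \<omega> F G = (\<lambda>x. \<omega> (ham_vf \<omega> F x) (ham_vf \<omega> G x))"


section \<open>Bases, matrices and the group generated by the transposed linear part\<close>

definition is_basis :: "('m::finite \<Rightarrow> 'v::real_vector) \<Rightarrow> bool"
  where "is_basis e \<longleftrightarrow> inj e \<and> independent (range e) \<and> span (range e) = UNIV"

definition coords :: "('m::finite \<Rightarrow> 'v::real_vector) \<Rightarrow> 'v \<Rightarrow> real^'m"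
  where "coords e v = (\<chi> i. representation (range e) v (e i))"

definition matrix_wrt :: "('m::finite \<Rightarrow> 'v::real_vector) \<Rightarrow> ('v \<Rightarrow> 'v) \<Rightarrow> real^'m^'m"
  where "matrix_wrt e f = (\<chi> i j. coords e (f (e j)) $ i)"

definition matrix_act :: "('m::finite \<Rightarrow> 'v::real_vector) \<Rightarrow> real^'m^'m \<Rightarrow> 'v \<Rightarrow> 'v"
  where "matrix_act e A v = (\<Sum>i\<in>UNIV. (A *v coords e v) $ i *\<^sub>R e i)"

definition inner_product :: "('v::real_vector \<Rightarrow> 'v \<Rightarrow> real) \<Rightarrow> bool"
  where "inner_product ip \<longleftrightarrow>
    (\<forall>u. linear (ip u)) \<and> (\<forall>u v. ip u v = ip v u) \<and> (\<forall>v. v \<noteq> 0 \<longrightarrow> ip v v > 0)"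

definition orthonormal_for_invariant ::
    "'g monoid \<Rightarrow> ('g \<Rightarrow> 'v \<Rightarrow> 'v) \<Rightarrow> ('m \<Rightarrow> 'v::real_vector) \<Rightarrow> bool"
  where "orthonormal_for_invariant G \<rho> e \<longleftrightarrow>
    (\<exists>ip. inner_product ip \<and>
       (\<forall>g\<in>carrier G. \<forall>u v. ip (\<rho> g u) (\<rho> g v) = ip u v) \<and>
       (\<forall>i j. ip (e i) (e j) = (if i = j then 1 else 0)))"

definition mexp :: "real^'m^'m \<Rightarrow> real^'m^'m"
  where "mexp A = (\<Sum>k. (1 / fact k) *\<^sub>R (((**) A ^^ k) (mat 1)))"

text \<open>Intersecting the closure with the invertible matrices gives the closure in \<open>GL\<close>.\<close>

definition S_set :: "('m::finite \<Rightarrow> 'v::real_vector) \<Rightarrow> ('v \<Rightarrow> 'v) \<Rightarrow> (real^'m^'m) set"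
  where "S_set e L =
    closure (range (\<lambda>s. mexp (s *\<^sub>R transpose (matrix_wrt e L)))) \<inter> {A. invertible A}"

definition S_group :: "('m::finite \<Rightarrow> 'v::real_vector) \<Rightarrow> ('v \<Rightarrow> 'v) \<Rightarrow> (real^'m^'m) monoid"
  where "S_group e L = \<lparr>carrier = S_set e L, mult = (**), one = mat 1\<rparr>"

text \<open>\<open>\<Gamma>\<close> acts on \<open>\<^bold>S\<close> by conjugation, \<open>A \<mapsto> \<gamma>A\<gamma>\<^sup>-\<^sup>1\<close>, which is the automorphism
  \<open>e\<^bsup>sL\<^sup>T\<^esup> \<mapsto> e\<^bsup>\<sigma>\<^sub>2(\<gamma>)sL\<^sup>T\<^esup>\<close> on the generating one-parameter group.\<close>

definition semidirect ::
    "('m::finite \<Rightarrow> 'v::real_vector) \<Rightarrow> ('v \<Rightarrow> 'v) \<Rightarrow> 'g monoid \<Rightarrow> ('g \<Rightarrow> 'v \<Rightarrow> 'v) \<Rightarrow>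
      ((real^'m^'m) \<times> 'g) monoid"
  where "semidirect e L G \<rho> =
    \<lparr>carrier = S_set e L \<times> carrier G,
     mult = (\<lambda>(A, g) (B, h).
       (A ** (matrix_wrt e (\<rho> g) ** B ** matrix_wrt e (\<rho> (inv\<^bsub>G\<^esub> g))), g \<otimes>\<^bsub>G\<^esub> h)),
     one = (mat 1, \<one>\<^bsub>G\<^esub>)\<rparr>"

definition semidirect_act ::
    "('m::finite \<Rightarrow> 'v::real_vector) \<Rightarrow> ('g \<Rightarrow> 'v \<Rightarrow> 'v) \<Rightarrow> (real^'m^'m) \<times> 'g \<Rightarrow> 'v \<Rightarrow> 'v"
  where "semidirect_act e \<rho> = (\<lambda>(A, g) x. matrix_act e A (\<rho> g x))"


section \<open>Homogeneous polynomials\<close>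

definition hom_poly :: "nat \<Rightarrow> ('v::real_normed_vector \<Rightarrow> real) set"
  where "hom_poly k = {f. real_polynomial_function f \<and> (\<forall>t x. f (t *\<^sub>R x) = t ^ k * f x)}"

definition hom_poly_semi ::
    "'h monoid \<Rightarrow> ('h \<Rightarrow> 'v \<Rightarrow> 'v) \<Rightarrow> ('h \<Rightarrow> real) \<Rightarrow> nat \<Rightarrow> ('v::real_normed_vector \<Rightarrow> real) set"
  where "hom_poly_semi G act \<sigma> k =
    {f \<in> hom_poly k. \<forall>g\<in>carrier G. \<forall>x. f (act g x) = \<sigma> g * f x}"

definition hom_poly_inv ::
    "'h monoid \<Rightarrow> ('h \<Rightarrow> 'v \<Rightarrow> 'v) \<Rightarrow> nat \<Rightarrow> ('v::real_normed_vector \<Rightarrow> real) set"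
  where "hom_poly_inv G act k = hom_poly_semi G act (\<lambda>_. 1) k"

definition linear_complement :: "('v \<Rightarrow> real) set \<Rightarrow> ('v \<Rightarrow> real) set \<Rightarrow> ('v \<Rightarrow> real) set \<Rightarrow> bool"
  where "linear_complement P R D \<longleftrightarrow>
    D \<subseteq> P \<and> R \<subseteq> P \<and> (\<lambda>_. 0) \<in> D \<and>
    (\<forall>f\<in>D. \<forall>g\<in>D. (\<lambda>x. f x + g x) \<in> D) \<and> (\<forall>c. \<forall>f\<in>D. (\<lambda>x. c * f x) \<in> D) \<and>
    (\<forall>p\<in>P. \<exists>!q. q \<in> R \<times> D \<and> p = (\<lambda>x. fst q x + snd q x))"


section \<open>Formal conjugacy\<close>

text \<open>A formal power series map is given by the sequence of its homogeneous components.\<close>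

definition formal_map :: "(nat \<Rightarrow> 'v \<Rightarrow> 'v::real_normed_vector) \<Rightarrow> bool"
  where "formal_map \<xi> \<longleftrightarrow>
    (\<forall>k. polynomial_function (\<xi> k) \<and> (\<forall>t x. \<xi> k (t *\<^sub>R x) = t ^ k *\<^sub>R \<xi> k x))"

text \<open>When \<open>\<xi>\<close> has zero constant term, the degree \<open>k\<close> component of \<open>F \<circ> \<xi>\<close> only involves the components
  of degree at most \<open>k\<close> of \<open>F\<close> and \<open>\<xi>\<close>: it is that of the composite of the polynomial truncations.\<close>

definition formal_compose ::
    "(nat \<Rightarrow> 'v \<Rightarrow> 'v) \<Rightarrow> (nat \<Rightarrow> 'v \<Rightarrow> 'v) \<Rightarrow> nat \<Rightarrow> 'v \<Rightarrow> 'v::real_normed_vector"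
  where "formal_compose F \<xi> k = taylor (\<lambda>y. \<Sum>j\<le>k. F j (\<Sum>i\<le>k. \<xi> i y)) k"

text \<open>The product \<open>d\<xi> \<cdot> Y\<close>: the component of degree \<open>j\<close> of \<open>d\<xi>\<close> is the derivative of \<open>\<xi> (j + 1)\<close>.\<close>

definition formal_deriv_apply ::
    "(nat \<Rightarrow> 'v \<Rightarrow> 'v) \<Rightarrow> (nat \<Rightarrow> 'v \<Rightarrow> 'v) \<Rightarrow> nat \<Rightarrow> 'v \<Rightarrow> 'v::real_normed_vector"
  where "formal_deriv_apply \<xi> Y k =
    (\<lambda>y. \<Sum>j\<le>k. frechet_derivative (\<xi> (Suc j)) (at y) (Y (k - j) y))"

definition formally_conjugated :: "('v \<Rightarrow> 'v) \<Rightarrow> ('v \<Rightarrow> 'v::real_normed_vector) \<Rightarrow> bool"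
  where "formally_conjugated Y X \<longleftrightarrow>
    (\<exists>\<xi>. formal_map \<xi> \<and> \<xi> 0 = (\<lambda>_. 0) \<and> bij (\<xi> 1) \<and>
       formal_deriv_apply \<xi> (taylor Y) = formal_compose (taylor X) \<xi>)"


section \<open>Normal forms\<close>

definition gradient_wrt :: "('m::finite \<Rightarrow> 'v::real_normed_vector) \<Rightarrow> ('v \<Rightarrow> real) \<Rightarrow> 'v \<Rightarrow> 'v"
  where "gradient_wrt e H x = (\<Sum>i\<in>UNIV. dderiv (e i) H x *\<^sub>R e i)"

definition hessian_wrt ::
    "('m::finite \<Rightarrow> 'v::real_normed_vector) \<Rightarrow> ('v \<Rightarrow> real) \<Rightarrow> 'v \<Rightarrow> real^'m^'m"
  where "hessian_wrt e H x = (\<chi> i j. dderiv (e i) (dderiv (e j) H) x)"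

definition hess_quad :: "('m::finite \<Rightarrow> 'v::real_normed_vector) \<Rightarrow> ('v \<Rightarrow> real) \<Rightarrow> 'v \<Rightarrow> real"
  where "hess_quad e H = (\<lambda>x. (1 / 2) * (coords e x \<bullet> (hessian_wrt e H 0 *v coords e x)))"

text \<open>The components \<open>K\<^sup>3, \<dots>, K\<^sup>r\<close> of a normal form of \<open>H\<close>, relative to a choice of complements
  \<open>D k\<close> of the range of \<open>ad\<^bsub>H\<^sup>2\<^esub>\<close> in degree \<open>k\<close>.\<close>

definition normal_form_components ::
    "('v::real_normed_vector \<Rightarrow> 'v \<Rightarrow> real) \<Rightarrow> ('m::finite \<Rightarrow> 'v) \<Rightarrow> (nat \<Rightarrow> ('v \<Rightarrow> real) set) \<Rightarrow>
      ('v \<Rightarrow> real) \<Rightarrow> nat \<Rightarrow> (nat \<Rightarrow> 'v \<Rightarrow> real) \<Rightarrow> bool"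
  where "normal_form_components \<omega> e D H r K \<longleftrightarrow>
    (\<forall>k\<in>{3..r}.
       linear_complement (hom_poly k) ((\<lambda>F. poisson \<omega> F (hess_quad e H)) ` hom_poly k) (D k)) \<and>
    (\<forall>k\<in>{3..r}. K k \<in> D k) \<and>
    (\<exists>Y. (\<exists>U. open U \<and> 0 \<in> U \<and> smooth_on U Y) \<and> Y 0 = 0 \<and>
       (\<lambda>y. norm (Y y -
          (frechet_derivative (ham_vf \<omega> H) (at 0) y + (\<Sum>k=3..r. ham_vf \<omega> (K k) y))))
         \<in> O[at 0](\<lambda>y. norm y ^ r) \<and>
       formally_conjugated (ham_vf \<omega> H) Y)"

definition hamiltonian_normal_form ::
    "('v::real_normed_vector \<Rightarrow> 'v \<Rightarrow> real) \<Rightarrow> ('m::finite \<Rightarrow> 'v) \<Rightarrow> (nat \<Rightarrow> ('v \<Rightarrow> real) set) \<Rightarrow>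
      ('v \<Rightarrow> real) \<Rightarrow> nat \<Rightarrow> ('v \<Rightarrow> real) \<Rightarrow> bool"
  where "hamiltonian_normal_form \<omega> e D H r K \<longleftrightarrow>
    (\<exists>Kc. normal_form_components \<omega> e D H r Kc \<and> K = (\<lambda>x. hess_quad e H x + (\<Sum>k=3..r. Kc k x)))"

definition vf_normal_form ::
    "('v::real_normed_vector \<Rightarrow> 'v \<Rightarrow> real) \<Rightarrow> ('m::finite \<Rightarrow> 'v) \<Rightarrow> (nat \<Rightarrow> ('v \<Rightarrow> real) set) \<Rightarrow>
      ('v \<Rightarrow> 'v) \<Rightarrow> nat \<Rightarrow> ('v \<Rightarrow> 'v) \<Rightarrow> bool"
  where "vf_normal_form \<omega> e D X s Z \<longleftrightarrow>
    (\<exists>H Kc. smooth_on UNIV H \<and> X = ham_vf \<omega> H \<and> H 0 = 0 \<and> gradient_wrt e H 0 = 0 \<and>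
       normal_form_components \<omega> e D H (Suc s) Kc \<and>
       Z = (\<lambda>y. frechet_derivative X (at 0) y + (\<Sum>k=3..Suc s. ham_vf \<omega> (Kc k) y)))"

end

theory Submission
  imports Defs
begin

text \<open>
  In degree \<open>k\<close> the operator \<open>f \<mapsto> {f, H\<^sup>2}\<close> is the Lie derivative \<open>f \<mapsto> df(Lx)\<close>, whose adjoint for
  the Fischer inner product is \<open>f \<mapsto> df(L\<^sup>Tx)\<close>; the kernel of the latter consists of the
  \<open>\<^bold>S\<close>-invariants, which are therefore a complement of the range. The homological equation
  \<open>w = {G, H\<^sup>2} + Q\<close> has a unique solution with \<open>Q\<close> in this kernel and \<open>G\<close> in the range of the adjoint,
  so \<open>Q\<close> and \<open>G\<close> inherit the symmetries of \<open>w\<close> and no averaging over \<open>\<Gamma>\<close> is needed.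

  Instead of composing Lie transforms, one single symplectic map is used, the implicit midpoint map
  \<open>\<phi> : z - X\<^sub>F(z)/2 \<mapsto> z + X\<^sub>F(z)/2\<close> of an unknown polynomial \<open>F\<close>. The condition
  \<open>H \<circ> \<phi> = K + O(|x|\<^bsup>r+1\<^esup>)\<close> reads \<open>H(z + X\<^sub>F/2) - K(z - X\<^sub>F/2) = O(|z|\<^bsup>r+1\<^esup>)\<close> and is solved
  degree by degree for \<open>F\<close> and \<open>K\<close>. Since \<open>\<phi>\<close> is a smooth local symplectomorphism, the Hamiltonian
  vector field of \<open>H \<circ> \<phi>\<close> is smoothly, hence formally, conjugate to \<open>X\<close>.
\<close>

section \<open>Smooth maps\<close>

text \<open>A change of coordinates by a Hamiltonian flow would call for solutions of differential
  equations and their smooth dependence on initial values. With the midpoint map nothing is even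
  inverted while \<open>F\<close> and \<open>K\<close> are built: the condition involves only
  composites of \<open>H\<close> and \<open>K\<close> with the maps \<open>mid t F\<close>, and
  local inverses enter once, at the end. The map is symplectic for the reason the Cayley transform
  is: the derivative of a Hamiltonian field is skew for \<open>\<omega>\<close>, so both halves pull
  \<open>\<omega>\<close> back to the same form.

  Elements of the group may reverse \<open>\<omega>\<close> as well as time, hence two characters.
  \<open>F\<close> must change by \<open>\<sigma>\<^sub>1\<close> alone: the sign of
  \<open>F\<close> then cancels that of \<open>\<omega>\<close>, and the field of \<open>F\<close>
  commutes with the group. \<open>K\<close> must change by
  \<open>\<sigma>\<^sub>1 \<sigma>\<^sub>2\<close>, as \<open>H\<close> does. The homological
  equation is compatible with this because \<open>L\<close> commutes with a group element up to
  \<open>\<sigma>\<^sub>2\<close>. The transpose of \<open>L\<close> has to satisfy the same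
  relation, which holds because the group is orthogonal in the chosen basis.\<close>

lemma dderiv_eq: "(f has_derivative f') (at x) \<Longrightarrow> dderiv v f x = f' v"
  using frechet_derivative_at[of f f' x] by (simp add: dderiv_def)

lemma has_derivative_dderiv:
  "f differentiable at x \<Longrightarrow> (f has_derivative (\<lambda>v. dderiv v f x)) (at x)"
  by (simp add: dderiv_def frechet_derivative_works[symmetric])

lemma bounded_linear_dderiv: "f differentiable at x \<Longrightarrow> bounded_linear (\<lambda>v. dderiv v f x)"
  using has_derivative_dderiv has_derivative_bounded_linear by blast

lemma linear_dderiv: "f differentiable at x \<Longrightarrow> linear (\<lambda>v. dderiv v f x)"
  using bounded_linear_dderiv bounded_linear.linear by blast

lemma dderiv_scaleR_left: "f differentiable at x \<Longrightarrow> dderiv (c *\<^sub>R v) f x = c *\<^sub>R dderiv v f x"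
  by (rule linear_scale[OF linear_dderiv])

text \<open>\<open>C_diff_on\<close> differentiates along fixed vectors, whereas the chain rule
  produces directions that vary with the point. Expansion along \<open>Basis\<close> moves the
  variation into scalar coefficients.\<close>

lemma dderiv_expand:
  fixes v :: "'a::euclidean_space"
  assumes "f differentiable at x"
  shows "dderiv v f x = (\<Sum>b\<in>Basis. (v \<bullet> b) *\<^sub>R dderiv b f x)"
proof -
  have "dderiv v f x = dderiv (\<Sum>b\<in>Basis. (v \<bullet> b) *\<^sub>R b) f x"
    by (simp add: euclidean_representation)
  also have "\<dots> = (\<Sum>b\<in>Basis. (v \<bullet> b) *\<^sub>R dderiv b f x)"
    by (simp add: linear_sum[OF linear_dderiv[OF assms]] dderiv_scaleR_left[OF assms])
  finally show ?thesis .
qed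

lemma dderiv_const [simp]: "dderiv v (\<lambda>x. c) = (\<lambda>x. 0)"
  by (rule ext, rule dderiv_eq[OF has_derivative_const])

lemma dderiv_bounded_linear: "bounded_linear f \<Longrightarrow> dderiv v f = (\<lambda>x. f v)"
  by (rule ext, rule dderiv_eq[OF bounded_linear_imp_has_derivative])

lemma dderiv_add:
  "f differentiable at x \<Longrightarrow> g differentiable at x \<Longrightarrow>
    dderiv v (\<lambda>y. f y + g y) x = dderiv v f x + dderiv v g x"
  by (rule dderiv_eq[OF has_derivative_add[OF has_derivative_dderiv has_derivative_dderiv]])

lemma dderiv_diff:
  "f differentiable at x \<Longrightarrow> g differentiable at x \<Longrightarrow>
    dderiv v (\<lambda>y. f y - g y) x = dderiv v f x - dderiv v g x"
  by (rule dderiv_eq[OF has_derivative_diff[OF has_derivative_dderiv has_derivative_dderiv]])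

lemma dderiv_linear_compose:
  "bounded_linear h \<Longrightarrow> f differentiable at x \<Longrightarrow> dderiv v (\<lambda>y. h (f y)) x = h (dderiv v f x)"
  by (rule dderiv_eq[OF bounded_linear.has_derivative[OF _ has_derivative_dderiv]])

lemma dderiv_sum:
  assumes "\<And>i. i \<in> I \<Longrightarrow> f i differentiable at x"
  shows "dderiv v (\<lambda>y. \<Sum>i\<in>I. f i y) x = (\<Sum>i\<in>I. dderiv v (f i) x)"
  by (rule dderiv_eq[OF has_derivative_sum[OF has_derivative_dderiv[OF assms]]])

lemma (in bounded_bilinear) dderiv:
  "f differentiable at x \<Longrightarrow> g differentiable at x \<Longrightarrow>
    dderiv v (\<lambda>y. prod (f y) (g y)) x = prod (f x) (dderiv v g x) + prod (dderiv v f x) (g x)"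
  by (rule dderiv_eq[OF FDERIV[OF has_derivative_dderiv has_derivative_dderiv]])

lemma (in bounded_bilinear) differentiable:
  assumes "f differentiable at x" "g differentiable at x"
  shows "(\<lambda>y. prod (f y) (g y)) differentiable at x"
proof -
  obtain f' g' where "(f has_derivative f') (at x)" "(g has_derivative g') (at x)"
    using assms unfolding differentiable_def by blast
  from FDERIV[OF this] show ?thesis
    unfolding differentiable_def by blast
qed

lemmas dderiv_mult = bounded_bilinear.dderiv[OF bounded_bilinear_mult]

lemma dderiv_compose:
  assumes "f differentiable at x" "g differentiable at (f x)"
  shows "dderiv v (\<lambda>y. g (f y)) x = dderiv (dderiv v f x) g (f x)"
  by (rule dderiv_eq, rule has_derivative_compose[OF has_derivative_dderiv has_derivative_dderiv])
    (use assms in auto)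

lemma differentiable_transform_open:
  assumes "open S" "x \<in> S" "\<And>y. y \<in> S \<Longrightarrow> f y = g y" "f differentiable at x"
  shows "g differentiable at x" and "dderiv v g x = dderiv v f x"
proof -
  have *: "(g has_derivative (\<lambda>v. dderiv v f x)) (at x)"
    using has_derivative_transform_within_open[OF has_derivative_dderiv[OF assms(4)] assms(1,2)]
      assms(3) by auto
  show "g differentiable at x" using * by (auto simp: differentiable_def)
  show "dderiv v g x = dderiv v f x" by (rule dderiv_eq[OF *])
qed

text \<open>Derivative formulas are available only at points of \<open>S\<close>, while
  \<open>dderiv\<close> gives a function on the whole space; openness lets agreement on
  \<open>S\<close> pass to derivatives.\<close>

lemma C_diff_on_cong:
  assumes "open S" "\<And>x. x \<in> S \<Longrightarrow> f x = g x" "C_diff_on k S f"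
  shows "C_diff_on k S g"
  using assms
proof (induction k arbitrary: f g)
  case 0
  then show ?case by (auto cong: continuous_on_cong)
next
  case (Suc k)
  have d: "g differentiable at x" "dderiv v g x = dderiv v f x" if "x \<in> S" for x v
    using differentiable_transform_open[OF Suc.prems(1) that, of f g] Suc.prems that by auto
  have "C_diff_on k S (dderiv v g)" for v
    by (rule Suc.IH[of "dderiv v f"]) (use Suc.prems d in auto)
  with d show ?case by auto
qed

lemma C_diff_on_subset: "C_diff_on k S f \<Longrightarrow> T \<subseteq> S \<Longrightarrow> C_diff_on k T f"
  by (induction k arbitrary: f) (auto intro: continuous_on_subset)

text \<open>The recursive definition records continuity only at its bottom level, so monotonicity in
  the order rests on differentiable functions being continuous.\<close>

lemma C_diff_on_SucD: "C_diff_on (Suc k) S f \<Longrightarrow> C_diff_on k S f"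
proof (induction k arbitrary: f)
  case 0
  then show ?case
    by (auto intro!: continuous_at_imp_continuous_on differentiable_imp_continuous_within)
next
  case (Suc k)
  then show ?case by (metis C_diff_on.simps(2))
qed

lemma C_diff_on_const [simp]: "C_diff_on k S (\<lambda>x. c)"
  by (induction k arbitrary: c) auto

lemma C_diff_on_linear: "bounded_linear f \<Longrightarrow> C_diff_on k S f"
  by (cases k) (auto simp: dderiv_bounded_linear linear_continuous_on bounded_linear_imp_differentiable)

lemma C_diff_on_add:
  assumes "open S" "C_diff_on k S f" "C_diff_on k S g"
  shows "C_diff_on k S (\<lambda>x. f x + g x)"
  using assms
proof (induction k arbitrary: f g)
  case 0
  then show ?case by (auto intro: continuous_on_add)
next
  case (Suc k)
  have "C_diff_on k S (dderiv v (\<lambda>x. f x + g x))" for v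
    by (rule C_diff_on_cong[OF Suc.prems(1) _ Suc.IH[of "dderiv v f" "dderiv v g"]])
      (use Suc.prems in \<open>auto simp: dderiv_add\<close>)
  with Suc.prems show ?case by auto
qed

lemma C_diff_on_linear_compose:
  assumes S: "open S" and h: "bounded_linear h" and "C_diff_on k S f"
  shows "C_diff_on k S (\<lambda>x. h (f x))"
  using assms(3)
proof (induction k arbitrary: f)
  case 0
  then show ?case by (simp add: bounded_linear.continuous_on[OF h])
next
  case (Suc k)
  have fd: "f differentiable at x" if "x \<in> S" for x
    using Suc.prems that by simp
  have df: "C_diff_on k S (dderiv v f)" for v
    using Suc.prems by simp
  have "C_diff_on k S (dderiv v (\<lambda>x. h (f x)))" for v
    by (rule C_diff_on_cong[OF S _ Suc.IH[OF df[of v]]]) (simp add: dderiv_linear_compose[OF h fd])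
  moreover have "(\<lambda>x. h (f x)) differentiable at x" if "x \<in> S" for x
    using bounded_linear.has_derivative[OF h has_derivative_dderiv[OF fd[OF that]]]
    unfolding differentiable_def by blast
  ultimately show ?case unfolding C_diff_on.simps by blast
qed

lemma (in bounded_bilinear) C_diff_on:
  assumes S: "open S" and "C_diff_on k S f" "C_diff_on k S g"
  shows "C_diff_on k S (\<lambda>x. prod (f x) (g x))"
  using assms(2,3)
proof (induction k arbitrary: f g)
  case 0
  then show ?case unfolding C_diff_on.simps by (rule continuous_on)
next
  case (Suc k)
  have d: "f differentiable at x" "g differentiable at x" if "x \<in> S" for x
    using Suc.prems that by simp_all
  have dk: "C_diff_on k S (dderiv v f)" "C_diff_on k S (dderiv v g)" for v
    using Suc.prems by simp_all
  have low: "C_diff_on k S f" "C_diff_on k S g"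
    using C_diff_on_SucD[OF Suc.prems(1)] C_diff_on_SucD[OF Suc.prems(2)] by simp_all
  have "C_diff_on k S (dderiv v (\<lambda>x. prod (f x) (g x)))" for v
    by (rule C_diff_on_cong[OF S _ C_diff_on_add[OF S Suc.IH[OF low(1) dk(2)[of v]]
            Suc.IH[OF dk(1)[of v] low(2)]]]) (simp only: dderiv[OF d])
  moreover have "(\<lambda>x. prod (f x) (g x)) differentiable at x" if "x \<in> S" for x
    by (rule differentiable[OF d[OF that]])
  ultimately show ?case unfolding C_diff_on.simps by blast
qed

lemmas C_diff_on_mult = bounded_bilinear.C_diff_on[OF bounded_bilinear_mult]
lemmas C_diff_on_scaleR = bounded_bilinear.C_diff_on[OF bounded_bilinear_scaleR]

lemma C_diff_on_sum:
  assumes "open S" "\<And>i. i \<in> I \<Longrightarrow> C_diff_on k S (f i)"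
  shows "C_diff_on k S (\<lambda>x. \<Sum>i\<in>I. f i x)"
  using assms(2) by (induction I rule: infinite_finite_induct) (auto intro: C_diff_on_add[OF assms(1)])

lemma C_diff_on_prod:
  fixes f :: "'i \<Rightarrow> 'a::real_normed_vector \<Rightarrow> real"
  assumes "open S" "\<And>i. i \<in> I \<Longrightarrow> C_diff_on k S (f i)"
  shows "C_diff_on k S (\<lambda>x. \<Prod>i\<in>I. f i x)"
  using assms(2) by (induction I rule: infinite_finite_induct) (auto intro: C_diff_on_mult[OF assms(1)])

lemma C_diff_on_inverse:
  fixes f :: "'a::real_normed_vector \<Rightarrow> real"
  assumes "open S" "C_diff_on k S f" "\<And>x. x \<in> S \<Longrightarrow> f x \<noteq> 0"
  shows "C_diff_on k S (\<lambda>x. inverse (f x))"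
  using assms
proof (induction k arbitrary: f)
  case 0
  then show ?case by (auto intro: continuous_on_inverse)
next
  case (Suc k)
  have fd: "f differentiable at x" if "x \<in> S" for x
    using Suc.prems that by simp
  have df: "C_diff_on k S (dderiv v f)" for v
    using Suc.prems by simp
  have hd: "((\<lambda>x. inverse (f x)) has_derivative
      (\<lambda>v. - (inverse (f x) * dderiv v f x * inverse (f x)))) (at x)" if "x \<in> S" for x
    by (rule Deriv.has_derivative_inverse[OF Suc.prems(3)[OF that] has_derivative_dderiv[OF fd[OF that]]])
  \<comment> \<open>The derivative of the inverse contains the inverse itself, but only to one order
    less, which the induction hypothesis covers.\<close>
  have inv: "C_diff_on k S (\<lambda>x. inverse (f x))"
    by (rule Suc.IH[OF Suc.prems(1) C_diff_on_SucD[OF Suc.prems(2)] Suc.prems(3)])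
  have "C_diff_on k S (dderiv v (\<lambda>x. inverse (f x)))" for v
    by (rule C_diff_on_cong[OF Suc.prems(1) _ C_diff_on_linear_compose[OF Suc.prems(1)
          bounded_linear_minus[OF bounded_linear_ident] C_diff_on_mult[OF Suc.prems(1)
            C_diff_on_mult[OF Suc.prems(1) inv df[of v]] inv]]])
      (simp add: dderiv_eq[OF hd])
  with hd show ?case by (auto simp: differentiable_def)
qed

text \<open>The derivative at \<open>x\<close> is that of \<open>g\<close> along the moving
  direction \<open>dderiv v f x\<close>. Expanded along \<open>Basis\<close> it becomes a sum of
  products of a component of \<open>dderiv v f\<close> with \<open>dderiv b g\<close> composed with
  \<open>f\<close>, and the induction hypothesis applies to the latter.\<close>

lemma C_diff_on_compose:
  fixes f :: "'a::real_normed_vector \<Rightarrow> 'b::euclidean_space" and g :: "'b \<Rightarrow> 'c::real_normed_vector"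
  assumes S: "open S" and U: "open U" and fS: "f ` S \<subseteq> U"
    and "C_diff_on k S f" "C_diff_on k U g"
  shows "C_diff_on k S (\<lambda>x. g (f x))"
  using assms(4,5)
proof (induction k arbitrary: g)
  case 0
  then show ?case
    using continuous_on_compose2[of U g S f] fS by simp
next
  case (Suc k)
  have fd: "f differentiable at x" if "x \<in> S" for x
    using Suc.prems(1) that by simp
  have gd: "g differentiable at (f x)" if "x \<in> S" for x
    using Suc.prems(2) that fS by auto
  have df: "C_diff_on k S (dderiv v f)" for v
    using Suc.prems(1) by simp
  have dg: "C_diff_on k U (dderiv v g)" for v
    using Suc.prems(2) by simp
  have deriv: "((\<lambda>x. g (f x)) has_derivative (\<lambda>v. dderiv (dderiv v f x) g (f x))) (at x)" if "x \<in> S" for x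
    by (rule has_derivative_compose[of f "\<lambda>v. dderiv v f x" x UNIV g "\<lambda>v. dderiv v g (f x)"])
      (rule has_derivative_dderiv fd gd that)+
  have eq: "(\<Sum>b\<in>Basis. (dderiv v f x \<bullet> b) *\<^sub>R dderiv b g (f x)) = dderiv v (\<lambda>x. g (f x)) x"
    if "x \<in> S" for x v
    unfolding dderiv_eq[OF deriv[OF that]] by (rule dderiv_expand[OF gd[OF that], symmetric])
  have C: "C_diff_on k S (\<lambda>x. \<Sum>b\<in>Basis. (dderiv v f x \<bullet> b) *\<^sub>R dderiv b g (f x))" for v
  proof (rule C_diff_on_sum[OF S], rule C_diff_on_scaleR[OF S])
    fix b :: 'b
    show "C_diff_on k S (\<lambda>x. dderiv v f x \<bullet> b)"
      by (rule C_diff_on_linear_compose[OF S bounded_linear_inner_left df])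
    show "C_diff_on k S (\<lambda>x. dderiv b g (f x))"
      by (rule Suc.IH[OF C_diff_on_SucD[OF Suc.prems(1)] dg])
  qed
  have "C_diff_on k S (dderiv v (\<lambda>x. g (f x)))" for v
    by (rule C_diff_on_cong[OF S eq C])
  moreover have "(\<lambda>x. g (f x)) differentiable at x" if "x \<in> S" for x
    using deriv[OF that] unfolding differentiable_def by blast
  ultimately show ?case unfolding C_diff_on.simps by blast
qed

section \<open>Closure properties of smooth maps\<close>

lemma smooth_onD:
  assumes "smooth_on S f" "x \<in> S"
  shows "f differentiable at x"
proof -
  have "C_diff_on (Suc 0) S f"
    using assms(1) unfolding smooth_on_def ..
  with assms(2) show ?thesis by simp
qed

lemma smooth_on_dderiv: "smooth_on S f \<Longrightarrow> smooth_on S (dderiv v f)"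
  unfolding smooth_on_def
proof
  fix k assume "\<forall>k. C_diff_on k S f"
  then have "C_diff_on (Suc k) S f" ..
  then show "C_diff_on k S (dderiv v f)" by simp
qed

lemma smooth_on_continuous:
  assumes "smooth_on S f"
  shows "continuous_on S f"
proof -
  have "C_diff_on 0 S f"
    using assms unfolding smooth_on_def ..
  then show ?thesis by simp
qed

lemma smooth_on_subset: "smooth_on S f \<Longrightarrow> T \<subseteq> S \<Longrightarrow> smooth_on T f"
  unfolding smooth_on_def using C_diff_on_subset by blast

lemma smooth_on_cong:
  "open S \<Longrightarrow> smooth_on S f \<Longrightarrow> (\<And>x. x \<in> S \<Longrightarrow> f x = g x) \<Longrightarrow> smooth_on S g"
  unfolding smooth_on_def using C_diff_on_cong by blast

lemma smooth_on_const [simp]: "smooth_on S (\<lambda>x. c)"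
  by (simp add: smooth_on_def)

lemma smooth_on_linear: "bounded_linear f \<Longrightarrow> smooth_on S f"
  by (simp add: smooth_on_def C_diff_on_linear)

lemma smooth_on_add: "open S \<Longrightarrow> smooth_on S f \<Longrightarrow> smooth_on S g \<Longrightarrow> smooth_on S (\<lambda>x. f x + g x)"
  by (simp add: smooth_on_def C_diff_on_add)

lemma smooth_on_linear_compose:
  "open S \<Longrightarrow> bounded_linear h \<Longrightarrow> smooth_on S f \<Longrightarrow> smooth_on S (\<lambda>x. h (f x))"
  by (simp add: smooth_on_def C_diff_on_linear_compose)

lemma smooth_on_diff:
  assumes "open S" "smooth_on S f" "smooth_on S g"
  shows "smooth_on S (\<lambda>x. f x - g x)"
  using smooth_on_add[OF assms(1,2) smooth_on_linear_compose[OF assms(1)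
      bounded_linear_minus[OF bounded_linear_ident] assms(3)]] by simp

lemma smooth_on_scaleR:
  "open S \<Longrightarrow> smooth_on S f \<Longrightarrow> smooth_on S g \<Longrightarrow> smooth_on S (\<lambda>x. f x *\<^sub>R g x)"
  by (simp add: smooth_on_def C_diff_on_scaleR)

lemma smooth_on_mult:
  fixes f g :: "'a::real_normed_vector \<Rightarrow> real"
  shows "open S \<Longrightarrow> smooth_on S f \<Longrightarrow> smooth_on S g \<Longrightarrow> smooth_on S (\<lambda>x. f x * g x)"
  by (simp add: smooth_on_def C_diff_on_mult)

lemma smooth_on_sum:
  "open S \<Longrightarrow> (\<And>i. i \<in> I \<Longrightarrow> smooth_on S (f i)) \<Longrightarrow> smooth_on S (\<lambda>x. \<Sum>i\<in>I. f i x)"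
  by (simp add: smooth_on_def C_diff_on_sum)

lemma smooth_on_compose:
  fixes f :: "'a::real_normed_vector \<Rightarrow> 'b::euclidean_space"
  assumes "open S" "open U" "f ` S \<subseteq> U" "smooth_on S f" "smooth_on U g"
  shows "smooth_on S (\<lambda>x. g (f x))"
  using C_diff_on_compose[OF assms(1-3)] assms(4,5) unfolding smooth_on_def by blast

lemma smooth_on_componentwise:
  fixes f :: "'a::real_normed_vector \<Rightarrow> 'b::euclidean_space"
  assumes "open S" "\<And>b. b \<in> Basis \<Longrightarrow> smooth_on S (\<lambda>x. f x \<bullet> b)"
  shows "smooth_on S f"
proof -
  have "smooth_on S (\<lambda>x. \<Sum>b\<in>Basis. (f x \<bullet> b) *\<^sub>R b)"
    by (rule smooth_on_sum[OF assms(1) smooth_on_scaleR[OF assms(1) assms(2) smooth_on_const]])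
  then show ?thesis
    unfolding euclidean_representation .
qed

lemma smooth_on_real_polynomial: "real_polynomial_function f \<Longrightarrow> smooth_on UNIV f"
  by (induction f rule: real_polynomial_function.induct)
    (auto intro: smooth_on_add smooth_on_mult smooth_on_linear)

lemma smooth_on_polynomial:
  fixes f :: "'a::real_normed_vector \<Rightarrow> 'b::euclidean_space"
  shows "polynomial_function f \<Longrightarrow> smooth_on UNIV f"
  by (rule smooth_on_componentwise)
    (auto simp: polynomial_function_def o_def intro!: smooth_on_real_polynomial bounded_linear_inner_left)

lemma smooth_on_prod:
  fixes f :: "'i \<Rightarrow> 'a::real_normed_vector \<Rightarrow> real"
  shows "open S \<Longrightarrow> (\<And>i. i \<in> I \<Longrightarrow> smooth_on S (f i)) \<Longrightarrow> smooth_on S (\<lambda>x. \<Prod>i\<in>I. f i x)"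
  by (simp add: smooth_on_def C_diff_on_prod)

lemma smooth_on_inverse:
  fixes f :: "'a::real_normed_vector \<Rightarrow> real"
  shows "open S \<Longrightarrow> smooth_on S f \<Longrightarrow> (\<And>x. x \<in> S \<Longrightarrow> f x \<noteq> 0) \<Longrightarrow> smooth_on S (\<lambda>x. inverse (f x))"
  by (simp add: smooth_on_def C_diff_on_inverse)

text \<open>Prepares Cramer's rule, by which the inverse of a linear map depends smoothly on
  parameters.\<close>

lemma smooth_on_det:
  fixes A :: "'a::real_normed_vector \<Rightarrow> real^'m^'m"
  assumes S: "open S" and A: "\<And>i j. smooth_on S (\<lambda>x. A x $ i $ j)"
  shows "smooth_on S (\<lambda>x. det (A x))"
  unfolding det_def
  by (rule smooth_on_sum[OF S smooth_on_mult[OF S smooth_on_const smooth_on_prod[OF S A]]])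

section \<open>Symmetry of second derivatives\<close>

lemma has_real_derivative_line:
  fixes f :: "'a::real_normed_vector \<Rightarrow> real"
  assumes "f differentiable at (a + s *\<^sub>R u)"
  shows "((\<lambda>s. f (a + s *\<^sub>R u)) has_real_derivative dderiv u f (a + s *\<^sub>R u)) (at s)"
proof -
  have l: "((\<lambda>s. a + s *\<^sub>R u) has_derivative (\<lambda>t. t *\<^sub>R u)) (at s)"
    by (auto intro!: derivative_eq_intros)
  have "((\<lambda>s. f (a + s *\<^sub>R u)) has_derivative (\<lambda>t. dderiv (t *\<^sub>R u) f (a + s *\<^sub>R u))) (at s)"
    by (rule has_derivative_compose[of "\<lambda>s. a + s *\<^sub>R u" "\<lambda>t. t *\<^sub>R u" s UNIV f
        "\<lambda>v. dderiv v f (a + s *\<^sub>R u)"]) (rule l has_derivative_dderiv assms)+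
  moreover have "(\<lambda>t. dderiv (t *\<^sub>R u) f (a + s *\<^sub>R u)) = (*) (dderiv u f (a + s *\<^sub>R u))"
    by (simp add: dderiv_scaleR_left[OF assms] fun_eq_iff mult.commute)
  ultimately show ?thesis by (simp add: has_field_derivative_def)
qed

text \<open>The mean value theorem is applied twice, along \<open>u\<close> to the difference of
  \<open>f\<close> on two parallel segments and then along \<open>v\<close>. The second difference
  is unchanged when \<open>u\<close> and \<open>v\<close> are exchanged, whereas the derivative on
  the right is not visibly so.\<close>

lemma mixed_difference:
  fixes f :: "'a::real_normed_vector \<Rightarrow> real"
  assumes f: "smooth_on (ball x r) f" and h: "0 < h" "h * (norm u + norm v) < r"
  obtains p where "norm (p - x) \<le> h * (norm u + norm v)"
    "f (x + h *\<^sub>R u + h *\<^sub>R v) - f (x + h *\<^sub>R u) - f (x + h *\<^sub>R v) + f x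
      = h * (h * dderiv v (dderiv u f) p)"
proof -
  have near: "norm (s *\<^sub>R u + t *\<^sub>R v) \<le> h * (norm u + norm v)" if "0 \<le> s" "s \<le> h" "0 \<le> t" "t \<le> h" for s t
  proof -
    have "norm (s *\<^sub>R u + t *\<^sub>R v) \<le> s * norm u + t * norm v"
      using norm_triangle_ineq[of "s *\<^sub>R u" "t *\<^sub>R v"] that by simp
    also have "\<dots> \<le> h * norm u + h * norm v"
      by (intro add_mono mult_right_mono) (use that in auto)
    finally show ?thesis by (simp add: algebra_simps)
  qed
  have inb: "x + s *\<^sub>R u + t *\<^sub>R v \<in> ball x r" if "0 \<le> s" "s \<le> h" "0 \<le> t" "t \<le> h" for s t
  proof -
    have "dist x (x + s *\<^sub>R u + t *\<^sub>R v) = norm (s *\<^sub>R u + t *\<^sub>R v)"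
      using norm_minus_cancel[of "s *\<^sub>R u + t *\<^sub>R v"] by (simp add: dist_norm algebra_simps)
    then show ?thesis using near[OF that] h(2) by simp
  qed
  define \<phi> where "\<phi> s = f (x + h *\<^sub>R v + s *\<^sub>R u) - f (x + s *\<^sub>R u)" for s
  have D: "(\<phi> has_real_derivative dderiv u f (x + h *\<^sub>R v + s *\<^sub>R u) - dderiv u f (x + s *\<^sub>R u)) (at s)"
    if "0 \<le> s" "s \<le> h" for s
    unfolding \<phi>_def
    by (intro DERIV_diff has_real_derivative_line smooth_onD[OF f])
      (use inb[OF that, of h] inb[OF that, of 0] h in \<open>simp_all add: algebra_simps\<close>)
  obtain s where s: "0 < s" "s < h"
    "\<phi> h - \<phi> 0 = (h - 0) * (dderiv u f (x + h *\<^sub>R v + s *\<^sub>R u) - dderiv u f (x + s *\<^sub>R u))"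
    using MVT2[OF h(1), of \<phi> "\<lambda>s. dderiv u f (x + h *\<^sub>R v + s *\<^sub>R u) - dderiv u f (x + s *\<^sub>R u)"] D by auto
  have D2: "((\<lambda>t. dderiv u f (x + s *\<^sub>R u + t *\<^sub>R v)) has_real_derivative
      dderiv v (dderiv u f) (x + s *\<^sub>R u + t *\<^sub>R v)) (at t)" if "0 \<le> t" "t \<le> h" for t
    by (intro has_real_derivative_line smooth_onD[OF smooth_on_dderiv[OF f]] inb) (use s that in auto)
  obtain t where t: "0 < t" "t < h"
    "dderiv u f (x + s *\<^sub>R u + h *\<^sub>R v) - dderiv u f (x + s *\<^sub>R u + 0 *\<^sub>R v)
      = (h - 0) * dderiv v (dderiv u f) (x + s *\<^sub>R u + t *\<^sub>R v)"
    using MVT2[OF h(1), of "\<lambda>t. dderiv u f (x + s *\<^sub>R u + t *\<^sub>R v)"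
      "\<lambda>t. dderiv v (dderiv u f) (x + s *\<^sub>R u + t *\<^sub>R v)"] D2 by auto
  show ?thesis
  proof
    show "norm (x + s *\<^sub>R u + t *\<^sub>R v - x) \<le> h * (norm u + norm v)"
      using near[of s t] s t by (simp add: algebra_simps)
    have e: "x + h *\<^sub>R v + s *\<^sub>R u = x + s *\<^sub>R u + h *\<^sub>R v" for s by simp
    show "f (x + h *\<^sub>R u + h *\<^sub>R v) - f (x + h *\<^sub>R u) - f (x + h *\<^sub>R v) + f x
      = h * (h * dderiv v (dderiv u f) (x + s *\<^sub>R u + t *\<^sub>R v))"
      using s(3) t(3) unfolding \<phi>_def e by simp
  qed
qed

text \<open>Both mixed derivatives, each at some point near \<open>x\<close>, equal one and the same
  second difference divided by \<open>h * h\<close>; by continuity their values at \<open>x\<close>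
  cannot differ.\<close>

lemma dderiv_commute_real:
  fixes f :: "'a::real_normed_vector \<Rightarrow> real"
  assumes S: "open S" and f: "smooth_on S f" and x: "x \<in> S"
  shows "dderiv u (dderiv v f) x = dderiv v (dderiv u f) x"
proof (rule ccontr)
  let ?A = "dderiv v (dderiv u f)" and ?B = "dderiv u (dderiv v f)"
  assume ne: "?B x \<noteq> ?A x"
  \<comment> \<open>Half the gap: two deviations below \<open>\<epsilon>\<close> cannot bridge
    it.\<close>
  define \<epsilon> where "\<epsilon> = \<bar>?A x - ?B x\<bar> / 2"
  have \<epsilon>: "\<epsilon> > 0" using ne by (simp add: \<epsilon>_def)
  obtain r where r: "r > 0" "ball x r \<subseteq> S"
    using S x by (auto simp: open_contains_ball)
  have fr: "smooth_on (ball x r) f" using smooth_on_subset[OF f r(2)] .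
  have "isCont ?A x" "isCont ?B x"
    using smooth_on_continuous[OF smooth_on_dderiv[OF smooth_on_dderiv[OF f]]] S x
    by (auto simp: continuous_on_eq_continuous_at)
  then obtain d1 d2 where d: "d1 > 0" "d2 > 0"
    "\<And>y. dist y x < d1 \<Longrightarrow> dist (?A y) (?A x) < \<epsilon>" "\<And>y. dist y x < d2 \<Longrightarrow> dist (?B y) (?B x) < \<epsilon>"
    using \<epsilon> unfolding continuous_at_eps_delta by metis
  define m where "m = min r (min d1 d2)"
  \<comment> \<open>The summand 1 keeps the denominator positive when \<open>u\<close> and
    \<open>v\<close> vanish; the factor 2 makes the inequality with \<open>m\<close> strict.\<close>
  define h where "h = m / (2 * (norm u + norm v + 1))"
  have m: "m > 0" using r d by (simp add: m_def)
  have n: "norm u + norm v + 1 > 0" using norm_ge_zero[of u] norm_ge_zero[of v] by linarith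
  have h: "h > 0" using m n by (simp add: h_def)
  have "h * (norm u + norm v) \<le> h * (norm u + norm v + 1)" using h by simp
  also have "\<dots> = m / 2" using n by (simp add: h_def field_simps)
  also have "\<dots> < m" using m by simp
  finally have hm: "h * (norm u + norm v) < m" .
  then have hr: "h * (norm u + norm v) < r" "h * (norm v + norm u) < r"
    by (simp_all add: m_def add.commute)
  obtain p where p: "norm (p - x) \<le> h * (norm u + norm v)"
    "f (x + h *\<^sub>R u + h *\<^sub>R v) - f (x + h *\<^sub>R u) - f (x + h *\<^sub>R v) + f x = h * (h * ?A p)"
    using mixed_difference[OF fr h hr(1)] by blast
  obtain q where q: "norm (q - x) \<le> h * (norm v + norm u)"
    "f (x + h *\<^sub>R v + h *\<^sub>R u) - f (x + h *\<^sub>R v) - f (x + h *\<^sub>R u) + f x = h * (h * ?B q)"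
    using mixed_difference[OF fr h hr(2)] by blast
  have e: "x + h *\<^sub>R v + h *\<^sub>R u = x + h *\<^sub>R u + h *\<^sub>R v" by simp
  have "h * (h * ?A p) = h * (h * ?B q)" using p(2) q(2) unfolding e by linarith
  then have pq: "?A p = ?B q" using h by simp
  have "dist p x < d1" "dist q x < d2"
    using p(1) q(1) hm by (simp_all add: dist_norm m_def add.commute)
  then have "dist (?A p) (?A x) < \<epsilon>" "dist (?B q) (?B x) < \<epsilon>"
    by (simp_all only: d)
  then have "\<bar>?A x - ?B x\<bar> < 2 * \<epsilon>" using pq by (simp add: dist_real_def)
  then show False by (simp add: \<epsilon>_def)
qed

lemma dderiv_linear_compose_on:
  assumes "open S" "smooth_on S f" "x \<in> S" "bounded_linear h"
  shows "dderiv u (dderiv v (\<lambda>y. h (f y))) x = h (dderiv u (dderiv v f) x)"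
proof -
  have "dderiv u (dderiv v (\<lambda>y. h (f y))) x = dderiv u (\<lambda>y. h (dderiv v f y)) x"
  proof (rule differentiable_transform_open(2)[OF assms(1,3)])
    show "h (dderiv v f y) = dderiv v (\<lambda>y. h (f y)) y" if "y \<in> S" for y
      using dderiv_linear_compose[OF assms(4) smooth_onD[OF assms(2) that]] by simp
    show "(\<lambda>y. h (dderiv v f y)) differentiable at x"
      by (rule smooth_onD[OF smooth_on_linear_compose[OF assms(1,4) smooth_on_dderiv[OF assms(2)]] assms(3)])
  qed
  also have "\<dots> = h (dderiv u (dderiv v f) x)"
    by (rule dderiv_linear_compose[OF assms(4) smooth_onD[OF smooth_on_dderiv[OF assms(2)] assms(3)]])
  finally show ?thesis .
qed

lemma dderiv_commute:
  fixes f :: "'a::real_normed_vector \<Rightarrow> 'b::euclidean_space"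
  assumes S: "open S" and f: "smooth_on S f" and x: "x \<in> S"
  shows "dderiv u (dderiv v f) x = dderiv v (dderiv u f) x"
proof (rule euclidean_eqI)
  fix b :: 'b
  have "smooth_on S (\<lambda>y. f y \<bullet> b)"
    by (rule smooth_on_linear_compose[OF S bounded_linear_inner_left f])
  from dderiv_commute_real[OF S this x, of u v]
  show "dderiv u (dderiv v f) x \<bullet> b = dderiv v (dderiv u f) x \<bullet> b"
    by (simp only: dderiv_linear_compose_on[OF S f x bounded_linear_inner_left])
qed

section \<open>Taylor components\<close>

lemma smooth_on_iter_dderiv: "smooth_on S f \<Longrightarrow> smooth_on S ((dderiv x ^^ k) f)"
  by (induction k) (simp_all add: smooth_on_dderiv)

lemma iter_dderiv_cong:
  assumes "open S" "smooth_on S f" "\<And>y. y \<in> S \<Longrightarrow> f y = g y" "y \<in> S"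
  shows "(dderiv x ^^ k) g y = (dderiv x ^^ k) f y"
  using assms(4)
proof (induction k arbitrary: y)
  case 0
  then show ?case using assms(3) by simp
next
  case (Suc k)
  show ?case
    unfolding funpow.simps comp_def
    by (rule differentiable_transform_open(2)[OF assms(1) Suc.prems Suc.IH[symmetric]
          smooth_onD[OF smooth_on_iter_dderiv[OF assms(2)] Suc.prems]])
qed

lemma iter_dderiv_linear_compose:
  assumes S: "open S" and f: "smooth_on S f" and h: "bounded_linear h" and "y \<in> S"
  shows "(dderiv x ^^ k) (\<lambda>z. h (f z)) y = h ((dderiv x ^^ k) f y)"
  using assms(4)
proof (induction k arbitrary: y)
  case (Suc k)
  have d: "(dderiv x ^^ k) f differentiable at y"
    by (rule smooth_onD[OF smooth_on_iter_dderiv[OF f] Suc.prems])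
  have "dderiv x ((dderiv x ^^ k) (\<lambda>z. h (f z))) y = dderiv x (\<lambda>z. h ((dderiv x ^^ k) f z)) y"
    by (rule differentiable_transform_open(2)[OF S Suc.prems Suc.IH[symmetric]
          smooth_onD[OF smooth_on_linear_compose[OF S h smooth_on_iter_dderiv[OF f]] Suc.prems]])
  then show ?case
    by (simp add: dderiv_linear_compose[OF h d])
qed simp

lemma iter_dderiv_sum:
  assumes S: "open S" and f: "\<And>i. i \<in> I \<Longrightarrow> smooth_on S (f i)" and "y \<in> S"
  shows "(dderiv x ^^ k) (\<lambda>z. \<Sum>i\<in>I. f i z) y = (\<Sum>i\<in>I. (dderiv x ^^ k) (f i) y)"
  using assms(3)
proof (induction k arbitrary: y)
  case (Suc k)
  have d: "(dderiv x ^^ k) (f i) differentiable at y" if "i \<in> I" for i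
    by (rule smooth_onD[OF smooth_on_iter_dderiv[OF f[OF that]] Suc.prems])
  have s: "smooth_on S (\<lambda>z. \<Sum>i\<in>I. (dderiv x ^^ k) (f i) z)"
    by (rule smooth_on_sum[OF S smooth_on_iter_dderiv[OF f]])
  have "dderiv x ((dderiv x ^^ k) (\<lambda>z. \<Sum>i\<in>I. f i z)) y
      = dderiv x (\<lambda>z. \<Sum>i\<in>I. (dderiv x ^^ k) (f i) z) y"
    by (rule differentiable_transform_open(2)[OF S Suc.prems Suc.IH[symmetric] smooth_onD[OF s Suc.prems]])
  then show ?case
    by (simp add: dderiv_sum[OF d])
qed simp

lemma iter_dderiv_expand:
  fixes f :: "'a::euclidean_space \<Rightarrow> 'b::real_normed_vector"
  assumes S: "open S" and f: "smooth_on S f" and y: "y \<in> S"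
  shows "(dderiv x ^^ k) (dderiv v f) y = (\<Sum>b\<in>Basis. (v \<bullet> b) *\<^sub>R (dderiv x ^^ k) (dderiv b f) y)"
proof -
  have s: "smooth_on S (\<lambda>z. (v \<bullet> b) *\<^sub>R dderiv b f z)" for b
    by (rule smooth_on_linear_compose[OF S bounded_linear_scaleR_right smooth_on_dderiv[OF f]])
  have "(dderiv x ^^ k) (dderiv v f) y
      = (dderiv x ^^ k) (\<lambda>z. \<Sum>b\<in>Basis. (v \<bullet> b) *\<^sub>R dderiv b f z) y"
    by (rule iter_dderiv_cong[OF S smooth_on_sum[OF S s] _ y])
      (rule dderiv_expand[OF smooth_onD[OF f], symmetric])
  also have "\<dots> = (\<Sum>b\<in>Basis. (dderiv x ^^ k) (\<lambda>z. (v \<bullet> b) *\<^sub>R dderiv b f z) y)"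
    by (rule iter_dderiv_sum[OF S s y])
  also have "\<dots> = (\<Sum>b\<in>Basis. (v \<bullet> b) *\<^sub>R (dderiv x ^^ k) (dderiv b f) y)"
    by (simp only: iter_dderiv_linear_compose[OF S smooth_on_dderiv[OF f] bounded_linear_scaleR_right y])
  finally show ?thesis .
qed

text \<open>Peeling off the innermost derivative exhibits the iterated derivative as a polynomial in
  the direction \<open>x\<close> whose coefficients are of the same kind at lower order.
  Polynomiality, homogeneity and bounds in \<open>x\<close> follow by induction with
  \<open>f\<close> generalized.\<close>

lemma iter_dderiv_Suc_expand:
  fixes f :: "'a::euclidean_space \<Rightarrow> 'b::real_normed_vector"
  assumes "open S" "smooth_on S f" "y \<in> S"
  shows "(dderiv x ^^ Suc k) f y = (\<Sum>b\<in>Basis. (x \<bullet> b) *\<^sub>R (dderiv x ^^ k) (dderiv b f) y)"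
  unfolding funpow_Suc_right comp_def by (rule iter_dderiv_expand[OF assms])

text \<open>The variable is the direction \<open>x\<close>, not the base point. The iterated
  derivative is a symmetric multilinear form on the diagonal, and symmetry makes the contributions
  of its \<open>k\<close> slots equal.\<close>

lemma has_derivative_iter_dderiv:
  fixes f :: "'a::euclidean_space \<Rightarrow> 'b::euclidean_space"
  assumes S: "open S" and f: "smooth_on S f" and y: "y \<in> S"
  shows "((\<lambda>x. (dderiv x ^^ k) f y) has_derivative
    (\<lambda>v. real k *\<^sub>R (dderiv x ^^ (k - 1)) (dderiv v f) y)) (at x)"
  using f
proof (induction k arbitrary: f)
  case 0
  then show ?case by simp
next
  case (Suc k)
  note f = Suc.prems
  have "((\<lambda>x. \<Sum>b\<in>Basis. (x \<bullet> b) *\<^sub>R (dderiv x ^^ k) (dderiv b f) y) has_derivative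
    (\<lambda>v. \<Sum>b\<in>Basis. (x \<bullet> b) *\<^sub>R (real k *\<^sub>R (dderiv x ^^ (k - 1)) (dderiv v (dderiv b f)) y)
      + (v \<bullet> b) *\<^sub>R (dderiv x ^^ k) (dderiv b f) y)) (at x)"
    by (intro has_derivative_sum has_derivative_scaleR Suc.IH smooth_on_dderiv f
        bounded_linear_imp_has_derivative bounded_linear_inner_left)
  moreover have "(\<Sum>b\<in>Basis. (x \<bullet> b) *\<^sub>R (real k *\<^sub>R (dderiv x ^^ (k - 1)) (dderiv v (dderiv b f)) y)
      + (v \<bullet> b) *\<^sub>R (dderiv x ^^ k) (dderiv b f) y)
    = real (Suc k) *\<^sub>R (dderiv x ^^ k) (dderiv v f) y" for v
  proof -
    have c: "(dderiv x ^^ (k - 1)) (dderiv v (dderiv b f)) y = (dderiv x ^^ (k - 1)) (dderiv b (dderiv v f)) y" for b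
      by (rule iter_dderiv_cong[OF S smooth_on_dderiv[OF smooth_on_dderiv[OF f]] _ y])
        (rule dderiv_commute[OF S f])
    have "(\<Sum>b\<in>Basis. (x \<bullet> b) *\<^sub>R (real k *\<^sub>R (dderiv x ^^ (k - 1)) (dderiv v (dderiv b f)) y))
      = real k *\<^sub>R (\<Sum>b\<in>Basis. (x \<bullet> b) *\<^sub>R (dderiv x ^^ (k - 1)) (dderiv b (dderiv v f)) y)"
      unfolding c scaleR_sum_right by (simp add: mult.commute)
    \<comment> \<open>For \<open>k = 0\<close> the truncated exponent \<open>k - 1\<close> does no
      harm, because the factor \<open>real k\<close> vanishes.\<close>
    also have "\<dots> = real k *\<^sub>R (dderiv x ^^ k) (dderiv v f) y"
    proof (cases k)
      case (Suc j)
      then show ?thesis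
        using iter_dderiv_Suc_expand[OF S smooth_on_dderiv[OF f] y, symmetric] by simp
    qed simp
    finally show ?thesis
      unfolding sum.distrib iter_dderiv_expand[OF S f y, where x = x and k = k and v = v, symmetric]
      by (simp add: scaleR_left.add)
  qed
  ultimately show ?case
    unfolding iter_dderiv_Suc_expand[OF S f y] by simp
qed

lemma polynomial_function_iter_dderiv:
  fixes f :: "'a::euclidean_space \<Rightarrow> 'b::real_normed_vector"
  assumes S: "open S" and f: "smooth_on S f" and y: "y \<in> S"
  shows "polynomial_function (\<lambda>x. (dderiv x ^^ k) f y)"
  using f
proof (induction k arbitrary: f)
  case (Suc k)
  show ?case
    unfolding iter_dderiv_Suc_expand[OF S Suc.prems y]
    by (intro polynomial_function_sum polynomial_function_mult Suc.IH smooth_on_dderiv Suc.prems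
        polynomial_function_bounded_linear bounded_linear_inner_left finite_Basis)
qed simp

lemma iter_dderiv_scaleR:
  fixes f :: "'a::euclidean_space \<Rightarrow> 'b::real_normed_vector"
  assumes S: "open S" and f: "smooth_on S f" and y: "y \<in> S"
  shows "(dderiv (t *\<^sub>R x) ^^ k) f y = t ^ k *\<^sub>R (dderiv x ^^ k) f y"
  using f
proof (induction k arbitrary: f)
  case (Suc k)
  show ?case
    unfolding iter_dderiv_Suc_expand[OF S Suc.prems y] Suc.IH[OF smooth_on_dderiv[OF Suc.prems]]
    by (simp add: scaleR_sum_right mult_ac)
qed simp

text \<open>Uniformity in \<open>y\<close> serves Taylor's formula, whose remainder is evaluated at
  an unknown intermediate point.\<close>

lemma iter_dderiv_bound:
  fixes f :: "'a::euclidean_space \<Rightarrow> 'b::real_normed_vector"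
  assumes S: "open S" and f: "smooth_on S f" and K: "compact K" "K \<subseteq> S"
  obtains C where "\<And>x y. y \<in> K \<Longrightarrow> norm ((dderiv x ^^ k) f y) \<le> C * norm x ^ k"
proof -
  have "\<exists>C. \<forall>x. \<forall>y\<in>K. norm ((dderiv x ^^ k) f y) \<le> C * norm x ^ k"
    using f
  proof (induction k arbitrary: f)
    case 0
    have "bounded (f ` K)"
      by (rule compact_imp_bounded[OF compact_continuous_image[OF continuous_on_subset[OF
              smooth_on_continuous[OF 0] K(2)] K(1)]])
    then show ?case by (auto simp: bounded_iff)
  next
    case (Suc k)
    have "\<forall>b. \<exists>C. \<forall>x. \<forall>y\<in>K. norm ((dderiv x ^^ k) (dderiv b f) y) \<le> C * norm x ^ k"
      using Suc.IH[OF smooth_on_dderiv[OF Suc.prems]] by blast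
    then obtain C where C: "\<And>b x y. y \<in> K \<Longrightarrow> norm ((dderiv x ^^ k) (dderiv b f) y) \<le> C b * norm x ^ k"
      by metis
    have "norm ((dderiv x ^^ Suc k) f y) \<le> (\<Sum>b\<in>Basis. C b) * norm x ^ Suc k" if "y \<in> K" for x y
    proof -
      have yS: "y \<in> S" using that K by auto
      have "norm ((dderiv x ^^ Suc k) f y) \<le> (\<Sum>b\<in>Basis. norm ((x \<bullet> b) *\<^sub>R (dderiv x ^^ k) (dderiv b f) y))"
        unfolding iter_dderiv_Suc_expand[OF S Suc.prems yS] by (rule norm_sum)
      also have "\<dots> \<le> (\<Sum>b\<in>Basis. norm x * (C b * norm x ^ k))"
      proof (rule sum_mono)
        fix b :: 'a assume b: "b \<in> Basis"
        show "norm ((x \<bullet> b) *\<^sub>R (dderiv x ^^ k) (dderiv b f) y) \<le> norm x * (C b * norm x ^ k)"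
          unfolding norm_scaleR
          by (rule mult_mono) (use C[OF that] Basis_le_norm[OF b] in auto)
      qed
      finally show ?thesis by (simp add: sum_distrib_right sum_distrib_left mult_ac)
    qed
    then show ?case by blast
  qed
  then show ?thesis using that by blast
qed

section \<open>Vanishing order at the origin\<close>

text \<open>This is a Landau bound at the origin. The filter \<open>nhds 0\<close> includes the
  origin itself, so a positive order forces the value 0 there.\<close>

definition flat :: "nat \<Rightarrow> ('a::real_normed_vector \<Rightarrow> 'b::real_normed_vector) \<Rightarrow> bool"
  where "flat p f \<longleftrightarrow> (\<exists>C. \<forall>\<^sub>F x in nhds 0. norm (f x) \<le> C * norm x ^ p)"

lemma flatI: "(\<forall>\<^sub>F x in nhds 0. norm (f x) \<le> C * norm x ^ p) \<Longrightarrow> flat p f"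
  unfolding flat_def by blast

lemma flatE:
  assumes "flat p f"
  obtains C where "C > 0" "\<forall>\<^sub>F x in nhds 0. norm (f x) \<le> C * norm x ^ p"
proof -
  obtain C where C: "\<forall>\<^sub>F x in nhds 0. norm (f x) \<le> C * norm x ^ p"
    using assms unfolding flat_def by blast
  have "\<forall>\<^sub>F x in nhds 0. norm (f x) \<le> (\<bar>C\<bar> + 1) * norm x ^ p"
    using C
  proof eventually_elim
    case (elim x)
    have "C * norm x ^ p \<le> (\<bar>C\<bar> + 1) * norm x ^ p"
      by (rule mult_right_mono) auto
    with elim show ?case by linarith
  qed
  then show ?thesis using that[of "\<bar>C\<bar> + 1"] by simp
qed

lemma flat_cong:
  assumes "flat p f" "\<forall>\<^sub>F x in nhds 0. f x = g x"
  shows "flat p g"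
proof -
  obtain C where "\<forall>\<^sub>F x in nhds 0. norm (f x) \<le> C * norm x ^ p"
    using assms(1) by (rule flatE)
  then have "\<forall>\<^sub>F x in nhds 0. norm (g x) \<le> C * norm x ^ p"
    using assms(2) by eventually_elim simp
  then show ?thesis by (rule flatI)
qed

lemma eventually_cong_on:
  "open S \<Longrightarrow> 0 \<in> S \<Longrightarrow> (\<And>x. x \<in> S \<Longrightarrow> P x) \<Longrightarrow> \<forall>\<^sub>F x in nhds 0. P x"
  unfolding eventually_nhds by blast

lemma flat_zero [simp]: "flat p (\<lambda>x. 0)"
  by (rule flatI[of _ 0]) simp

lemma flat_add:
  assumes "flat p f" "flat p g"
  shows "flat p (\<lambda>x. f x + g x)"
proof -
  obtain C D where "\<forall>\<^sub>F x in nhds 0. norm (f x) \<le> C * norm x ^ p"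
    "\<forall>\<^sub>F x in nhds 0. norm (g x) \<le> D * norm x ^ p"
    using assms unfolding flat_def by blast
  then have "\<forall>\<^sub>F x in nhds 0. norm (f x + g x) \<le> (C + D) * norm x ^ p"
  proof eventually_elim
    case (elim x)
    then show ?case using norm_triangle_ineq[of "f x" "g x"] by (simp add: distrib_right)
  qed
  then show ?thesis by (rule flatI)
qed

lemma flat_linear_compose:
  assumes h: "bounded_linear h" and "flat p f"
  shows "flat p (\<lambda>x. h (f x))"
proof -
  obtain C where "\<forall>\<^sub>F x in nhds 0. norm (f x) \<le> C * norm x ^ p"
    using assms(2) by (rule flatE)
  then have "\<forall>\<^sub>F x in nhds 0. norm (h (f x)) \<le> (onorm h * C) * norm x ^ p"
  proof eventually_elim
    case (elim x)
    have "norm (h (f x)) \<le> onorm h * norm (f x)"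
      by (rule onorm[OF h])
    also have "\<dots> \<le> onorm h * (C * norm x ^ p)"
      by (rule mult_left_mono[OF elim onorm_pos_le[OF h]])
    finally show ?case by simp
  qed
  then show ?thesis by (rule flatI)
qed

lemma flat_minus: "flat p f \<Longrightarrow> flat p (\<lambda>x. - f x)"
  by (rule flat_linear_compose[OF bounded_linear_minus[OF bounded_linear_ident]])

lemma flat_diff: "flat p f \<Longrightarrow> flat p g \<Longrightarrow> flat p (\<lambda>x. f x - g x)"
  using flat_add[OF _ flat_minus, of p f g] by simp

lemma flat_sum: "(\<And>i. i \<in> I \<Longrightarrow> flat p (f i)) \<Longrightarrow> flat p (\<lambda>x. \<Sum>i\<in>I. f i x)"
  by (induction I rule: infinite_finite_induct) (auto intro: flat_add)

lemma (in bounded_bilinear) flat: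
  assumes "flat p f" "flat q g"
  shows "flat (p + q) (\<lambda>x. prod (f x) (g x))"
proof -
  obtain C where C: "C > 0" "\<forall>\<^sub>F x in nhds 0. norm (f x) \<le> C * norm x ^ p"
    using assms(1) by (rule flatE)
  obtain D where D: "D > 0" "\<forall>\<^sub>F x in nhds 0. norm (g x) \<le> D * norm x ^ q"
    using assms(2) by (rule flatE)
  obtain K where K: "K > 0" "\<And>a b. norm (prod a b) \<le> norm a * norm b * K"
    using pos_bounded by blast
  have "\<forall>\<^sub>F x in nhds 0. norm (prod (f x) (g x)) \<le> (C * D * K) * norm x ^ (p + q)"
    using C(2) D(2)
  proof eventually_elim
    case (elim x)
    have "norm (f x) * norm (g x) \<le> (C * norm x ^ p) * (D * norm x ^ q)"
      by (rule mult_mono) (use elim C(1) in auto)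
    then have "norm (f x) * norm (g x) * K \<le> (C * norm x ^ p) * (D * norm x ^ q) * K"
      using K(1) by (intro mult_right_mono) auto
    then show ?case
      using K(2)[of "f x" "g x"] by (simp add: power_add mult_ac)
  qed
  then show ?thesis by (rule flatI)
qed

lemma flat_mono:
  assumes "flat p f" "q \<le> p"
  shows "flat q f"
proof -
  obtain C where C: "C > 0" "\<forall>\<^sub>F x in nhds 0. norm (f x) \<le> C * norm x ^ p"
    using assms(1) by (rule flatE)
  have "\<forall>\<^sub>F x::'a in nhds 0. norm x < 1"
    by (rule eventually_cong_on[of "ball 0 1"]) auto
  with C(2) have "\<forall>\<^sub>F x in nhds 0. norm (f x) \<le> C * norm x ^ q"
  proof eventually_elim
    case (elim x)
    have "C * norm x ^ p \<le> C * norm x ^ q"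
      by (intro mult_left_mono power_decreasing) (use elim C(1) assms(2) in auto)
    with elim show ?case by linarith
  qed
  then show ?thesis by (rule flatI)
qed

lemma flat_1_tendsto:
  assumes "flat 1 u"
  shows "(u \<longlongrightarrow> 0) (nhds 0)"
proof -
  obtain C where C: "\<forall>\<^sub>F x in nhds 0. norm (u x) \<le> C * norm x ^ 1"
    using assms by (rule flatE)
  have "((\<lambda>x::'a. C * norm x ^ 1) \<longlongrightarrow> C * norm (0::'a) ^ 1) (nhds 0)"
    by (intro tendsto_intros filterlim_ident)
  then show ?thesis
    using Lim_null_comparison[OF C] by simp
qed

lemma flat_compose:
  assumes "flat p f" "flat 1 u"
  shows "flat p (\<lambda>x. f (u x))"
proof -
  obtain C where C: "C > 0" "\<forall>\<^sub>F x in nhds 0. norm (f x) \<le> C * norm x ^ p"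
    using assms(1) by (rule flatE)
  obtain D where D: "D > 0" "\<forall>\<^sub>F x in nhds 0. norm (u x) \<le> D * norm x ^ 1"
    using assms(2) by (rule flatE)
  have "\<forall>\<^sub>F x in nhds 0. norm (f (u x)) \<le> C * norm (u x) ^ p"
    by (rule eventually_compose_filterlim[OF C(2) flat_1_tendsto[OF assms(2)]])
  with D(2) have "\<forall>\<^sub>F x in nhds 0. norm (f (u x)) \<le> (C * D ^ p) * norm x ^ p"
  proof eventually_elim
    case (elim x)
    have "C * norm (u x) ^ p \<le> C * (D * norm x) ^ p"
      by (intro mult_left_mono power_mono) (use elim C(1) in auto)
    with elim show ?case by (simp add: power_mult_distrib mult.assoc)
  qed
  then show ?thesis by (rule flatI)
qed

lemma flat_0_isCont:
  assumes "isCont f 0"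
  shows "flat 0 f"
proof -
  obtain d where d: "d > 0" "\<And>x. dist x 0 < d \<Longrightarrow> dist (f x) (f 0) < 1"
    using assms zero_less_one unfolding continuous_at_eps_delta by blast
  have "norm (f x) \<le> (norm (f 0) + 1) * norm x ^ 0" if "x \<in> ball 0 d" for x
    using d(2)[of x] that norm_triangle_ineq2[of "f x" "f 0"] by (simp add: dist_norm)
  then show ?thesis
    using d(1) by (intro flatI eventually_cong_on[of "ball 0 d"]) auto
qed

lemma flat_componentwise:
  fixes f :: "'a::real_normed_vector \<Rightarrow> 'b::euclidean_space"
  assumes "\<And>b. b \<in> Basis \<Longrightarrow> flat p (\<lambda>x. f x \<bullet> b)"
  shows "flat p f"
proof -
  have "flat p (\<lambda>x. \<Sum>b\<in>Basis. (f x \<bullet> b) *\<^sub>R b)"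
    by (rule flat_sum[OF flat_linear_compose[OF bounded_linear_scaleR_left assms]])
  then show ?thesis unfolding euclidean_representation .
qed

section \<open>Homogeneous maps and the uniqueness of homogeneous expansions\<close>

definition homog :: "nat \<Rightarrow> ('a::real_normed_vector \<Rightarrow> 'b::real_normed_vector) \<Rightarrow> bool"
  where "homog k f \<longleftrightarrow> (\<forall>t x. f (t *\<^sub>R x) = t ^ k *\<^sub>R f x)"

lemma homogD: "homog k f \<Longrightarrow> f (t *\<^sub>R x) = t ^ k *\<^sub>R f x"
  by (simp add: homog_def)

lemma homog_bound:
  fixes f :: "'a::euclidean_space \<Rightarrow> 'b::real_normed_vector"
  assumes f: "homog k f" and c: "continuous_on UNIV f"
  obtains C where "\<And>x. norm (f x) \<le> C * norm x ^ k"
proof -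
  have "bounded (f ` cball 0 1)"
    by (rule compact_imp_bounded[OF compact_continuous_image[OF continuous_on_subset[OF c] compact_cball]]) simp
  then obtain C where "\<forall>y\<in>f ` cball 0 1. norm y \<le> C"
    unfolding bounded_iff by blast
  then have C: "norm (f x) \<le> C" if "norm x \<le> 1" for x
    using that by simp
  have "norm (f x) \<le> C * norm x ^ k" for x
  proof (cases "x = 0")
    case True
    then show ?thesis
      using C[of 0] homogD[OF f, of 0 0] by (cases k) auto
  next
    case False
    have "f x = norm x ^ k *\<^sub>R f ((1 / norm x) *\<^sub>R x)"
      using homogD[OF f, of "norm x" "(1 / norm x) *\<^sub>R x"] False by simp
    then have "norm (f x) = norm x ^ k * norm (f ((1 / norm x) *\<^sub>R x))"
      by (metis power_abs norm_scaleR abs_norm_cancel)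
    also have "\<dots> \<le> norm x ^ k * C"
      by (intro mult_left_mono C) (use False in auto)
    finally show ?thesis by (simp add: mult.commute)
  qed
  then show ?thesis using that by blast
qed

lemma flat_homog:
  fixes f :: "'a::euclidean_space \<Rightarrow> 'b::real_normed_vector"
  assumes "homog k f" "continuous_on UNIV f"
  shows "flat k f"
proof -
  obtain C where "\<And>x. norm (f x) \<le> C * norm x ^ k"
    using homog_bound[OF assms] by blast
  then show ?thesis by (intro flatI[of _ C]) simp
qed

text \<open>In the induction step the top term is itself bounded by a multiple of
  \<open>t ^ p\<close>, so the induction hypothesis kills the lower coefficients; dividing by
  \<open>t ^ p\<close> and letting \<open>t\<close> tend to 0 kills the last one.\<close>

lemma poly_coeffs_unique:
  fixes c :: "nat \<Rightarrow> 'b::real_normed_vector"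
  assumes "\<forall>\<^sub>F t in at_right 0. norm (\<Sum>j<p. t ^ j *\<^sub>R c j) \<le> C * t ^ p" "j < p"
  shows "c j = 0"
  using assms
proof (induction p arbitrary: C j)
  case (Suc p)
  have small: "\<forall>\<^sub>F t::real in at_right 0. 0 < t \<and> t < 1"
    by (rule eventually_at_rightI[of 0 1]) auto
  have "\<forall>\<^sub>F t in at_right 0. norm (\<Sum>j<p. t ^ j *\<^sub>R c j) \<le> (\<bar>C\<bar> + norm (c p)) * t ^ p"
    using Suc.prems(1) small
  proof eventually_elim
    case (elim t)
    have "(\<Sum>j<p. t ^ j *\<^sub>R c j) = (\<Sum>j<Suc p. t ^ j *\<^sub>R c j) - t ^ p *\<^sub>R c p" by simp
    then have "norm (\<Sum>j<p. t ^ j *\<^sub>R c j) \<le> norm (\<Sum>j<Suc p. t ^ j *\<^sub>R c j) + norm (t ^ p *\<^sub>R c p)"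
      by (metis norm_triangle_ineq4)
    also have "\<dots> \<le> C * t ^ Suc p + t ^ p * norm (c p)"
      using elim by simp
    also have "C * t ^ Suc p \<le> \<bar>C\<bar> * t ^ p"
      by (rule mult_mono) (use elim in \<open>auto simp: mult_left_le_one_le\<close>)
    finally show ?case by (simp add: algebra_simps)
  qed
  then have z: "c i = 0" if "i < p" for i
    using Suc.IH that by blast
  have "\<forall>\<^sub>F t in at_right 0. norm (c p) \<le> C * t"
    using Suc.prems(1) small
  proof eventually_elim
    case (elim t)
    then have "t ^ p * norm (c p) \<le> t ^ p * (C * t)"
      by (simp add: z mult_ac)
    then show ?case using elim by simp
  qed
  moreover have "((\<lambda>t. C * t) \<longlongrightarrow> C * 0) (at_right 0)"
    by (intro tendsto_intros)
  ultimately have "norm (c p) \<le> C * 0"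
    using tendsto_lowerbound[of "\<lambda>t. C * t" "C * 0" "at_right 0" "norm (c p)"] by simp
  then show ?case using z Suc.prems(2) by (cases "j = p") auto
qed simp

text \<open>On a ray the homogeneous terms become monomials in one real variable.\<close>

lemma homog_unique:
  fixes P :: "nat \<Rightarrow> 'a::real_normed_vector \<Rightarrow> 'b::real_normed_vector"
  assumes P: "\<And>j. j < p \<Longrightarrow> homog j (P j)" and fl: "flat p (\<lambda>x. \<Sum>j<p. P j x)" and j: "j < p"
  shows "P j x = 0"
proof -
  obtain C where C: "C > 0" "\<forall>\<^sub>F x in nhds 0. norm (\<Sum>j<p. P j x) \<le> C * norm x ^ p"
    using fl by (rule flatE)
  have t: "((\<lambda>t. t *\<^sub>R x) \<longlongrightarrow> 0 *\<^sub>R x) (at_right (0::real))"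
    by (intro tendsto_intros)
  have "\<forall>\<^sub>F t in at_right 0. norm (\<Sum>j<p. P j (t *\<^sub>R x)) \<le> C * norm (t *\<^sub>R x) ^ p"
    by (rule eventually_compose_filterlim[OF C(2)]) (use t in simp)
  moreover have "\<forall>\<^sub>F t::real in at_right 0. 0 < t"
    by (rule eventually_at_rightI[of 0 1]) auto
  ultimately have "\<forall>\<^sub>F t in at_right 0. norm (\<Sum>j<p. t ^ j *\<^sub>R P j x) \<le> (C * norm x ^ p) * t ^ p"
  proof eventually_elim
    case (elim t)
    then show ?case by (simp add: homogD[OF P] power_mult_distrib mult_ac)
  qed
  from poly_coeffs_unique[OF this j] show ?thesis .
qed

section \<open>Taylor's theorem at the origin\<close>

context
  fixes S :: "'a::euclidean_space set"
  assumes S: "open S" "0 \<in> S"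
begin

lemma homog_taylor: "smooth_on S f \<Longrightarrow> homog k (taylor f k)"
  unfolding homog_def taylor_def by (simp add: iter_dderiv_scaleR[OF S(1) _ S(2)])

lemma polynomial_taylor: "smooth_on S f \<Longrightarrow> polynomial_function (taylor f k)"
  unfolding taylor_def
  by (intro polynomial_function_cmul polynomial_function_iter_dderiv[OF S(1) _ S(2)])

lemma has_derivative_taylor:
  fixes f :: "'a \<Rightarrow> 'b::euclidean_space"
  assumes f: "smooth_on S f"
  shows "(taylor f (Suc j) has_derivative (\<lambda>v. taylor (dderiv v f) j x)) (at x)"
proof -
  have "((\<lambda>x. (1 / fact (Suc j)) *\<^sub>R (dderiv x ^^ Suc j) f 0) has_derivative
    (\<lambda>v. (1 / fact (Suc j)) *\<^sub>R (real (Suc j) *\<^sub>R (dderiv x ^^ (Suc j - 1)) (dderiv v f) 0))) (at x)"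
    by (rule has_derivative_scaleR_right[OF has_derivative_iter_dderiv[OF S(1) f S(2)]])
  then show ?thesis
    unfolding taylor_def by simp
qed

lemma dderiv_taylor:
  fixes f :: "'a \<Rightarrow> 'b::euclidean_space"
  shows "smooth_on S f \<Longrightarrow> dderiv v (taylor f (Suc j)) = taylor (dderiv v f) j"
  by (rule ext, rule dderiv_eq[OF has_derivative_taylor])

lemma taylor_linear_compose:
  "smooth_on S f \<Longrightarrow> bounded_linear h \<Longrightarrow> taylor (\<lambda>x. h (f x)) k x = h (taylor f k x)"
  unfolding taylor_def
  by (simp add: iter_dderiv_linear_compose[OF S(1) _ _ S(2)] linear_scale bounded_linear.linear)

lemma taylor_cong:
  assumes "smooth_on S f" "\<And>x. x \<in> S \<Longrightarrow> f x = g x"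
  shows "taylor g k = taylor f k"
  unfolding taylor_def by (simp only: iter_dderiv_cong[OF S(1) assms S(2)])

text \<open>Maclaurin's formula on the segment from 0 to \<open>x\<close>: the derivatives of
  \<open>f (t *\<^sub>R x)\<close> in \<open>t\<close> are iterated derivatives along
  \<open>x\<close>, which are bounded uniformly on a closed ball.\<close>

lemma taylor_remainder_real:
  fixes f :: "'a \<Rightarrow> real"
  assumes f: "smooth_on S f"
  shows "flat p (\<lambda>x. f x - (\<Sum>j<p. taylor f j x))"
proof -
  obtain d where d: "d > 0" "cball 0 d \<subseteq> S"
    using S by (auto simp: open_contains_cball)
  obtain C where C: "\<And>x y. y \<in> cball 0 d \<Longrightarrow> norm ((dderiv x ^^ p) f y) \<le> C * norm x ^ p"
    using iter_dderiv_bound[OF S(1) f compact_cball d(2)] by blast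
  have "norm (f x - (\<Sum>j<p. taylor f j x)) \<le> C * norm x ^ p" if x: "x \<in> ball 0 d" for x
  proof -
    have inS: "t *\<^sub>R x \<in> cball 0 d" if "0 \<le> t" "t \<le> 1" for t
    proof -
      have "t * norm x \<le> 1 * norm x" by (rule mult_right_mono) (use that in auto)
      then show ?thesis using that x by simp
    qed
    have D: "DERIV (\<lambda>t. (dderiv x ^^ m) f (t *\<^sub>R x)) t :> (dderiv x ^^ Suc m) f (t *\<^sub>R x)"
      if "0 \<le> t" "t \<le> 1" for m t
    proof -
      have "t *\<^sub>R x \<in> S" using inS[OF that] d(2) by blast
      then have "(dderiv x ^^ m) f differentiable at (0 + t *\<^sub>R x)"
        using smooth_onD[OF smooth_on_iter_dderiv[OF f]] by simp
      from has_real_derivative_line[OF this] show ?thesis by simp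
    qed
    obtain t where t: "0 < t" "t \<le> 1"
      "f (1 *\<^sub>R x) = (\<Sum>m<p. (dderiv x ^^ m) f (0 *\<^sub>R x) / fact m * 1 ^ m)
         + (dderiv x ^^ p) f (t *\<^sub>R x) / fact p * 1 ^ p"
      using Maclaurin2[of 1 "\<lambda>m t. (dderiv x ^^ m) f (t *\<^sub>R x)" "\<lambda>t. f (t *\<^sub>R x)" p] D by auto
    then have "f x - (\<Sum>j<p. taylor f j x) = (dderiv x ^^ p) f (t *\<^sub>R x) / fact p"
      by (simp add: taylor_def)
    also have "norm \<dots> \<le> norm ((dderiv x ^^ p) f (t *\<^sub>R x))"
      using mult_left_mono[of 1 "fact p :: real" "\<bar>(dderiv x ^^ p) f (t *\<^sub>R x)\<bar>"]
      by (simp add: divide_le_eq)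
    also have "\<dots> \<le> C * norm x ^ p"
      by (rule C) (use inS t in auto)
    finally show ?thesis .
  qed
  then show ?thesis
    using d(1) by (intro flatI eventually_cong_on[of "ball 0 d"]) auto
qed

text \<open>The intermediate point in Maclaurin's formula differs from coordinate to coordinate, so
  the vector-valued case is assembled from components.\<close>

lemma taylor_remainder:
  fixes f :: "'a \<Rightarrow> 'b::euclidean_space"
  assumes f: "smooth_on S f"
  shows "flat p (\<lambda>x. f x - (\<Sum>j<p. taylor f j x))"
proof (rule flat_componentwise)
  fix b :: 'b
  have "smooth_on S (\<lambda>x. f x \<bullet> b)"
    by (rule smooth_on_linear_compose[OF S(1) bounded_linear_inner_left f])
  then have "flat p (\<lambda>x. f x \<bullet> b - (\<Sum>j<p. taylor (\<lambda>x. f x \<bullet> b) j x))"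
    by (rule taylor_remainder_real)
  moreover have "taylor (\<lambda>x. f x \<bullet> b) j x = taylor f j x \<bullet> b" for j x
    by (rule taylor_linear_compose[OF f bounded_linear_inner_left])
  ultimately show "flat p (\<lambda>x. (f x - (\<Sum>j<p. taylor f j x)) \<bullet> b)"
    by (simp only: inner_diff_left inner_sum_left)
qed

text \<open>The difference of two expansions with errors of order \<open>p\<close> is a flat sum of
  homogeneous terms. Taylor components of products and composites are computed through this
  uniqueness, without higher Leibniz or chain rules.\<close>

lemma taylor_unique:
  fixes f :: "'a \<Rightarrow> 'b::euclidean_space"
  assumes f: "smooth_on S f" and P: "\<And>j. j < p \<Longrightarrow> homog j (P j)"
    and fl: "flat p (\<lambda>x. f x - (\<Sum>j<p. P j x))" and j: "j < p"
  shows "taylor f j = P j"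
proof
  fix x
  have "flat p (\<lambda>x. \<Sum>j<p. (taylor f j x - P j x))"
  proof -
    have eq: "(\<lambda>x. \<Sum>j<p. (taylor f j x - P j x))
      = (\<lambda>x. (f x - (\<Sum>j<p. P j x)) - (f x - (\<Sum>j<p. taylor f j x)))"
      by (simp add: sum_subtractf)
    show ?thesis unfolding eq by (rule flat_diff[OF fl taylor_remainder[OF f, of p]])
  qed
  moreover have "homog j (\<lambda>x. taylor f j x - P j x)" if "j < p" for j
    using P[OF that] homog_taylor[OF f, of j] by (simp add: homog_def algebra_simps)
  ultimately have "taylor f j x - P j x = 0"
    using homog_unique[of p "\<lambda>j x. taylor f j x - P j x" j x] j by blast
  then show "taylor f j x = P j x" by simp
qed

lemma flat_iff_taylor:
  fixes f :: "'a \<Rightarrow> 'b::euclidean_space"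
  assumes f: "smooth_on S f"
  shows "flat p f \<longleftrightarrow> (\<forall>j<p. taylor f j = (\<lambda>x. 0))"
proof
  assume "flat p f"
  then show "\<forall>j<p. taylor f j = (\<lambda>x. 0)"
    using taylor_unique[OF f, of p "\<lambda>j x. 0"] by (auto simp: homog_def)
next
  assume "\<forall>j<p. taylor f j = (\<lambda>x. 0)"
  then show "flat p f" using taylor_remainder[OF f, of p] by simp
qed

text \<open>A bound on a function says nothing about its derivative in general, since it may
  oscillate. Smoothness enters through the Taylor components, which differentiation shifts down by
  one degree.\<close>

lemma flat_dderiv:
  fixes f :: "'a \<Rightarrow> 'b::euclidean_space"
  assumes f: "smooth_on S f" and fl: "flat (Suc p) f"
  shows "flat p (dderiv v f)"
proof -
  have "taylor (dderiv v f) j = (\<lambda>x. 0)" if "j < p" for j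
  proof -
    have "taylor f (Suc j) = (\<lambda>x. 0)" using fl that unfolding flat_iff_taylor[OF f] by blast
    then show ?thesis using dderiv_taylor[OF f, of v j] by simp
  qed
  then show ?thesis
    unfolding flat_iff_taylor[OF smooth_on_dderiv[OF f]] by blast
qed

lemma smooth_on_isCont_0: "smooth_on S f \<Longrightarrow> isCont f 0"
  using smooth_on_continuous S continuous_on_eq_continuous_at by blast

lemma flat_0_smooth: "smooth_on S f \<Longrightarrow> flat 0 f"
  by (rule flat_0_isCont[OF smooth_on_isCont_0])

lemma flat_1_smooth:
  fixes f :: "'a \<Rightarrow> 'b::euclidean_space"
  shows "smooth_on S f \<Longrightarrow> f 0 = 0 \<Longrightarrow> flat 1 f"
  by (simp add: flat_iff_taylor taylor_def)

text \<open>Orders add as for a product: on a ball of radius comparable to \<open>norm x\<close> the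
  derivative has order \<open>p\<close>, and the displacement has order \<open>q\<close>. This
  measures the error of replacing an argument by an approximation.\<close>

lemma flat_mean_value:
  fixes f :: "'a \<Rightarrow> 'b::euclidean_space" and u w :: "'c::real_normed_vector \<Rightarrow> 'a"
  assumes f: "smooth_on S f" and df: "\<And>b. b \<in> Basis \<Longrightarrow> flat p (dderiv b f)"
    and u: "flat 1 u" and w: "flat 1 w" and uw: "flat q (\<lambda>x. u x - w x)"
  shows "flat (p + q) (\<lambda>x. f (u x) - f (w x))"
proof -
  have "\<forall>b\<in>Basis. \<exists>C. C > 0 \<and> (\<forall>\<^sub>F x in nhds 0. norm (dderiv b f x) \<le> C * norm x ^ p)"
    using flatE[OF df] by metis
  then obtain C where C: "\<And>b. b \<in> Basis \<Longrightarrow> C b > 0"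
    "\<And>b. b \<in> Basis \<Longrightarrow> \<forall>\<^sub>F x in nhds 0. norm (dderiv b f x) \<le> C b * norm x ^ p"
    by metis
  define B where "B = (\<Sum>b\<in>Basis. C b)"
  have "\<forall>\<^sub>F x in nhds 0. x \<in> S \<and> (\<forall>b\<in>Basis. norm (dderiv b f x) \<le> C b * norm x ^ p)"
    using C(2) eventually_cong_on[OF S, of "\<lambda>x. x \<in> S"]
    by (intro eventually_conj) (auto simp: eventually_ball_finite)
  then obtain d where d: "d > 0" "\<And>x b. norm x < d \<Longrightarrow> x \<in> S"
    "\<And>x b. norm x < d \<Longrightarrow> b \<in> Basis \<Longrightarrow> norm (dderiv b f x) \<le> C b * norm x ^ p"
    unfolding eventually_nhds_metric dist_norm by auto
  have on: "norm (dderiv v f x) \<le> B * r ^ p * norm v" if "norm x < d" "norm x \<le> r" for x v r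
  proof -
    have "norm (dderiv v f x) \<le> (\<Sum>b\<in>Basis. norm ((v \<bullet> b) *\<^sub>R dderiv b f x))"
      unfolding dderiv_expand[OF smooth_onD[OF f d(2)[OF that(1)]], of v] by (rule norm_sum)
    also have "\<dots> \<le> (\<Sum>b\<in>Basis. norm v * (C b * r ^ p))"
    proof (rule sum_mono)
      fix b :: 'a assume b: "b \<in> Basis"
      have "norm (dderiv b f x) \<le> C b * norm x ^ p" using d(3)[OF that(1) b] .
      also have "\<dots> \<le> C b * r ^ p"
        by (intro mult_left_mono power_mono) (use that C(1)[OF b] in auto)
      finally show "norm ((v \<bullet> b) *\<^sub>R dderiv b f x) \<le> norm v * (C b * r ^ p)"
        unfolding norm_scaleR by (intro mult_mono) (use Basis_le_norm[OF b] in auto)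
    qed
    also have "\<dots> = B * r ^ p * norm v"
      by (simp add: B_def sum_distrib_left sum_distrib_right mult_ac)
    finally show ?thesis .
  qed
  obtain D1 where D1: "D1 > 0" "\<forall>\<^sub>F x in nhds 0. norm (u x) \<le> D1 * norm x ^ 1" using u by (rule flatE)
  obtain D2 where D2: "D2 > 0" "\<forall>\<^sub>F x in nhds 0. norm (w x) \<le> D2 * norm x ^ 1" using w by (rule flatE)
  obtain D3 where D3: "D3 > 0" "\<forall>\<^sub>F x in nhds 0. norm (u x - w x) \<le> D3 * norm x ^ q" using uw by (rule flatE)
  \<comment> \<open>The ball of radius \<open>D * norm x\<close> contains both arguments and, being
    convex, the segment between them.\<close>
  define D where "D = D1 + D2"
  have Dp: "D > 0" using D1 D2 by (simp add: D_def)
  have B0: "B \<ge> 0" using C(1) by (auto simp: B_def intro: sum_nonneg less_imp_le)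
  have "\<forall>\<^sub>F x::'c in nhds 0. norm x < d / D"
    by (rule eventually_cong_on[of "ball 0 (d / D)"]) (use d(1) Dp in auto)
  with D1(2) D2(2) D3(2)
  have "\<forall>\<^sub>F x in nhds 0. norm (f (u x) - f (w x)) \<le> (B * D ^ p * D3) * norm x ^ (p + q)"
  proof eventually_elim
    case (elim x)
    define r where "r = D * norm x"
    have r: "norm (u x) \<le> r" "norm (w x) \<le> r" "r < d"
      using elim D1 D2 Dp unfolding r_def D_def by (auto simp: distrib_right field_simps intro: add_increasing add_increasing2)
    have r0: "r \<ge> 0" using r(1) norm_ge_zero order_trans by blast
    have "norm (f (u x) - f (w x)) \<le> (B * r ^ p) * norm (u x - w x)"
    proof (rule differentiable_bound[of "cball 0 r" f "\<lambda>y v. dderiv v f y"])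
      fix y :: 'a assume y: "y \<in> cball 0 r"
      then have yd: "norm y < d" using r(3) by simp
      show "(f has_derivative (\<lambda>v. dderiv v f y)) (at y within cball 0 r)"
        by (rule has_derivative_at_withinI[OF has_derivative_dderiv[OF smooth_onD[OF f d(2)[OF yd]]]])
      show "onorm (\<lambda>v. dderiv v f y) \<le> B * r ^ p"
        by (rule onorm_bound) (use on[OF yd] y B0 r0 in auto)
    qed (use r in auto)
    also have "\<dots> \<le> (B * r ^ p) * (D3 * norm x ^ q)"
      by (rule mult_left_mono) (use elim B0 r0 in auto)
    finally show ?case by (simp add: r_def power_mult_distrib power_add mult_ac)
  qed
  then show ?thesis by (rule flatI)
qed

end

section \<open>Homogeneous polynomials\<close>

lemma real_polynomial_dderiv:
  "real_polynomial_function f \<Longrightarrow> real_polynomial_function (dderiv v f)"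
proof (induction f rule: real_polynomial_function.induct)
  case (linear f)
  show ?case
    unfolding dderiv_bounded_linear[OF linear] by (rule real_polynomial_function.intros(2))
next
  case (const c)
  show ?case unfolding dderiv_const by (rule real_polynomial_function.intros(2))
next
  case (add f g)
  have "dderiv v (\<lambda>x. f x + g x) = (\<lambda>x. dderiv v f x + dderiv v g x)"
    using add.hyps by (intro ext dderiv_add smooth_onD[OF smooth_on_real_polynomial]) auto
  then show ?case using add.IH by (simp add: real_polynomial_function.intros(3))
next
  case (mult f g)
  have "dderiv v (\<lambda>x. f x * g x) = (\<lambda>x. f x * dderiv v g x + dderiv v f x * g x)"
    using mult.hyps by (intro ext dderiv_mult smooth_onD[OF smooth_on_real_polynomial]) auto
  then show ?case using mult by (auto intro!: real_polynomial_function.intros(3,4))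
qed

lemma taylor_homog:
  fixes f :: "'a::euclidean_space \<Rightarrow> 'b::euclidean_space"
  assumes f: "smooth_on UNIV f" and h: "homog k f"
  shows "taylor f j = (if j = k then f else (\<lambda>x. 0))"
proof -
  define P where "P i = (if i = k then f else (\<lambda>x. 0))" for i
  define p where "p = Suc (max j k)"
  have "(\<Sum>i<p. P i x) = f x" for x
  proof -
    have "(\<Sum>i<p. P i x) = (\<Sum>i<p. if i = k then f x else 0)"
      by (rule sum.cong) (auto simp: P_def)
    then show ?thesis by (simp add: p_def)
  qed
  moreover have "homog i (P i)" for i
    using h by (auto simp: P_def homog_def)
  ultimately have "taylor f j = P j"
    using taylor_unique[OF open_UNIV UNIV_I f, of p P j] by (simp add: p_def)
  then show ?thesis by (simp add: P_def)
qed

text \<open>A smooth homogeneous map is its own Taylor component, and differentiation maps Taylor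
  components to Taylor components.\<close>

lemma homog_dderiv:
  fixes f :: "'a::euclidean_space \<Rightarrow> 'b::euclidean_space"
  assumes f: "smooth_on UNIV f" and h: "homog (Suc k) f"
  shows "homog k (dderiv v f)"
proof -
  have "dderiv v f = dderiv v (taylor f (Suc k))"
    by (simp add: taylor_homog[OF f h])
  also have "\<dots> = taylor (dderiv v f) k"
    by (rule dderiv_taylor[OF open_UNIV UNIV_I f])
  finally show ?thesis
    using homog_taylor[OF open_UNIV UNIV_I smooth_on_dderiv[OF f], of k v] by simp
qed

lemma hom_poly_iff: "f \<in> hom_poly k \<longleftrightarrow> real_polynomial_function f \<and> homog k f"
  by (simp add: hom_poly_def homog_def)

lemma hom_polyD:
  assumes "f \<in> hom_poly k"
  shows "real_polynomial_function f" "homog k f" "smooth_on UNIV f" "f differentiable at x"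
  using assms smooth_on_real_polynomial smooth_onD[OF smooth_on_real_polynomial]
  by (auto simp: hom_poly_iff)

lemma hom_poly_dderiv:
  fixes f :: "'a::euclidean_space \<Rightarrow> real"
  assumes "f \<in> hom_poly (Suc k)"
  shows "dderiv v f \<in> hom_poly k"
  using homog_dderiv[OF hom_polyD(3)[OF assms] hom_polyD(2)[OF assms], of v]
    real_polynomial_dderiv[OF hom_polyD(1)[OF assms], of v]
  unfolding hom_poly_iff by simp

lemma hom_poly_add: "f \<in> hom_poly k \<Longrightarrow> g \<in> hom_poly k \<Longrightarrow> (\<lambda>x. f x + g x) \<in> hom_poly k"
  by (auto simp: hom_poly_def algebra_simps)

lemma hom_poly_cmul: "f \<in> hom_poly k \<Longrightarrow> (\<lambda>x. c * f x) \<in> hom_poly k"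
  by (auto simp: hom_poly_def algebra_simps)

lemma hom_poly_diff: "f \<in> hom_poly k \<Longrightarrow> g \<in> hom_poly k \<Longrightarrow> (\<lambda>x. f x - g x) \<in> hom_poly k"
  by (auto simp: hom_poly_def algebra_simps)

lemma hom_poly_zero [simp]: "(\<lambda>x. 0) \<in> hom_poly k"
  by (auto simp: hom_poly_def)

lemma hom_poly_sum: "(\<And>i. i \<in> I \<Longrightarrow> f i \<in> hom_poly k) \<Longrightarrow> (\<lambda>x. \<Sum>i\<in>I. f i x) \<in> hom_poly k"
  by (induction I rule: infinite_finite_induct) (auto intro: hom_poly_add)

lemma hom_poly_mult: "f \<in> hom_poly j \<Longrightarrow> g \<in> hom_poly k \<Longrightarrow> (\<lambda>x. f x * g x) \<in> hom_poly (j + k)"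
  by (auto simp: hom_poly_def power_add mult_ac)

lemma hom_poly_linear: "bounded_linear f \<Longrightarrow> f \<in> hom_poly 1"
  by (auto simp: hom_poly_def linear_scale bounded_linear.linear)

lemma hom_poly_compose_linear:
  fixes h :: "'a::euclidean_space \<Rightarrow> 'b::euclidean_space"
  assumes "f \<in> hom_poly k" "linear h"
  shows "(\<lambda>x. f (h x)) \<in> hom_poly k"
  using assms real_polynomial_function_compose[OF polynomial_function_bounded_linear, of h f]
  by (auto simp: hom_poly_def o_def linear_scale linear_conv_bounded_linear)

lemma hom_poly_0_const: "f \<in> hom_poly 0 \<Longrightarrow> f = (\<lambda>x. f 0)"
  unfolding hom_poly_def by (rule ext) (metis (mono_tags, lifting) mem_Collect_eq mult_1 power_0 scaleR_zero_left)

lemma euler_homog: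
  assumes "f \<in> hom_poly k"
  shows "dderiv x f x = real k * f x"
proof -
  have "((\<lambda>s. f (0 + s *\<^sub>R x)) has_real_derivative dderiv x f (0 + 1 *\<^sub>R x)) (at 1)"
    by (rule has_real_derivative_line[OF hom_polyD(4)[OF assms]])
  then have "((\<lambda>s. s ^ k * f x) has_real_derivative dderiv x f x) (at 1)"
    using homogD[OF hom_polyD(2)[OF assms]] by simp
  moreover have "((\<lambda>s. s ^ k * f x) has_real_derivative real k * f x) (at 1)"
    by (auto intro!: derivative_eq_intros)
  ultimately show ?thesis by (rule DERIV_unique)
qed

text \<open>The Lie derivative along the field \<open>M\<close>, used for linear \<open>M\<close>.
  For the linear part of \<open>X\<close> it is the bracket with the quadratic Hamiltonian.\<close>

definition lie :: "('v::real_normed_vector \<Rightarrow> 'v) \<Rightarrow> ('v \<Rightarrow> real) \<Rightarrow> 'v \<Rightarrow> real"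
  where "lie M f x = dderiv (M x) f x"

lemma lie_add:
  "f \<in> hom_poly k \<Longrightarrow> g \<in> hom_poly k \<Longrightarrow> lie M (\<lambda>x. f x + g x) = (\<lambda>x. lie M f x + lie M g x)"
  by (rule ext) (simp add: lie_def dderiv_add[OF hom_polyD(4) hom_polyD(4)])

lemma lie_diff:
  "f \<in> hom_poly k \<Longrightarrow> g \<in> hom_poly k \<Longrightarrow> lie M (\<lambda>x. f x - g x) = (\<lambda>x. lie M f x - lie M g x)"
  by (rule ext) (simp add: lie_def dderiv_diff[OF hom_polyD(4) hom_polyD(4)])

lemma lie_cmul: "f \<in> hom_poly k \<Longrightarrow> lie M (\<lambda>x. c * f x) = (\<lambda>x. c * lie M f x)"
  by (rule ext) (simp add: lie_def dderiv_linear_compose[OF bounded_linear_mult_right hom_polyD(4)])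

lemma lie_sum:
  assumes "\<And>i. i \<in> I \<Longrightarrow> f i \<in> hom_poly k"
  shows "lie M (\<lambda>x. \<Sum>i\<in>I. c i * f i x) = (\<lambda>x. \<Sum>i\<in>I. c i * lie M (f i) x)"
proof
  fix x
  have "dderiv (M x) (\<lambda>x. \<Sum>i\<in>I. c i * f i x) x = (\<Sum>i\<in>I. dderiv (M x) (\<lambda>x. c i * f i x) x)"
    by (rule dderiv_sum[OF hom_polyD(4)[OF hom_poly_cmul[OF assms]]])
  also have "\<dots> = (\<Sum>i\<in>I. c i * dderiv (M x) (f i) x)"
    by (rule sum.cong[OF refl])
      (simp add: dderiv_linear_compose[OF bounded_linear_mult_right hom_polyD(4)[OF assms]])
  finally show "lie M (\<lambda>x. \<Sum>i\<in>I. c i * f i x) x = (\<Sum>i\<in>I. c i * lie M (f i) x)"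
    by (simp add: lie_def)
qed

text \<open>Chain rule for maps that commute or anticommute with \<open>M\<close>;
  \<open>s * s = 1\<close> allows the sign to change sides.\<close>

lemma lie_compose_linear:
  fixes g :: "'v::euclidean_space \<Rightarrow> 'v"
  assumes f: "f \<in> hom_poly k" and g: "linear g" and M: "\<And>x. M (g x) = s *\<^sub>R g (M x)" and s: "s * s = 1"
  shows "lie M (\<lambda>x. f (g x)) x = s * lie M f (g x)"
proof -
  have bl: "bounded_linear g" using g by (simp add: linear_conv_bounded_linear)
  have "lie M (\<lambda>x. f (g x)) x = dderiv (dderiv (M x) g x) f (g x)"
    unfolding lie_def
    by (rule dderiv_compose[OF bounded_linear_imp_differentiable[OF bl] hom_polyD(4)[OF f]])
  also have "dderiv (M x) g x = s *\<^sub>R M (g x)"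
    by (simp add: dderiv_bounded_linear[OF bl] M s)
  finally show ?thesis
    by (simp add: lie_def dderiv_scaleR_left[OF hom_polyD(4)[OF f]])
qed

section \<open>The Fischer inner product\<close>

text \<open>The sum of \<open>\<partial>\<^sub>w f(0) \<cdot> \<partial>\<^sub>w g(0)\<close> over all words \<open>w\<close> of length \<open>k\<close> in the basis vectors.\<close>

primrec fischer :: "('m::finite \<Rightarrow> 'v::real_normed_vector) \<Rightarrow> nat \<Rightarrow> ('v \<Rightarrow> real) \<Rightarrow> ('v \<Rightarrow> real) \<Rightarrow> real"
  where
    "fischer e 0 f g = f 0 * g 0"
  | "fischer e (Suc k) f g = (\<Sum>i\<in>UNIV. fischer e k (dderiv (e i) f) (dderiv (e i) g))"

lemma fischer_sym: "fischer e k f g = fischer e k g f"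
  by (induction k arbitrary: f g) (auto intro!: sum.cong)

lemma fischer_nonneg: "fischer e k f f \<ge> 0"
  by (induction k arbitrary: f) (auto intro: sum_nonneg)

lemma fischer_sum_left:
  assumes "\<And>i. i \<in> I \<Longrightarrow> real_polynomial_function (f i)"
  shows "fischer e k (\<lambda>x. \<Sum>i\<in>I. c i * f i x) g = (\<Sum>i\<in>I. c i * fischer e k (f i) g)"
  using assms
proof (induction k arbitrary: f g)
  case 0
  then show ?case by (simp add: sum_distrib_right mult.assoc)
next
  case (Suc k)
  have d: "f i differentiable at x" if "i \<in> I" for i x
    using smooth_onD[OF smooth_on_real_polynomial[OF Suc.prems[OF that]]] by simp
  have eq: "dderiv v (\<lambda>x. \<Sum>i\<in>I. c i * f i x) = (\<lambda>x. \<Sum>i\<in>I. c i * dderiv v (f i) x)" for v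
  proof
    fix x
    have "(\<lambda>x. c i * f i x) differentiable at x" if "i \<in> I" for i
      using d[OF that] by (intro differentiable_mult) auto
    then show "dderiv v (\<lambda>x. \<Sum>i\<in>I. c i * f i x) x = (\<Sum>i\<in>I. c i * dderiv v (f i) x)"
      by (simp add: dderiv_sum dderiv_linear_compose[OF bounded_linear_mult_right d])
  qed
  have "fischer e k (\<lambda>x. \<Sum>i\<in>I. c i * dderiv v (f i) x) h = (\<Sum>i\<in>I. c i * fischer e k (dderiv v (f i)) h)" for v h
    by (rule Suc.IH[OF real_polynomial_dderiv[OF Suc.prems]])
  then show ?case
    unfolding fischer.simps eq sum_distrib_left by (simp only: sum.swap[of _ I])
qed

lemma fischer_add_left:
  assumes "real_polynomial_function f" "real_polynomial_function g"
  shows "fischer e k (\<lambda>x. a * f x + b * g x) h = a * fischer e k f h + b * fischer e k g h"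
  using fischer_sum_left[of "UNIV :: bool set" "\<lambda>i. if i then f else g" e k "\<lambda>i. if i then a else b" h]
    assms by (simp add: UNIV_bool add.commute)

lemma fischer_zero_left [simp]: "fischer e k (\<lambda>x. 0) g = 0"
  using fischer_sum_left[of "{}" "\<lambda>i x. 0" e k] by simp

text \<open>The linear span, meant for finite \<open>B\<close>: a sum over an infinite set is 0 by
  convention, which would leave only the zero function.\<close>

definition fspan :: "('v \<Rightarrow> real) set \<Rightarrow> ('v \<Rightarrow> real) set"
  where "fspan B = {f. \<exists>c. f = (\<lambda>x. \<Sum>b\<in>B. c b * b x)}"

lemma fspan_sum:
  assumes "\<And>i. i \<in> I \<Longrightarrow> g i \<in> fspan B"
  shows "(\<lambda>x. \<Sum>i\<in>I. a i * g i x) \<in> fspan B"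
proof -
  have "\<forall>i\<in>I. \<exists>c. g i = (\<lambda>x. \<Sum>b\<in>B. c b * b x)"
    using assms by (auto simp: fspan_def)
  then obtain c where c: "\<And>i. i \<in> I \<Longrightarrow> g i = (\<lambda>x. \<Sum>b\<in>B. c i b * b x)" by metis
  have "(\<Sum>i\<in>I. a i * g i x) = (\<Sum>b\<in>B. (\<Sum>i\<in>I. a i * c i b) * b x)" for x
  proof -
    have "(\<Sum>i\<in>I. a i * g i x) = (\<Sum>i\<in>I. \<Sum>b\<in>B. a i * c i b * b x)"
      by (rule sum.cong) (simp_all add: c sum_distrib_left mult.assoc)
    also have "\<dots> = (\<Sum>b\<in>B. \<Sum>i\<in>I. a i * c i b * b x)" by (rule sum.swap)
    finally show ?thesis by (simp add: sum_distrib_right)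
  qed
  then show ?thesis
    unfolding fspan_def by (intro CollectI exI[of _ "\<lambda>b. \<Sum>i\<in>I. a i * c i b"] ext)
qed

lemma fspan_mem:
  assumes "finite B" "b \<in> B"
  shows "b \<in> fspan B"
proof -
  have "b x = (\<Sum>a\<in>B. (if a = b then 1 else 0) * a x)" for x
    using assms by (simp add: if_distrib[of "\<lambda>c. c * _"] cong: if_cong)
  then show ?thesis
    unfolding fspan_def by (intro CollectI exI[of _ "\<lambda>a. if a = b then 1 else 0"] ext)
qed

section \<open>Polynomials in a basis, adjointness and orthogonal projection\<close>

locale based =
  fixes e :: "'m::finite \<Rightarrow> 'v::euclidean_space"
  assumes basis: "is_basis e"
begin

lemma indep: "independent (range e)" and span_e: "span (range e) = UNIV" and inj_e: "inj e"
  using basis by (auto simp: is_basis_def)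

lemma coords_expand: "(\<Sum>i\<in>UNIV. coords e x $ i *\<^sub>R e i) = x"
proof -
  have "(\<Sum>b\<in>range e. representation (range e) x b *\<^sub>R b) = x"
    by (rule real_vector.sum_representation_eq[OF indep]) (auto simp: span_e)
  then show ?thesis
    by (simp add: sum.reindex[OF inj_e] coords_def)
qed

lemma coords_e: "coords e (e j) $ i = (if i = j then 1 else 0)"
proof -
  have "representation (range e) (e j) = (\<lambda>v. if v = e j then 1 else 0)"
    by (rule real_vector.representation_basis[OF indep]) auto
  then show ?thesis using inj_e by (auto simp: coords_def inj_eq)
qed

lemma linear_coords: "linear (\<lambda>x. coords e x $ i)"
  by (rule linearI)
    (simp_all add: coords_def real_vector.representation_add[OF indep] real_vector.representation_scale[OF indep] span_e)

lemma bounded_linear_coords: "bounded_linear (\<lambda>x. coords e x $ i)"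
  using linear_coords by (simp add: linear_conv_bounded_linear)

lemma linear_expand:
  assumes "linear f"
  shows "f x = (\<Sum>i\<in>UNIV. coords e x $ i *\<^sub>R f (e i))"
proof -
  have "f x = f (\<Sum>i\<in>UNIV. coords e x $ i *\<^sub>R e i)" by (simp only: coords_expand)
  then show ?thesis by (simp add: linear_sum[OF assms] linear_scale[OF assms])
qed

lemma dderiv_coords:
  assumes "f differentiable at x"
  shows "dderiv v f x = (\<Sum>i\<in>UNIV. coords e v $ i *\<^sub>R dderiv (e i) f x)"
  by (rule linear_expand[OF linear_dderiv[OF assms]])

lemma lie_expand:
  fixes M :: "'v \<Rightarrow> 'v"
  assumes "f \<in> hom_poly k"
  shows "lie M f = (\<lambda>x. \<Sum>i\<in>UNIV. coords e (M x) $ i * dderiv (e i) f x)"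
  by (rule ext) (simp add: lie_def dderiv_coords[OF hom_polyD(4)[OF assms], of "M _"])

lemma hom_poly_lie:
  fixes M :: "'v \<Rightarrow> 'v"
  assumes f: "f \<in> hom_poly k" and M: "linear M"
  shows "lie M f \<in> hom_poly k"
proof (cases k)
  case 0
  have "lie M f = (\<lambda>x. 0)"
    using hom_poly_0_const[of f] f 0 unfolding lie_def by (metis dderiv_const)
  then show ?thesis by simp
next
  case (Suc j)
  have "bounded_linear (\<lambda>x. coords e (M x) $ i)" for i
    using M bounded_linear_compose[OF bounded_linear_coords] by (simp add: linear_conv_bounded_linear)
  then have "(\<lambda>x. coords e (M x) $ i * dderiv (e i) f x) \<in> hom_poly (1 + j)" for i
    using f Suc by (intro hom_poly_mult hom_poly_linear hom_poly_dderiv) auto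
  then show ?thesis
    unfolding lie_expand[OF f] using Suc by (intro hom_poly_sum) auto
qed

text \<open>A sum of nonnegative terms vanishes termwise, so by induction all derivatives along the
  basis vanish, and Euler's identity recovers \<open>f\<close> from them.\<close>

lemma fischer_definite:
  assumes "f \<in> hom_poly k" "fischer e k f f = 0"
  shows "f = (\<lambda>x. 0)"
  using assms
proof (induction k arbitrary: f)
  case 0
  then show ?case using hom_poly_0_const[of f] by auto
next
  case (Suc k)
  have "fischer e k (dderiv (e i) f) (dderiv (e i) f) = 0" for i
  proof -
    have "\<forall>i\<in>UNIV. fischer e k (dderiv (e i) f) (dderiv (e i) f) = 0"
      using Suc.prems(2) by (subst (asm) fischer.simps(2), subst (asm) sum_nonneg_eq_0_iff) (auto simp: fischer_nonneg)
    then show ?thesis by simp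
  qed
  then have "dderiv (e i) f = (\<lambda>x. 0)" for i
    by (rule Suc.IH[OF hom_poly_dderiv[OF Suc.prems(1)]])
  then have "dderiv x f x = 0" for x
    by (simp add: dderiv_coords[OF hom_polyD(4)[OF Suc.prems(1)]])
  then show ?case
    using euler_homog[OF Suc.prems(1)] by (simp add: fun_eq_iff)
qed

text \<open>The commutator of a constant and a linear vector field is constant: the extra term comes
  from differentiating the coefficients of \<open>M\<close>.\<close>

lemma dderiv_lie:
  fixes M :: "'v \<Rightarrow> 'v"
  assumes f: "f \<in> hom_poly k" and M: "linear M"
  shows "dderiv v (lie M f) = (\<lambda>x. lie M (dderiv v f) x + dderiv (M v) f x)"
proof
  fix x
  have bl: "bounded_linear (\<lambda>x. coords e (M x) $ i)" for i
    using M bounded_linear_compose[OF bounded_linear_coords] by (simp add: linear_conv_bounded_linear)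
  have dd: "dderiv w f differentiable at x" for w x
    using smooth_onD[OF smooth_on_dderiv[OF hom_polyD(3)[OF f]]] by simp
  have "dderiv v (\<lambda>x. \<Sum>i\<in>UNIV. coords e (M x) $ i * dderiv (e i) f x) x
    = (\<Sum>i\<in>UNIV. dderiv v (\<lambda>x. coords e (M x) $ i * dderiv (e i) f x) x)"
    by (rule dderiv_sum[OF differentiable_mult[OF bounded_linear_imp_differentiable[OF bl] dd]])
  also have "\<dots> = (\<Sum>i\<in>UNIV. coords e (M x) $ i * dderiv v (dderiv (e i) f) x + coords e (M v) $ i * dderiv (e i) f x)"
    by (rule sum.cong[OF refl])
      (simp add: dderiv_mult[OF bounded_linear_imp_differentiable[OF bl] dd] dderiv_bounded_linear[OF bl])
  also have "\<dots> = (\<Sum>i\<in>UNIV. coords e (M x) $ i * dderiv (e i) (dderiv v f) x) + dderiv (M v) f x"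
    by (simp add: sum.distrib dderiv_coords[OF hom_polyD(4)[OF f], of "M v"]
        dderiv_commute[OF open_UNIV hom_polyD(3)[OF f] UNIV_I, of v])
  also have "(\<Sum>i\<in>UNIV. coords e (M x) $ i * dderiv (e i) (dderiv v f) x) = lie M (dderiv v f) x"
    unfolding lie_def using dderiv_coords[OF dd, of "M x"] by simp
  finally show "dderiv v (lie M f) x = lie M (dderiv v f) x + dderiv (M v) f x"
    unfolding lie_expand[OF f] .
qed

text \<open>Induction on the degree. Besides the term of the induction hypothesis, the commutator
  \<open>dderiv_lie\<close> produces derivatives along \<open>M (e i)\<close>; expanded in the basis
  they form a double sum weighted by the matrix of \<open>M\<close>, and \<open>adj\<close> converts
  it into the corresponding sum for \<open>N\<close> acting on \<open>g\<close>.\<close>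

lemma fischer_lie_adjoint:
  fixes M N :: "'v \<Rightarrow> 'v"
  assumes M: "linear M" and N: "linear N"
    and adj: "\<And>i j. coords e (M (e i)) $ j = coords e (N (e j)) $ i"
    and "f \<in> hom_poly k" "g \<in> hom_poly k"
  shows "fischer e k (lie M f) g = fischer e k f (lie N g)"
  using assms(4,5)
proof (induction k arbitrary: f g)
  case 0
  have "lie M f 0 = 0" "lie N g 0 = 0"
    using M N hom_polyD(4)[OF 0(1)] hom_polyD(4)[OF 0(2)]
    by (simp_all add: lie_def linear_0 linear_0[OF linear_dderiv])
  then show ?case by simp
next
  case (Suc k)
  note f = Suc.prems(1) and g = Suc.prems(2)
  note poly = hom_polyD(1)[OF hom_poly_dderiv[OF f]] hom_polyD(1)[OF hom_poly_dderiv[OF g]]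
    hom_polyD(1)[OF hom_poly_lie[OF hom_poly_dderiv[OF f] M]]
    hom_polyD(1)[OF hom_poly_lie[OF hom_poly_dderiv[OF g] N]]
  have lin: "fischer e k (dderiv w f) h = (\<Sum>j\<in>UNIV. coords e w $ j * fischer e k (dderiv (e j) f) h)"
    if "f \<in> hom_poly (Suc k)" for w f h
  proof -
    have "dderiv w f = (\<lambda>x. \<Sum>j\<in>UNIV. coords e w $ j * dderiv (e j) f x)"
      using dderiv_coords[OF hom_polyD(4)[OF that], of w] by (simp add: fun_eq_iff)
    then show ?thesis
      by (simp add: fischer_sum_left[OF hom_polyD(1)[OF hom_poly_dderiv[OF that]]])
  qed
  have "fischer e (Suc k) (lie M f) g
    = (\<Sum>i\<in>UNIV. fischer e k (\<lambda>x. 1 * lie M (dderiv (e i) f) x + 1 * dderiv (M (e i)) f x) (dderiv (e i) g))"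
    by (simp add: dderiv_lie[OF f M])
  also have "\<dots> = (\<Sum>i\<in>UNIV. fischer e k (lie M (dderiv (e i) f)) (dderiv (e i) g)
      + fischer e k (dderiv (M (e i)) f) (dderiv (e i) g))"
    unfolding fischer_add_left[OF poly(3) poly(1)] by simp
  also have "\<dots> = (\<Sum>i\<in>UNIV. fischer e k (dderiv (e i) f) (lie N (dderiv (e i) g)))
      + (\<Sum>i\<in>UNIV. \<Sum>j\<in>UNIV. coords e (M (e i)) $ j * fischer e k (dderiv (e j) f) (dderiv (e i) g))"
    by (simp only: sum.distrib Suc.IH[OF hom_poly_dderiv[OF f] hom_poly_dderiv[OF g]] lin[OF f, of "M (e _)"])
  also have "(\<Sum>i\<in>UNIV. \<Sum>j\<in>UNIV. coords e (M (e i)) $ j * fischer e k (dderiv (e j) f) (dderiv (e i) g))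
    = (\<Sum>j\<in>UNIV. \<Sum>i\<in>UNIV. coords e (N (e j)) $ i * fischer e k (dderiv (e i) g) (dderiv (e j) f))"
  proof -
    have "coords e (M (e i)) $ j * fischer e k (dderiv (e j) f) (dderiv (e i) g)
      = coords e (N (e j)) $ i * fischer e k (dderiv (e i) g) (dderiv (e j) f)" for i j
      unfolding adj by (subst fischer_sym) (rule refl)
    then show ?thesis
      by (simp only:) (rule sum.swap)
  qed
  also have "\<dots> = (\<Sum>j\<in>UNIV. fischer e k (dderiv (N (e j)) g) (dderiv (e j) f))"
    by (simp only: lin[OF g, of "N (e _)"])
  also have "(\<Sum>i\<in>UNIV. fischer e k (dderiv (e i) f) (lie N (dderiv (e i) g))) + \<dots>
    = (\<Sum>i\<in>UNIV. fischer e k (\<lambda>x. 1 * lie N (dderiv (e i) g) x + 1 * dderiv (N (e i)) g x) (dderiv (e i) f))"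
    unfolding fischer_add_left[OF poly(4) poly(2)]
    by (simp only: mult_1 sum.distrib fischer_sym[of e k "lie N _"])
  also have "\<dots> = fischer e (Suc k) (lie N g) f"
    by (simp add: dderiv_lie[OF g N])
  finally show ?case by (simp only: fischer_sym[of e _ "lie N g"])
qed

text \<open>Euler's identity writes \<open>f\<close> through products of coordinates with its first
  derivatives, and the latter are spanned in the lower degree by induction.\<close>

lemma hom_poly_finite_span:
  "\<exists>B :: ('v \<Rightarrow> real) set. finite B \<and> B \<subseteq> hom_poly k \<and> hom_poly k \<subseteq> fspan B"
proof (induction k)
  case 0
  have "f \<in> fspan {\<lambda>x. 1}" if "f \<in> hom_poly 0" for f :: "'v \<Rightarrow> real"
  proof -
    have "f x = (\<Sum>b\<in>{\<lambda>x. 1}. f 0 * b x)" for x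
      using fun_cong[OF hom_poly_0_const[OF that], of x] by simp
    then show ?thesis unfolding fspan_def by (intro CollectI exI[of _ "\<lambda>_. f 0"] ext)
  qed
  moreover have "(\<lambda>x::'v. 1) \<in> hom_poly 0" by (simp add: hom_poly_def real_polynomial_function.intros(2))
  ultimately show ?case by (intro exI[of _ "{\<lambda>x. 1}"]) auto
next
  case (Suc k)
  then obtain B :: "('v \<Rightarrow> real) set" where B0: "finite B \<and> B \<subseteq> hom_poly k \<and> hom_poly k \<subseteq> fspan B" ..
  note B = B0[THEN conjunct1] B0[THEN conjunct2, THEN conjunct1] B0[THEN conjunct2, THEN conjunct2]
  define m where "m i b = (\<lambda>x. coords e x $ i * b x)" for i and b :: "'v \<Rightarrow> real"
  define B' where "B' = (\<lambda>(i, b). m i b) ` (UNIV \<times> B)"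
  have fin: "finite B'" using B(1) by (simp add: B'_def)
  have mem': "m i b \<in> B'" if "b \<in> B" for i b
    unfolding B'_def by (rule image_eqI[of _ _ "(i, b)"]) (use that in simp_all)
  have mem: "m i b \<in> fspan B'" if "b \<in> B" for i b
    by (rule fspan_mem[OF fin mem'[OF that]])
  have "m i b \<in> hom_poly (1 + k)" if "b \<in> B" for i b
    unfolding m_def by (rule hom_poly_mult[OF hom_poly_linear[OF bounded_linear_coords] subsetD[OF B(2) that]])
  then have "B' \<subseteq> hom_poly (Suc k)" unfolding B'_def by (simp add: image_subset_iff)
  moreover have "f \<in> fspan B'" if f: "f \<in> hom_poly (Suc k)" for f
  proof -
    have "\<forall>i. \<exists>c. dderiv (e i) f = (\<lambda>x. \<Sum>b\<in>B. c b * b x)"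
      using subsetD[OF B(3) hom_poly_dderiv[OF f]] unfolding fspan_def by simp
    from choice[OF this] obtain c where "\<forall>i. dderiv (e i) f = (\<lambda>x. \<Sum>b\<in>B. c i b * b x)" ..
    note c = this[THEN spec]
    have "(\<lambda>x. \<Sum>b\<in>B. c i b * m i b x) \<in> fspan B'" for i
      by (rule fspan_sum[OF mem])
    then have "(\<lambda>x. \<Sum>i\<in>UNIV. (1 / real (Suc k)) * (\<Sum>b\<in>B. c i b * m i b x)) \<in> fspan B'"
      by (rule fspan_sum)
    moreover have "(\<Sum>i\<in>UNIV. (1 / real (Suc k)) * (\<Sum>b\<in>B. c i b * m i b x)) = f x" for x
    proof -
      have "real (Suc k) * f x = (\<Sum>i\<in>UNIV. coords e x $ i *\<^sub>R dderiv (e i) f x)"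
        unfolding euler_homog[OF f, of x, symmetric] by (rule dderiv_coords[OF hom_polyD(4)[OF f]])
      also have "\<dots> = (\<Sum>i\<in>UNIV. \<Sum>b\<in>B. c i b * m i b x)"
        unfolding c m_def by (simp add: sum_distrib_left mult_ac)
      finally have "(\<Sum>i\<in>UNIV. \<Sum>b\<in>B. c i b * m i b x) = real (Suc k) * f x" ..
      then show ?thesis
        unfolding sum_distrib_left[symmetric] by simp
    qed
    ultimately show ?thesis by simp
  qed
  ultimately show ?case using fin by blast
qed

text \<open>Gram-Schmidt, one function \<open>b a\<close> at a time. The family may be dependent,
  since it will consist of the images of a spanning set under \<open>lie M\<close>.\<close>

lemma orthogonal_decomposition:
  assumes "finite I" "\<And>i. i \<in> I \<Longrightarrow> b i \<in> hom_poly k" "p \<in> hom_poly k"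
  shows "\<exists>c. \<forall>j\<in>I. fischer e k (\<lambda>x. p x - (\<Sum>i\<in>I. c i * b i x)) (b j) = 0"
  using assms
proof (induction I arbitrary: p rule: finite_induct)
  case (insert a I)
  have bI: "\<And>i. i \<in> I \<Longrightarrow> b i \<in> hom_poly k" and ba: "b a \<in> hom_poly k" using insert.prems by auto
  have poly: "(\<lambda>x. \<Sum>i\<in>I. c i * b i x) \<in> hom_poly k" for c
    by (rule hom_poly_sum[OF hom_poly_cmul[OF bI]])
  from insert.IH[OF bI insert.prems(2)]
  obtain c where "\<forall>j\<in>I. fischer e k (\<lambda>x. p x - (\<Sum>i\<in>I. c i * b i x)) (b j) = 0" ..
  note c = this[rule_format]
  from insert.IH[OF bI ba]
  obtain d where "\<forall>j\<in>I. fischer e k (\<lambda>x. b a x - (\<Sum>i\<in>I. d i * b i x)) (b j) = 0" ..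
  note d = this[rule_format]
  define q where "q = (\<lambda>x. p x - (\<Sum>i\<in>I. c i * b i x))"
  define r where "r = (\<lambda>x. b a x - (\<Sum>i\<in>I. d i * b i x))"
  have q: "q \<in> hom_poly k" and r: "r \<in> hom_poly k"
    unfolding q_def r_def using insert.prems(2) ba poly by (auto intro: hom_poly_diff)
  \<comment> \<open>The projection coefficient of \<open>q\<close> along the residual
    \<open>r\<close>. If \<open>r\<close> has norm 0, the quotient is 0 by convention, and
    \<open>trr\<close> survives because \<open>r\<close> is then zero by definiteness.\<close>
  define t where "t = fischer e k q r / fischer e k r r"
  have trr: "t * fischer e k r r = fischer e k q r"
  proof (cases "fischer e k r r = 0")
    case True
    then have "r = (\<lambda>x. 0)" using fischer_definite[OF r] by blast
    then show ?thesis by (simp add: fischer_sym[of e k q])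
  qed (simp add: t_def)
  define c' where "c' i = (if i = a then t else c i - t * d i)" for i
  have res: "(\<lambda>x. p x - (\<Sum>i\<in>insert a I. c' i * b i x)) = (\<lambda>x. 1 * q x + (- t) * r x)"
  proof
    fix x
    have "(\<Sum>i\<in>I. c' i * b i x) = (\<Sum>i\<in>I. c i * b i x) - t * (\<Sum>i\<in>I. d i * b i x)"
      unfolding sum_distrib_left sum_subtractf[symmetric]
      by (rule sum.cong) (use insert.hyps(2) in \<open>auto simp: c'_def algebra_simps\<close>)
    then show "p x - (\<Sum>i\<in>insert a I. c' i * b i x) = 1 * q x + (- t) * r x"
      using insert.hyps by (simp add: c'_def q_def r_def algebra_simps)
  qed
  have orth: "fischer e k (\<lambda>x. 1 * q x + (- t) * r x) (b j) = 0" if "j \<in> I" for j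
    unfolding fischer_add_left[OF hom_polyD(1)[OF q] hom_polyD(1)[OF r]]
    using c[OF that] d[OF that] by (simp add: q_def r_def)
  have "fischer e k (b a) h = fischer e k r h + (\<Sum>i\<in>I. d i * fischer e k (b i) h)" for h
  proof -
    have "b a = (\<lambda>x. 1 * r x + 1 * (\<Sum>i\<in>I. d i * b i x))" by (simp add: r_def)
    then have "fischer e k (b a) h = fischer e k (\<lambda>x. 1 * r x + 1 * (\<Sum>i\<in>I. d i * b i x)) h" by simp
    then show ?thesis
      unfolding fischer_add_left[OF hom_polyD(1)[OF r] hom_polyD(1)[OF poly]]
      by (simp add: fischer_sum_left[OF hom_polyD(1)[OF bI]])
  qed
  moreover have "(\<Sum>i\<in>I. d i * fischer e k (b i) (\<lambda>x. 1 * q x + (- t) * r x)) = 0"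
  proof (rule sum.neutral, rule ballI)
    fix i assume "i \<in> I"
    then show "d i * fischer e k (b i) (\<lambda>x. 1 * q x + (- t) * r x) = 0"
      unfolding fischer_sym[of e k "b i"] by (simp only: orth mult_zero_right)
  qed
  moreover have "fischer e k r (\<lambda>x. 1 * q x + (- t) * r x) = 0"
    by (subst fischer_sym, subst fischer_add_left[OF hom_polyD(1)[OF q] hom_polyD(1)[OF r]])
      (use trr in simp)
  ultimately have "fischer e k (\<lambda>x. 1 * q x + (- t) * r x) (b a) = 0"
    by (subst fischer_sym) (simp only: add_0_left)
  then have "\<forall>j\<in>insert a I. fischer e k (\<lambda>x. p x - (\<Sum>i\<in>insert a I. c' i * b i x)) (b j) = 0"
    unfolding res using orth by auto
  then show ?case by (rule exI[of _ c'])
qed simp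

end

text \<open>\<open>adj\<close> says that the matrices of \<open>M\<close> and \<open>N\<close> in
  the basis are transposes of each other. This is symmetric, so the two maps may exchange
  roles.\<close>

locale adjoint_pair = based e
  for e :: "'m::finite \<Rightarrow> 'v::euclidean_space" +
  fixes M N :: "'v \<Rightarrow> 'v"
  assumes linM: "linear M" and linN: "linear N"
    and adj: "\<And>i j. coords e (M (e i)) $ j = coords e (N (e j)) $ i"
begin

text \<open>By adjointness the squared norm of \<open>lie M g\<close> is the product of
  \<open>g\<close> with \<open>lie N (lie M g)\<close>.\<close>

lemma range_lie_inter_ker:
  assumes g: "g \<in> hom_poly k" and k: "lie N (lie M g) = (\<lambda>x. 0)"
  shows "lie M g = (\<lambda>x. 0)"
proof (rule fischer_definite[OF hom_poly_lie[OF g linM]])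
  show "fischer e k (lie M g) (lie M g) = 0"
    using fischer_lie_adjoint[OF linM linN adj g hom_poly_lie[OF g linM]] k
    by (simp add: fischer_sym[of e k g])
qed

text \<open>Project \<open>p\<close> onto the range of \<open>lie M\<close>. The remainder
  \<open>q\<close> is orthogonal to that range, so by adjointness \<open>lie N q\<close> is
  orthogonal to a spanning set, hence to itself.\<close>

lemma lie_decomposition:
  assumes p: "p \<in> hom_poly k"
  obtains g q where "g \<in> hom_poly k" "q \<in> hom_poly k" "p = (\<lambda>x. lie M g x + q x)" "lie N q = (\<lambda>x. 0)"
proof -
  from hom_poly_finite_span[of k]
  obtain B :: "('v \<Rightarrow> real) set" where B0: "finite B \<and> B \<subseteq> hom_poly k \<and> hom_poly k \<subseteq> fspan B" ..
  note B = B0[THEN conjunct1] B0[THEN conjunct2, THEN conjunct1] B0[THEN conjunct2, THEN conjunct2]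
  note Bm = subsetD[OF B(2)]
  from orthogonal_decomposition[of B "lie M" k p, OF B(1) hom_poly_lie[OF Bm linM] p]
  obtain c where "\<forall>b\<in>B. fischer e k (\<lambda>x. p x - (\<Sum>i\<in>B. c i * lie M i x)) (lie M b) = 0" ..
  note c = this[rule_format]
  define g where "g = (\<lambda>x. \<Sum>b\<in>B. c b * b x)"
  have g: "g \<in> hom_poly k"
    unfolding g_def by (rule hom_poly_sum[OF hom_poly_cmul[OF Bm]])
  have lg: "lie M g = (\<lambda>x. \<Sum>b\<in>B. c b * lie M b x)"
    unfolding g_def by (rule lie_sum[of B "\<lambda>b. b", OF Bm])
  define q where "q = (\<lambda>x. p x - lie M g x)"
  have q: "q \<in> hom_poly k" unfolding q_def by (rule hom_poly_diff[OF p hom_poly_lie[OF g linM]])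
  have lq: "lie N q \<in> hom_poly k" by (rule hom_poly_lie[OF q linN])
  have orth: "fischer e k b (lie N q) = 0" if "b \<in> B" for b
    using c[OF that] fischer_lie_adjoint[OF linM linN adj Bm[OF that] q]
    by (simp add: q_def lg fischer_sym)
  from subsetD[OF B(3) lq, unfolded fspan_def, THEN CollectD] obtain a where a: "lie N q = (\<lambda>x. \<Sum>b\<in>B. a b * b x)" ..
  have "fischer e k (\<lambda>x. \<Sum>b\<in>B. a b * b x) (lie N q) = (\<Sum>b\<in>B. a b * fischer e k b (lie N q))"
    by (rule fischer_sum_left[of B "\<lambda>b. b", OF hom_polyD(1)[OF Bm]])
  then have "fischer e k (lie N q) (lie N q) = 0"
    using orth by (simp add: a[symmetric])
  then have "lie N q = (\<lambda>x. 0)" by (rule fischer_definite[OF lq])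
  moreover have "p = (\<lambda>x. lie M g x + q x)" by (simp add: q_def)
  ultimately show ?thesis using that[OF g q] by simp
qed

end

sublocale adjoint_pair \<subseteq> flip: adjoint_pair e N M
  by (intro adjoint_pair.intro adjoint_pair_axioms.intro based_axioms linM linN adj[symmetric])

context adjoint_pair
begin

text \<open>The choice of \<open>g\<close> in the range of \<open>lie N\<close> makes it unique, which replaces averaging over the group.\<close>

lemma equivariant_decomposition:
  assumes p: "p \<in> hom_poly k"
  obtains g q where "g \<in> hom_poly k" "q \<in> hom_poly k" "p = (\<lambda>x. lie M g x + q x)" "lie N q = (\<lambda>x. 0)"
    "\<forall>h s c. linear h \<longrightarrow> s * s = 1 \<longrightarrow> (\<forall>x. M (h x) = s *\<^sub>R h (M x)) \<longrightarrow> (\<forall>x. N (h x) = s *\<^sub>R h (N x)) \<longrightarrow>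
      (\<forall>x. p (h x) = c * p x) \<longrightarrow> (\<forall>x. q (h x) = c * q x) \<and> (\<forall>x. g (h x) = c * s * g x)"
proof -
  obtain g0 q where g0: "g0 \<in> hom_poly k" and q: "q \<in> hom_poly k"
    and pq: "p = (\<lambda>x. lie M g0 x + q x)" and Nq: "lie N q = (\<lambda>x. 0)"
    by (rule lie_decomposition[OF p])
  \<comment> \<open>The component \<open>z\<close> in the kernel of \<open>lie M\<close> is
    invisible to the equation; discarding it puts the solution into the range of
    \<open>lie N\<close>.\<close>
  obtain f z where f: "f \<in> hom_poly k" and z: "z \<in> hom_poly k"
    and g0z: "g0 = (\<lambda>x. lie N f x + z x)" and Mz: "lie M z = (\<lambda>x. 0)"
    by (rule flip.lie_decomposition[OF g0])
  define g where "g = lie N f"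
  have g: "g \<in> hom_poly k" unfolding g_def by (rule hom_poly_lie[OF f linN])
  have Mg: "lie M g0 = lie M g"
    unfolding g0z lie_add[OF hom_poly_lie[OF f linN] z] Mz g_def by simp
  have "(\<forall>x. q (h x) = c * q x) \<and> (\<forall>x. g (h x) = c * s * g x)"
    if h: "linear h" and s: "s * s = 1" and Mh: "\<And>x. M (h x) = s *\<^sub>R h (M x)"
      and Nh: "\<And>x. N (h x) = s *\<^sub>R h (N x)" and ph: "\<And>x. p (h x) = c * p x" for h s c
  proof -
    define gh where "gh = (\<lambda>x. g (h x))"
    define qh where "qh = (\<lambda>x. q (h x))"
    define fh where "fh = (\<lambda>x. f (h x))"
    have gh: "gh \<in> hom_poly k" and qh: "qh \<in> hom_poly k" and fh: "fh \<in> hom_poly k"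
      unfolding gh_def qh_def fh_def by (rule hom_poly_compose_linear[OF _ h], fact)+
    have Mgh: "lie M gh x = s * lie M g (h x)" for x
      unfolding gh_def by (rule lie_compose_linear[of g k h M s, OF g h Mh s])
    have Nqh: "lie N qh = (\<lambda>x. 0)"
      unfolding qh_def using lie_compose_linear[of q k h N s, OF q h Nh s] Nq by (simp add: fun_eq_iff)
    have Nfh: "lie N fh x = s * gh x" for x
      unfolding fh_def gh_def g_def by (rule lie_compose_linear[of f k h N s, OF f h Nh s])
    \<comment> \<open>Transforming the equation by \<open>h\<close> gives a second solution up to
      signs, and \<open>D\<close> compares the two. Its image \<open>c * q - qh\<close> lies in the
      range of \<open>lie M\<close> and in the kernel of \<open>lie N\<close>, so it
      vanishes.\<close>
    define D where "D = (\<lambda>x. s * gh x - c * g x)"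
    have D: "D \<in> hom_poly k"
      unfolding D_def by (intro hom_poly_diff hom_poly_cmul gh g)
    have MD: "lie M D = (\<lambda>x. c * q x - qh x)"
    proof
      fix x
      have "lie M D x = s * lie M gh x - c * lie M g x"
        unfolding D_def lie_diff[OF hom_poly_cmul[OF gh] hom_poly_cmul[OF g]] lie_cmul[OF gh] lie_cmul[OF g] ..
      also have "s * lie M gh x = lie M g (h x)"
        using s by (simp add: Mgh mult.assoc[symmetric])
      finally show "lie M D x = c * q x - qh x"
        using ph[of x] unfolding pq Mg qh_def by (simp add: algebra_simps)
    qed
    have "lie N (lie M D) = (\<lambda>x. 0)"
      unfolding MD lie_diff[OF hom_poly_cmul[OF q] qh] lie_cmul[OF q] Nq Nqh by simp
    then have MD0: "lie M D = (\<lambda>x. 0)" by (rule range_lie_inter_ker[OF D])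
    \<comment> \<open>A witness that \<open>D\<close> lies in the range of \<open>lie N\<close>. As
      \<open>lie M\<close> annihilates \<open>D\<close>, the previous argument with the roles
      exchanged gives \<open>D = 0\<close>.\<close>
    define F where "F = (\<lambda>x. fh x - c * f x)"
    have F: "F \<in> hom_poly k" unfolding F_def by (intro hom_poly_diff hom_poly_cmul fh f)
    have "lie N F = D"
      unfolding F_def lie_diff[OF fh hom_poly_cmul[OF f]] lie_cmul[OF f] D_def by (simp add: Nfh g_def)
    with MD0 have "D = (\<lambda>x. 0)" using flip.range_lie_inter_ker[OF F] by simp
    then have "s * gh x = c * g x" for x unfolding D_def by (simp add: fun_eq_iff)
    then have "s * (s * gh x) = c * s * g x" for x by (simp add: mult_ac)
    then have "gh x = c * s * g x" for x using s by (simp add: mult.assoc[symmetric])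
    moreover have "qh x = c * q x" for x using MD0 MD by (simp add: fun_eq_iff)
    ultimately show ?thesis unfolding gh_def qh_def by blast
  qed
  moreover have "p = (\<lambda>x. lie M g x + q x)" using pq Mg by simp
  ultimately show ?thesis using that[OF g q _ Nq] by blast
qed

text \<open>Uniqueness concerns the summand \<open>lie M g\<close>, not its preimage
  \<open>g\<close>: two decompositions differ by an element of the range that also lies in the
  kernel.\<close>

lemma linear_complement_ker:
  "linear_complement (hom_poly k) (lie M ` hom_poly k) {q \<in> hom_poly k. lie N q = (\<lambda>x. 0)}"
  unfolding linear_complement_def
proof (intro conjI ballI allI)
  let ?D = "{q \<in> hom_poly k. lie N q = (\<lambda>x. 0)}" and ?R = "lie M ` hom_poly k"
  show "?D \<subseteq> hom_poly k" "?R \<subseteq> hom_poly k" using hom_poly_lie[OF _ linM] by auto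
  show "(\<lambda>x. 0) \<in> ?D" by (simp add: lie_def fun_eq_iff)
  show "(\<lambda>x. f x + g x) \<in> ?D" if "f \<in> ?D" "g \<in> ?D" for f g
    using that by (auto simp: hom_poly_add lie_add)
  show "(\<lambda>x. c * f x) \<in> ?D" if "f \<in> ?D" for c f
    using that by (auto simp: hom_poly_cmul lie_cmul)
  fix p :: "'v \<Rightarrow> real" assume p: "p \<in> hom_poly k"
  obtain g q where gq: "g \<in> hom_poly k" "q \<in> hom_poly k" "p = (\<lambda>x. lie M g x + q x)" "lie N q = (\<lambda>x. 0)"
    by (rule lie_decomposition[OF p])
  show "\<exists>!y. y \<in> ?R \<times> ?D \<and> p = (\<lambda>x. fst y x + snd y x)"
  proof (rule ex1I[of _ "(lie M g, q)"])
    show "(lie M g, q) \<in> ?R \<times> ?D \<and> p = (\<lambda>x. fst (lie M g, q) x + snd (lie M g, q) x)"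
      using gq by simp
  next
    fix y assume y: "y \<in> ?R \<times> ?D \<and> p = (\<lambda>x. fst y x + snd y x)"
    then obtain g' q' where y': "y = (lie M g', q')" "g' \<in> hom_poly k" "q' \<in> hom_poly k" "lie N q' = (\<lambda>x. 0)"
      by auto
    have eq: "lie M g x + q x = lie M g' x + q' x" for x
      using y gq(3) y'(1) by (simp add: fun_eq_iff)
    define d where "d = (\<lambda>x. g x - g' x)"
    have d: "d \<in> hom_poly k" unfolding d_def by (rule hom_poly_diff[OF gq(1) y'(2)])
    have Md: "lie M d = (\<lambda>x. lie M g x - lie M g' x)" unfolding d_def by (rule lie_diff[OF gq(1) y'(2)])
    also have "\<dots> = (\<lambda>x. q' x - q x)" using eq by (simp add: fun_eq_iff algebra_simps)
    finally have Md': "lie M d = (\<lambda>x. q' x - q x)" .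
    have "lie N (lie M d) = (\<lambda>x. 0)"
      unfolding Md' lie_diff[OF y'(3) gq(2)] gq(4) y'(4) by simp
    then have "lie M d = (\<lambda>x. 0)" by (rule range_lie_inter_ker[OF d])
    then have "lie M g = lie M g'" "q = q'" using Md Md' by (simp_all add: fun_eq_iff)
    then show "y = (lie M g, q)" using y'(1) by simp
  qed
qed

end

section \<open>The matrix exponential\<close>

lemma vec_sums:
  fixes f :: "nat \<Rightarrow> real^'m^'n"
  assumes "\<And>i j. (\<lambda>k. f k $ i $ j) sums (X $ i $ j)"
  shows "f sums X"
  using assms unfolding sums_def
  by (intro vec_tendstoI) (simp add: sum_component)

lemma matrix_power_comm:
  fixes A :: "real^'m^'m"
  shows "((**) A ^^ k) (mat 1) ** A = ((**) A ^^ Suc k) (mat 1)"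
  by (induction k) (simp_all add: matrix_mul_assoc[symmetric])

lemma matrix_power_scaleR:
  fixes A :: "real^'m^'m"
  shows "((**) (s *\<^sub>R A) ^^ k) (mat 1) = s ^ k *\<^sub>R ((**) A ^^ k) (mat 1)"
  by (induction k)
    (simp_all add: vec_eq_iff matrix_matrix_mult_def sum_distrib_left mult_ac)

text \<open>The sum of the absolute values of all entries dominates every row sum, so each
  multiplication by \<open>A\<close> costs at most this factor.\<close>

lemma matrix_power_bound:
  fixes A :: "real^'m^'m"
  shows "\<bar>((**) A ^^ k) (mat 1) $ i $ j\<bar> \<le> (\<Sum>i\<in>UNIV. \<Sum>j\<in>UNIV. \<bar>A $ i $ j\<bar>) ^ k"
proof (induction k arbitrary: i j)
  case 0
  then show ?case by (simp add: mat_def)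
next
  case (Suc k)
  define c where "c = (\<Sum>i\<in>UNIV. \<Sum>j\<in>UNIV. \<bar>A $ i $ j\<bar>)"
  define P where "P = ((**) A ^^ k) (mat 1)"
  have row: "(\<Sum>l\<in>UNIV. \<bar>A $ i $ l\<bar>) \<le> c"
    unfolding c_def by (rule member_le_sum) (auto intro: sum_nonneg)
  have c0: "c \<ge> 0" unfolding c_def by (intro sum_nonneg) simp
  have "\<bar>(A ** P) $ i $ j\<bar> \<le> (\<Sum>l\<in>UNIV. \<bar>A $ i $ l * P $ l $ j\<bar>)"
    by (simp add: matrix_matrix_mult_def)
  also have "\<dots> \<le> (\<Sum>l\<in>UNIV. \<bar>A $ i $ l\<bar> * c ^ k)"
    unfolding abs_mult P_def c_def by (intro sum_mono mult_left_mono Suc.IH) simp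
  also have "\<dots> \<le> c * c ^ k"
    unfolding sum_distrib_right[symmetric] by (intro mult_right_mono row) (simp add: c0)
  finally show ?case by (simp add: P_def c_def)
qed

context
  fixes A :: "real^'m^'m"
begin

text \<open>Each entry of the exponential is a scalar power series in \<open>s\<close>, so
  convergence and termwise differentiation are those of real series.\<close>

definition mexp_coeff :: "'m \<Rightarrow> 'm \<Rightarrow> nat \<Rightarrow> real"
  where "mexp_coeff i j k = ((**) A ^^ k) (mat 1) $ i $ j / fact k"

lemma summable_mexp_coeff: "summable (\<lambda>k. mexp_coeff i j k * s ^ k)"
proof (rule summable_comparison_test')
  define c where "c = (\<Sum>i\<in>UNIV. \<Sum>j\<in>UNIV. \<bar>A $ i $ j\<bar>)"
  show "summable (\<lambda>k. inverse (fact k) * (c * \<bar>s\<bar>) ^ k)"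
    by (rule summable_exp)
  show "norm (mexp_coeff i j k * s ^ k) \<le> inverse (fact k) * (c * \<bar>s\<bar>) ^ k" if "k \<ge> 0" for k
  proof -
    have "\<bar>((**) A ^^ k) (mat 1) $ i $ j\<bar> * \<bar>s\<bar> ^ k \<le> c ^ k * \<bar>s\<bar> ^ k"
      unfolding c_def by (intro mult_right_mono matrix_power_bound) simp
    then have "\<bar>((**) A ^^ k) (mat 1) $ i $ j\<bar> * \<bar>s\<bar> ^ k / fact k \<le> c ^ k * \<bar>s\<bar> ^ k / fact k"
      by (intro divide_right_mono) auto
    then show ?thesis
      by (simp add: mexp_coeff_def abs_mult power_abs power_mult_distrib field_simps)
  qed
qed

lemma mexp_sums: "(\<lambda>k. mexp_coeff i j k * s ^ k) sums (mexp (s *\<^sub>R A) $ i $ j)"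
proof -
  define X :: "real^'m^'m" where "X = (\<chi> i j. \<Sum>k. mexp_coeff i j k * s ^ k)"
  have s: "(\<lambda>k. mexp_coeff i j k * s ^ k) sums (X $ i $ j)" for i j
    unfolding X_def using summable_sums[OF summable_mexp_coeff] by simp
  have "(\<lambda>k. (1 / fact k) *\<^sub>R ((**) (s *\<^sub>R A) ^^ k) (mat 1)) sums X"
    by (rule vec_sums) (use s in \<open>simp add: matrix_power_scaleR mexp_coeff_def field_simps\<close>)
  then have "mexp (s *\<^sub>R A) = X"
    unfolding mexp_def by (rule sums_unique[symmetric])
  then show ?thesis using s by simp
qed

lemma matrix_mexp_sums:
  "(\<lambda>k. ((**) A ^^ Suc k) (mat 1) $ i $ j / fact k * s ^ k) sums ((A ** mexp (s *\<^sub>R A)) $ i $ j)"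
proof -
  have "(\<lambda>k. \<Sum>l\<in>UNIV. A $ i $ l * (mexp_coeff l j k * s ^ k)) sums (\<Sum>l\<in>UNIV. A $ i $ l * mexp (s *\<^sub>R A) $ l $ j)"
    by (intro sums_sum sums_mult mexp_sums)
  moreover have "(\<Sum>l\<in>UNIV. A $ i $ l * (mexp_coeff l j k * s ^ k)) = ((**) A ^^ Suc k) (mat 1) $ i $ j / fact k * s ^ k" for k
    by (simp add: mexp_coeff_def matrix_matrix_mult_def sum_distrib_left sum_divide_distrib mult_ac)
  ultimately show ?thesis by (simp add: matrix_matrix_mult_def)
qed

lemma mexp_matrix_sums:
  "(\<lambda>k. ((**) A ^^ Suc k) (mat 1) $ i $ j / fact k * s ^ k) sums ((mexp (s *\<^sub>R A) ** A) $ i $ j)"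
proof -
  have "(\<lambda>k. \<Sum>l\<in>UNIV. mexp_coeff i l k * s ^ k * A $ l $ j) sums (\<Sum>l\<in>UNIV. mexp (s *\<^sub>R A) $ i $ l * A $ l $ j)"
    by (intro sums_sum sums_mult2 mexp_sums)
  moreover have "(\<Sum>l\<in>UNIV. mexp_coeff i l k * s ^ k * A $ l $ j) = ((**) A ^^ Suc k) (mat 1) $ i $ j / fact k * s ^ k" for k
    unfolding matrix_power_comm[symmetric]
    by (simp add: mexp_coeff_def matrix_matrix_mult_def sum_distrib_left sum_divide_distrib mult_ac)
  ultimately show ?thesis by (simp add: matrix_matrix_mult_def)
qed

lemma mexp_commute: "mexp (s *\<^sub>R A) ** A = A ** mexp (s *\<^sub>R A)"
  using sums_unique2[OF mexp_matrix_sums matrix_mexp_sums] by (simp add: vec_eq_iff)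

lemma mexp_0: "mexp (0 *\<^sub>R A) = mat 1"
proof -
  have "mexp (0 *\<^sub>R A) $ i $ j = mexp_coeff i j 0" for i j
    using sums_unique2[OF mexp_sums powser_sums_zero] by simp
  then show ?thesis by (simp add: vec_eq_iff mexp_coeff_def)
qed

lemma DERIV_mexp:
  "((\<lambda>s. mexp (s *\<^sub>R A) $ i $ j) has_real_derivative (A ** mexp (s *\<^sub>R A)) $ i $ j) (at s)"
proof -
  have "((\<lambda>s. \<Sum>k. mexp_coeff i j k * s ^ k) has_real_derivative (\<Sum>k. diffs (mexp_coeff i j) k * s ^ k)) (at s)"
    by (rule termdiffs_strong_converges_everywhere[OF summable_mexp_coeff])
  moreover have "(\<Sum>k. mexp_coeff i j k * s ^ k) = mexp (s *\<^sub>R A) $ i $ j" for s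
    using sums_unique[OF mexp_sums] by simp
  moreover have "diffs (mexp_coeff i j) k * s ^ k = ((**) A ^^ Suc k) (mat 1) $ i $ j / fact k * s ^ k" for k
    by (simp add: diffs_def mexp_coeff_def del: funpow.simps)
  ultimately show ?thesis
    using sums_unique[OF matrix_mexp_sums[of i j s]] by simp
qed

text \<open>The derivative in \<open>s\<close> vanishes because \<open>A\<close> commutes with its
  exponential, so the value at 0 persists. This places the one-parameter group among the invertible
  matrices, as \<open>S_set\<close> demands.\<close>

lemma mexp_inverse: "mexp (s *\<^sub>R A) ** mexp (- s *\<^sub>R A) = mat 1"
proof -
  define h where "h i j s = (mexp (s *\<^sub>R A) ** mexp (- s *\<^sub>R A)) $ i $ j" for i j s
  have "DERIV (h i j) s :> 0" for i j s
  proof -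
    have neg: "((\<lambda>s. mexp (- s *\<^sub>R A) $ l $ j) has_real_derivative - (A ** mexp (- s *\<^sub>R A)) $ l $ j) (at s)" for l s
      using DERIV_chain2[OF DERIV_mexp[of l j "- s"] DERIV_minus[OF DERIV_ident]] by simp
    have hd: "h i j = (\<lambda>s. \<Sum>l\<in>UNIV. mexp (s *\<^sub>R A) $ i $ l * mexp (- s *\<^sub>R A) $ l $ j)"
      by (rule ext) (simp add: h_def matrix_matrix_mult_def)
    have mm: "(P ** Q) $ i $ j = (\<Sum>l\<in>UNIV. P $ i $ l * Q $ l $ j)" for P Q :: "real^'m^'m"
      by (simp add: matrix_matrix_mult_def)
    have "(A ** mexp (s *\<^sub>R A)) ** mexp (- s *\<^sub>R A) = mexp (s *\<^sub>R A) ** (A ** mexp (- s *\<^sub>R A))"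
      unfolding mexp_commute[of s, symmetric] by (simp only: matrix_mul_assoc)
    then have "((A ** mexp (s *\<^sub>R A)) ** mexp (- s *\<^sub>R A)) $ i $ j
      - (mexp (s *\<^sub>R A) ** (A ** mexp (- s *\<^sub>R A))) $ i $ j = 0"
      by (simp only: diff_self)
    then have val: "(\<Sum>l\<in>UNIV. (A ** mexp (s *\<^sub>R A)) $ i $ l * mexp (- s *\<^sub>R A) $ l $ j
        + - (A ** mexp (- s *\<^sub>R A)) $ l $ j * mexp (s *\<^sub>R A) $ i $ l) = 0"
      unfolding mm sum_subtractf[symmetric] by (simp add: mult.commute)
    have "((\<lambda>s. \<Sum>l\<in>UNIV. mexp (s *\<^sub>R A) $ i $ l * mexp (- s *\<^sub>R A) $ l $ j) has_real_derivative
      (\<Sum>l\<in>UNIV. (A ** mexp (s *\<^sub>R A)) $ i $ l * mexp (- s *\<^sub>R A) $ l $ j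
        + - (A ** mexp (- s *\<^sub>R A)) $ l $ j * mexp (s *\<^sub>R A) $ i $ l)) (at s)"
      by (rule DERIV_sum, rule DERIV_mult[OF DERIV_mexp neg])
    then show ?thesis unfolding val hd .
  qed
  then have "h i j s = h i j 0" for i j by (intro DERIV_isconst_all allI)
  then have "h i j s = mat 1 $ i $ j" for i j
    using mexp_0 by (simp add: h_def)
  then show ?thesis
    unfolding h_def vec_eq_iff by blast
qed

lemma invertible_mexp: "invertible (mexp (s *\<^sub>R A))"
  unfolding invertible_right_inverse using mexp_inverse by blast

end

section \<open>The exponential acting on vectors, and its polynomial invariants\<close>

context based
begin

lemma coords_sum: "coords e (\<Sum>i\<in>UNIV. c $ i *\<^sub>R e i) = c"
proof (subst vec_eq_iff, rule allI)
  fix j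
  have "coords e (\<Sum>i\<in>UNIV. c $ i *\<^sub>R e i) $ j = (\<Sum>i\<in>UNIV. c $ i *\<^sub>R coords e (e i) $ j)"
    using linear_sum[OF linear_coords[of j], of "\<lambda>i. c $ i *\<^sub>R e i" UNIV]
    by (simp add: linear_scale[OF linear_coords[of j]])
  also have "\<dots> = (\<Sum>i\<in>UNIV. if j = i then c $ i else 0)"
    by (rule sum.cong) (simp_all add: coords_e)
  finally show "coords e (\<Sum>i\<in>UNIV. c $ i *\<^sub>R e i) $ j = c $ j" by simp
qed

lemma coords_inject: "coords e x = coords e y \<longleftrightarrow> x = y"
  by (metis coords_expand)

lemma coords_matrix_act: "coords e (matrix_act e A x) = A *v coords e x"
  unfolding matrix_act_def by (rule coords_sum)

lemma matrix_wrt_coords: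
  assumes "linear F"
  shows "matrix_wrt e F *v coords e x = coords e (F x)"
proof (subst vec_eq_iff, rule allI)
  fix i
  have "coords e (F x) $ i = (\<Sum>j\<in>UNIV. coords e x $ j *\<^sub>R coords e (F (e j)) $ i)"
    by (rule linear_expand[OF linear_compose[OF assms linear_coords, unfolded o_def]])
  then show "(matrix_wrt e F *v coords e x) $ i = coords e (F x) $ i"
    by (simp add: matrix_wrt_def matrix_vector_mult_def mult.commute)
qed

lemma matrix_act_mult: "matrix_act e (A ** B) x = matrix_act e A (matrix_act e B x)"
  unfolding coords_inject[symmetric] coords_matrix_act by (simp add: matrix_vector_mul_assoc)

lemma matrix_act_mat_1: "matrix_act e (mat 1) x = x"
  unfolding coords_inject[symmetric] coords_matrix_act by simp

lemma linear_matrix_act: "linear (matrix_act e A)"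
proof (rule linearI)
  have c: "coords e (x + y) = coords e x + coords e y" "coords e (r *\<^sub>R x) = r *\<^sub>R coords e x" for x y r
    using linear_add[OF linear_coords] linear_scale[OF linear_coords] by (simp_all add: vec_eq_iff)
  show "matrix_act e A (x + y) = matrix_act e A x + matrix_act e A y" for x y
    unfolding coords_inject[symmetric] c coords_matrix_act by (simp add: matrix_vector_right_distrib)
  show "matrix_act e A (r *\<^sub>R x) = r *\<^sub>R matrix_act e A x" for r x
    unfolding coords_inject[symmetric] c coords_matrix_act by (simp add: matrix_vector_mult_scaleR)
qed

lemma continuous_matrix_act: "continuous_on UNIV (\<lambda>A. matrix_act e A x)"
  unfolding matrix_act_def matrix_vector_mult_def by (simp, intro continuous_intros)

lemma mexp_act_derivative:
  "((\<lambda>s. matrix_act e (mexp (s *\<^sub>R A)) x) has_vector_derivative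
    matrix_act e A (matrix_act e (mexp (s *\<^sub>R A)) x)) (at s)"
proof -
  have "((\<lambda>s. (mexp (s *\<^sub>R A) *v coords e x) $ i) has_real_derivative ((A ** mexp (s *\<^sub>R A)) *v coords e x) $ i) (at s)" for i
    unfolding matrix_vector_mult_def vec_lambda_beta
    by (rule DERIV_sum, rule DERIV_cmult_right[OF DERIV_mexp])
  then have "((\<lambda>s. (mexp (s *\<^sub>R A) *v coords e x) $ i *\<^sub>R e i) has_vector_derivative
      ((A ** mexp (s *\<^sub>R A)) *v coords e x) $ i *\<^sub>R e i) (at s)" for i
    by (rule has_vector_derivative_scaleR[OF _ has_vector_derivative_const, THEN has_vector_derivative_eq_rhs]) simp
  then show ?thesis
    unfolding matrix_act_mult[symmetric] unfolding matrix_act_def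
    by (rule has_vector_derivative_sum)
qed

text \<open>Along an orbit the derivative of \<open>f\<close> in \<open>s\<close> is
  \<open>lie N f\<close> at the moving point. Its vanishing means constancy on the orbits, which
  extends to the closure by continuity; conversely the orbit is differentiated at
  \<open>s = 0\<close>.\<close>

lemma invariant_iff_lie:
  fixes L :: "'v \<Rightarrow> 'v"
  assumes f: "f \<in> hom_poly k"
  defines "N \<equiv> matrix_act e (transpose (matrix_wrt e L))"
  shows "lie N f = (\<lambda>x. 0) \<longleftrightarrow> (\<forall>A\<in>S_set e L. \<forall>x. f (matrix_act e A x) = f x)"
proof -
  define B where "B = transpose (matrix_wrt e L)"
  define y where "y s x = matrix_act e (mexp (s *\<^sub>R B)) x" for s x
  have y0: "y 0 x = x" for x unfolding y_def mexp_0 by (rule matrix_act_mat_1)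
  have D: "((\<lambda>s. f (y s x)) has_real_derivative lie N f (y s x)) (at s)" for x s
  proof -
    have "((\<lambda>s. y s x) has_derivative (\<lambda>t. t *\<^sub>R N (y s x))) (at s)"
      using mexp_act_derivative[of B x s] unfolding y_def N_def B_def has_vector_derivative_def .
    from has_derivative_compose[OF this has_derivative_dderiv[OF hom_polyD(4)[OF f, of "y s x"]]]
    have "((\<lambda>s. f (y s x)) has_derivative (\<lambda>t. dderiv (t *\<^sub>R N (y s x)) f (y s x))) (at s)" .
    moreover have "(\<lambda>t. dderiv (t *\<^sub>R N (y s x)) f (y s x)) = (*) (lie N f (y s x))"
      by (simp add: dderiv_scaleR_left[OF hom_polyD(4)[OF f]] fun_eq_iff lie_def mult.commute)
    ultimately show ?thesis by (simp add: has_field_derivative_def)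
  qed
  show ?thesis
  proof
    assume "lie N f = (\<lambda>x. 0)"
    then have "f (y s x) = f (y 0 x)" for s x
      using D by (intro DERIV_isconst_all[of "\<lambda>s. f (y s x)"] allI) simp
    then have inv: "f (matrix_act e (mexp (s *\<^sub>R B)) x) = f x" for s x
      unfolding y0 unfolding y_def .
    show "\<forall>A\<in>S_set e L. \<forall>x. f (matrix_act e A x) = f x"
    proof (intro ballI allI)
      fix A x assume "A \<in> S_set e L"
      then have A: "A \<in> closure (range (\<lambda>s. mexp (s *\<^sub>R B)))" by (simp add: S_set_def B_def)
      have "continuous_on UNIV (\<lambda>A. f (matrix_act e A x))"
        by (rule continuous_on_compose2[OF smooth_on_continuous[OF hom_polyD(3)[OF f]] continuous_matrix_act]) simp
      then have "closed {A. f (matrix_act e A x) = f x}"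
        by (intro closed_Collect_eq continuous_on_const)
      moreover have "range (\<lambda>s. mexp (s *\<^sub>R B)) \<subseteq> {A. f (matrix_act e A x) = f x}"
        using inv by (simp add: image_subset_iff)
      ultimately show "f (matrix_act e A x) = f x"
        using closure_minimal subsetD[OF _ A] by blast
    qed
  next
    assume S: "\<forall>A\<in>S_set e L. \<forall>x. f (matrix_act e A x) = f x"
    have "mexp (s *\<^sub>R B) \<in> S_set e L" for s
    proof -
      have "mexp (s *\<^sub>R B) \<in> closure (range (\<lambda>s. mexp (s *\<^sub>R B)))"
        by (rule subsetD[OF closure_subset]) simp
      then show ?thesis unfolding S_set_def B_def[symmetric] using invertible_mexp[of s B] by simp
    qed
    then have inv: "f (y s x) = f x" for s x using S unfolding y_def by blast
    have "lie N f x = 0" for x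
    proof -
      have "((\<lambda>s. f x) has_real_derivative lie N f x) (at 0)"
        using D[of x 0] unfolding inv y0 .
      then show ?thesis by (rule DERIV_unique[OF _ DERIV_const])
    qed
    then show "lie N f = (\<lambda>x. 0)" by (simp add: fun_eq_iff)
  qed
qed

section \<open>Smooth local inverses\<close>

text \<open>Cramer's rule expresses the inverse through determinants and one division.\<close>

lemma smooth_linear_inverse:
  fixes M :: "'a::euclidean_space \<Rightarrow> 'v \<Rightarrow> 'v"
  assumes S: "open S" and M: "\<And>w. smooth_on S (\<lambda>x. M x w)"
    and lin: "\<And>x. x \<in> S \<Longrightarrow> linear (M x)" and bij: "\<And>x. x \<in> S \<Longrightarrow> bij (M x)"
  shows "smooth_on S (\<lambda>x. inv_into UNIV (M x) v)"
proof -
  define D where "D x = matrix_wrt e (M x)" for x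
  \<comment> \<open>The numerator matrices of Cramer's rule.\<close>
  define R :: "'a \<Rightarrow> 'm \<Rightarrow> real^'m^'m"
    where "R x k = (\<chi> i j. if j = k then coords e v $ i else D x $ i $ j)" for x k
  have D: "smooth_on S (\<lambda>x. D x $ i $ j)" for i j
    unfolding D_def matrix_wrt_def vec_lambda_beta
    by (rule smooth_on_linear_compose[OF S bounded_linear_coords M])
  have R: "smooth_on S (\<lambda>x. R x k $ i $ j)" for k i j
    by (cases "j = k") (simp_all add: R_def D)
  have Dc: "D x *v coords e w = coords e (M x w)" if "x \<in> S" for x w
    unfolding D_def by (rule matrix_wrt_coords[OF lin[OF that]])
  have det: "det (D x) \<noteq> 0" if "x \<in> S" for x
  proof -
    have "inj ((*v) (D x))"
    proof (rule injI)
      fix c d assume eq: "D x *v c = D x *v d"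
      define w z where "w = (\<Sum>i\<in>UNIV. c $ i *\<^sub>R e i)" and "z = (\<Sum>i\<in>UNIV. d $ i *\<^sub>R e i)"
      have cw: "coords e w = c" "coords e z = d" unfolding w_def z_def by (rule coords_sum)+
      have "M x w = M x z"
        using eq Dc[OF that] unfolding cw[symmetric] by (simp add: coords_inject)
      then show "c = d" using bij_is_inj[OF bij[OF that]] cw by (metis injD)
    qed
    then show ?thesis by (simp add: invertible_det_nz[symmetric] invertible_left_inverse matrix_left_invertible_injective)
  qed
  have eq: "inv_into UNIV (M x) v = (\<Sum>k\<in>UNIV. (det (R x k) * inverse (det (D x))) *\<^sub>R e k)" if "x \<in> S" for x
  proof -
    have "M x (inv_into UNIV (M x) v) = v" using bij[OF that] by (simp add: bij_is_surj surj_f_inv_f)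
    then have "D x *v coords e (inv_into UNIV (M x) v) = coords e v" using Dc[OF that] by simp
    then have "coords e (inv_into UNIV (M x) v) = (\<chi> k. det (R x k) / det (D x))"
      unfolding R_def using cramer[OF det[OF that]] by blast
    then have "(\<Sum>k\<in>UNIV. coords e (inv_into UNIV (M x) v) $ k *\<^sub>R e k) = (\<Sum>k\<in>UNIV. (det (R x k) * inverse (det (D x))) *\<^sub>R e k)"
      by (simp add: divide_inverse)
    then show ?thesis unfolding coords_expand .
  qed
  have "smooth_on S (\<lambda>x. \<Sum>k\<in>UNIV. (det (R x k) * inverse (det (D x))) *\<^sub>R e k)"
    by (rule smooth_on_sum[OF S smooth_on_scaleR[OF S smooth_on_mult[OF S smooth_on_det[OF S R]
              smooth_on_inverse[OF S smooth_on_det[OF S D] det]] smooth_on_const]])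
  then show ?thesis by (rule smooth_on_cong[OF S _ eq[symmetric]])
qed

text \<open>The inverse function theorem yields a differentiable \<open>g\<close> whose derivative
  is the inverse of that of \<open>f\<close>, taken at \<open>g\<close>. Bootstrapping on this
  formula: if \<open>g\<close> has order \<open>k\<close>, so has the composite, and
  \<open>g\<close> gains one order.\<close>

lemma smooth_local_inverse:
  fixes f :: "'v \<Rightarrow> 'v"
  assumes f: "smooth_on UNIV f" and f0: "f 0 = 0" and df0: "\<And>v. dderiv v f 0 = v"
  obtains U V g where "open U" "0 \<in> U" "open V" "0 \<in> V" "homeomorphism U V f g" "smooth_on V g"
    "\<And>x. x \<in> U \<Longrightarrow> bij (\<lambda>v. dderiv v f x)"
proof -
  have bl: "bounded_linear (\<lambda>v. dderiv v f x)" for x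
    by (rule bounded_linear_dderiv[OF smooth_onD[OF f UNIV_I]])
  define f' where "f' x = Blinfun (\<lambda>v. dderiv v f x)" for x
  have f': "blinfun_apply (f' x) = (\<lambda>v. dderiv v f x)" for x
    unfolding f'_def by (rule bounded_linear_Blinfun_apply[OF bl])
  have der: "(f has_derivative blinfun_apply (f' x)) (at x)" if "x \<in> UNIV" for x
    unfolding f' by (rule has_derivative_dderiv[OF smooth_onD[OF f UNIV_I]])
  have cont: "continuous_on UNIV f'"
    by (rule continuous_on_blinfun_componentwise)
      (simp add: f' smooth_on_continuous[OF smooth_on_dderiv[OF f]])
  have inv0: "id_blinfun o\<^sub>L f' 0 = id_blinfun"
    by (rule blinfun_eqI) (simp add: f' df0)
  obtain U V g g' where UV: "open U" "0 \<in> U" "open V" "f 0 \<in> V" "homeomorphism U V f g"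
    and g': "\<And>y. y \<in> V \<Longrightarrow> (g has_derivative (g' y)) (at y)"
      "\<And>y. y \<in> V \<Longrightarrow> g' y = inv_into UNIV (blinfun_apply (f' (g y)))"
      "\<And>y. y \<in> V \<Longrightarrow> bij (blinfun_apply (f' (g y)))"
    by (rule inverse_function_theorem[OF open_UNIV der cont UNIV_I inv0]) auto
  have gV: "g ` V \<subseteq> U" and gf: "\<And>x. x \<in> U \<Longrightarrow> g (f x) = x" and fU: "\<And>x. x \<in> U \<Longrightarrow> f x \<in> V"
    using UV(5) unfolding homeomorphism_def by auto
  have bij: "bij (\<lambda>v. dderiv v f x)" if "x \<in> U" for x
    using g'(3)[OF fU[OF that]] unfolding gf[OF that] f' .
  have n: "smooth_on U (\<lambda>x. inv_into UNIV (\<lambda>v. dderiv v f x) v)" for v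
    by (rule smooth_linear_inverse[OF UV(1) _ linear_dderiv[OF smooth_onD[OF f UNIV_I]] bij])
      (rule smooth_on_subset[OF smooth_on_dderiv[OF f] subset_UNIV])
  have dg: "dderiv v g y = inv_into UNIV (\<lambda>v. dderiv v f (g y)) v" if "y \<in> V" for y v
    using dderiv_eq[OF g'(1)[OF that]] g'(2)[OF that] unfolding f' by simp
  have "C_diff_on k V g" for k
  proof (induction k)
    case 0
    show ?case using UV(5) unfolding homeomorphism_def by simp
  next
    case (Suc k)
    have nk: "C_diff_on k U (\<lambda>x. inv_into UNIV (\<lambda>v. dderiv v f x) v)" for v
      using n unfolding smooth_on_def by blast
    have "C_diff_on k V (dderiv v g)" for v
      by (rule C_diff_on_cong[OF UV(3) _ C_diff_on_compose[OF UV(3,1) gV Suc nk[of v]]])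
        (simp only: dg)
    moreover have "g differentiable at y" if "y \<in> V" for y
      using g'(1)[OF that] unfolding differentiable_def by blast
    ultimately show ?case unfolding C_diff_on.simps by blast
  qed
  then have "smooth_on V g" unfolding smooth_on_def by blast
  then show ?thesis
    using that[OF UV(1,2,3) _ UV(5)] UV(4) f0 bij by simp
qed

end

section \<open>Calculus of Taylor components\<close>

lemma iter_dderiv_compose_linear:
  fixes f :: "'a::euclidean_space \<Rightarrow> 'b::euclidean_space" and g :: "'a \<Rightarrow> 'a"
  assumes f: "smooth_on UNIV f" and g: "linear g"
  shows "(dderiv x ^^ k) (\<lambda>z. f (g z)) = (\<lambda>y. (dderiv (g x) ^^ k) f (g y))"
proof (induction k)
  case (Suc k)
  have bl: "bounded_linear g" using g by (simp add: linear_conv_bounded_linear)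
  have "dderiv x (\<lambda>z. (dderiv (g x) ^^ k) f (g z)) y = dderiv (g x) ((dderiv (g x) ^^ k) f) (g y)" for y
    using dderiv_compose[OF bounded_linear_imp_differentiable[OF bl]
        smooth_onD[OF smooth_on_iter_dderiv[OF f, of k "g x"] UNIV_I], of x y]
    by (simp add: dderiv_bounded_linear[OF bl])
  then show ?case by (simp add: Suc fun_eq_iff)
qed simp

lemma taylor_compose_linear:
  fixes f :: "'a::euclidean_space \<Rightarrow> 'b::euclidean_space" and g :: "'a \<Rightarrow> 'a"
  assumes "smooth_on UNIV f" "linear g"
  shows "taylor (\<lambda>z. f (g z)) k x = taylor f k (g x)"
  unfolding taylor_def iter_dderiv_compose_linear[OF assms] by (simp add: linear_0[OF assms(2)])

lemma flat_1_at_0: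
  assumes "flat (Suc p) f"
  shows "f 0 = 0"
proof -
  obtain C where "\<forall>\<^sub>F x in nhds 0. norm (f x) \<le> C * norm x ^ Suc p"
    using assms by (rule flatE)
  then show ?thesis using eventually_nhds_x_imp_x by fastforce
qed

context
  fixes S :: "'a::euclidean_space set"
  assumes S: "open S" "0 \<in> S"
begin

lemma taylor_eqI:
  fixes f g :: "'a \<Rightarrow> 'b::euclidean_space"
  assumes f: "smooth_on S f" and g: "smooth_on S g" and fl: "flat (Suc k) (\<lambda>x. f x - g x)"
  shows "taylor f k = taylor g k"
proof (rule taylor_unique[OF S f])
  show "homog j (taylor g j)" for j by (rule homog_taylor[OF S g])
  have "(\<lambda>x. f x - (\<Sum>j<Suc k. taylor g j x)) = (\<lambda>x. (f x - g x) + (g x - (\<Sum>j<Suc k. taylor g j x)))"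
    by (simp only: diff_add_cancel add_diff_eq)
  then show "flat (Suc k) (\<lambda>x. f x - (\<Sum>j<Suc k. taylor g j x))"
    using flat_add[OF fl taylor_remainder[OF S g, of "Suc k"]] by (simp only:)
qed simp

lemma taylor_sum:
  fixes f :: "'i \<Rightarrow> 'a \<Rightarrow> 'b::euclidean_space"
  assumes "\<And>i. i \<in> I \<Longrightarrow> smooth_on S (f i)"
  shows "taylor (\<lambda>x. \<Sum>i\<in>I. f i x) k x = (\<Sum>i\<in>I. taylor (f i) k x)"
  unfolding taylor_def by (simp only: iter_dderiv_sum[OF S(1) assms S(2)] scaleR_sum_right)

lemma flat_taylor:
  fixes f :: "'a \<Rightarrow> 'b::euclidean_space"
  assumes "smooth_on S f"
  shows "flat k (taylor f k)"
  by (rule flat_homog[OF homog_taylor[OF S assms]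
        smooth_on_continuous[OF smooth_on_polynomial[OF polynomial_taylor[OF S assms]]]])

lemma smooth_taylor:
  fixes f :: "'a \<Rightarrow> 'b::euclidean_space"
  shows "smooth_on S f \<Longrightarrow> smooth_on U (taylor f k)"
  by (rule smooth_on_subset[OF smooth_on_polynomial[OF polynomial_taylor[OF S]] subset_UNIV])

text \<open>The Cauchy product, obtained from uniqueness: in the product of the two truncations, all
  terms outside the triangle of total degree at most \<open>k\<close> have order
  \<open>Suc k\<close>, and so have the truncation errors.\<close>

lemma taylor_scaleR:
  fixes f :: "'a \<Rightarrow> real" and g :: "'a \<Rightarrow> 'b::euclidean_space"
  assumes f: "smooth_on S f" and g: "smooth_on S g"
  shows "taylor (\<lambda>x. f x *\<^sub>R g x) k = (\<lambda>x. \<Sum>j\<le>k. taylor f (k - j) x *\<^sub>R taylor g j x)"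
proof -
  define P where "P i x = (\<Sum>j\<le>i. taylor f (i - j) x *\<^sub>R taylor g j x)" for i x
  define T where "T j i x = taylor f i x *\<^sub>R taylor g j x" for j i x
  define p q where "p x = (\<Sum>i<Suc k. taylor f i x)" and "q x = (\<Sum>j<Suc k. taylor g j x)" for x
  let ?R = "{..k} \<times> {..k} - {(i, j). i + j \<le> k}"
  have fin: "finite ({..k} \<times> {..k})" by simp
  have sub: "{(i, j). i + j \<le> k} \<subseteq> {..k} \<times> {..k}" by auto
  have hom: "homog i (P i)" for i
    unfolding homog_def
  proof (intro allI)
    fix t x
    have "taylor f (i - j) (t *\<^sub>R x) *\<^sub>R taylor g j (t *\<^sub>R x) = t ^ i *\<^sub>R (taylor f (i - j) x *\<^sub>R taylor g j x)"
      if "j \<le> i" for j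
      using that by (simp add: homogD[OF homog_taylor[OF S f]] homogD[OF homog_taylor[OF S g]]
          power_add[symmetric] mult_ac)
    then show "P i (t *\<^sub>R x) = t ^ i *\<^sub>R P i x"
      unfolding P_def scaleR_sum_right by (intro sum.cong) auto
  qed
  have pq: "p x *\<^sub>R q x - (\<Sum>i<Suc k. P i x) = (\<Sum>(j, i)\<in>?R. T j i x)" for x
  proof -
    have "p x *\<^sub>R q x = (\<Sum>i\<le>k. \<Sum>j\<le>k. T j i x)"
      unfolding p_def q_def T_def lessThan_Suc_atMost
      by (simp add: scaleR_sum_left scaleR_sum_right sum.swap[of "\<lambda>i j. taylor f j x *\<^sub>R taylor g i x"])
    also have "\<dots> = (\<Sum>(j, i)\<in>{..k} \<times> {..k}. T j i x)"
      by (subst sum.swap) (simp add: sum.cartesian_product)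
    finally have 1: "p x *\<^sub>R q x = (\<Sum>(j, i)\<in>{..k} \<times> {..k}. T j i x)" .
    have "(\<Sum>i<Suc k. P i x) = (\<Sum>(j, i)\<in>{(i, j). i + j \<le> k}. T j i x)"
      unfolding P_def lessThan_Suc_atMost sum.triangle_reindex_eq T_def ..
    then show ?thesis
      unfolding 1 by (simp add: sum_diff[OF fin sub])
  qed
  have "flat (Suc k) (\<lambda>x. \<Sum>ij\<in>?R. T (fst ij) (snd ij) x)"
  proof (rule flat_sum)
    fix ij assume "ij \<in> ?R"
    then have le: "Suc k \<le> snd ij + fst ij" by auto
    have "flat (snd ij + fst ij) (\<lambda>x. T (fst ij) (snd ij) x)"
      unfolding T_def
      by (rule bounded_bilinear.flat[OF bounded_bilinear_scaleR flat_taylor[OF f] flat_taylor[OF g]])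
    then show "flat (Suc k) (\<lambda>x. T (fst ij) (snd ij) x)" by (rule flat_mono[OF _ le])
  qed
  then have R: "flat (Suc k) (\<lambda>x. \<Sum>(j, i)\<in>?R. T j i x)" by (simp add: case_prod_beta)
  have sp: "smooth_on S p" unfolding p_def[abs_def] by (rule smooth_on_sum[OF S(1) smooth_taylor[OF f]])
  have 1: "flat (Suc k + 0) (\<lambda>x. (f x - p x) *\<^sub>R g x)"
    unfolding p_def
    by (rule bounded_bilinear.flat[OF bounded_bilinear_scaleR taylor_remainder[OF S f] flat_0_smooth[OF S g]])
  have 2: "flat (0 + Suc k) (\<lambda>x. p x *\<^sub>R (g x - q x))"
    unfolding q_def
    by (rule bounded_bilinear.flat[OF bounded_bilinear_scaleR flat_0_smooth[OF S sp] taylor_remainder[OF S g]])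
  have eq: "f x *\<^sub>R g x - (\<Sum>i<Suc k. P i x) = (f x - p x) *\<^sub>R g x + p x *\<^sub>R (g x - q x) + (\<Sum>(j, i)\<in>?R. T j i x)" for x
    unfolding pq[symmetric] by (simp add: scaleR_left.diff scaleR_right.diff)
  have "flat (Suc k) (\<lambda>x. f x *\<^sub>R g x - (\<Sum>i<Suc k. P i x))"
    unfolding eq using flat_add[OF flat_add[OF 1[simplified] 2[simplified]] R] .
  then have "taylor (\<lambda>x. f x *\<^sub>R g x) k = P k"
    by (rule taylor_unique[OF S smooth_on_scaleR[OF S(1) f g] hom]) simp
  then show ?thesis by (simp add: P_def[abs_def])
qed

end

section \<open>Hamiltonian vector fields\<close>

locale symplectic = based e
  for e :: "'m::finite \<Rightarrow> 'v::euclidean_space" +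
  fixes \<omega> :: "'v \<Rightarrow> 'v \<Rightarrow> real"
  assumes symp: "symplectic_form \<omega>"
begin

lemma linear_right: "linear (\<omega> u)" and linear_left: "linear (\<lambda>u. \<omega> u v)"
  and alt: "\<omega> v v = 0" and nondeg: "(\<And>v. \<omega> u v = 0) \<Longrightarrow> u = 0"
  using symp by (auto simp: symplectic_form_def)

lemma bilin: "bounded_bilinear \<omega>"
  using linear_right linear_left
  by (simp add: bilinear_conv_bounded_bilinear[symmetric] bilinear_def)

lemmas add_left = linear_add[OF linear_left] and add_right = linear_add[OF linear_right]
  and diff_left = linear_diff[OF linear_left] and diff_right = linear_diff[OF linear_right]
  and scale_left = linear_scale[OF linear_left] and scale_right = linear_scale[OF linear_right]

lemma antisym: "\<omega> u v = - \<omega> v u"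
proof -
  have "\<omega> u v + \<omega> v u = 0"
    using alt[of "u + v"] unfolding add_left add_right by (simp add: alt)
  then show ?thesis by linarith
qed

lemma eq_iff: "(\<forall>v. \<omega> u v = \<omega> w v) \<longleftrightarrow> u = w"
  using nondeg[of "u - w"] by (auto simp: diff_left)

text \<open>Through the ambient inner product \<open>\<omega>\<close> becomes a linear map
  \<open>T\<close>, injective by nondegeneracy and therefore surjective in finite dimension.\<close>

lemma ex_sharp: "\<exists>u. \<forall>v. \<omega> u v = v \<bullet> b"
proof -
  define T where "T u = (\<Sum>b\<in>Basis. \<omega> u b *\<^sub>R b)" for u
  have Tb: "T u \<bullet> b = \<omega> u b" if "b \<in> Basis" for u b
    using that by (simp add: T_def inner_sum_left inner_Basis if_distrib cong: if_cong)
  have lin: "linear T"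
    by (rule linearI) (simp_all add: T_def add_left scale_left scaleR_add_left sum.distrib scaleR_sum_right)
  have ext: "\<omega> u v = T u \<bullet> v" for u v
  proof -
    have "\<omega> u v = \<omega> u (\<Sum>b\<in>Basis. (v \<bullet> b) *\<^sub>R b)" by (simp add: euclidean_representation)
    also have "\<dots> = (\<Sum>b\<in>Basis. (v \<bullet> b) * \<omega> u b)"
      by (simp add: linear_sum[OF linear_right] scale_right)
    also have "\<dots> = T u \<bullet> v"
      unfolding T_def inner_sum_left inner_scaleR_left by (simp add: inner_commute mult.commute)
    finally show ?thesis .
  qed
  have "inj T"
    unfolding linear_injective_0[OF lin] using nondeg by (simp add: ext)
  from surjD[OF linear_inj_imp_surj[OF lin this], of b]
  obtain u where "b = T u" ..
  then have "\<forall>v. \<omega> u v = v \<bullet> b" by (simp add: ext inner_commute)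
  then show ?thesis by (rule exI)
qed

definition sharp :: "'v \<Rightarrow> 'v" where "sharp b = (SOME u. \<forall>v. \<omega> u v = v \<bullet> b)"

lemma sharp: "\<omega> (sharp b) v = v \<bullet> b"
  using someI_ex[OF ex_sharp, of b] unfolding sharp_def by blast

lemma ham_vf_unique:
  assumes "\<And>v. \<omega> u v = dderiv v f x"
  shows "ham_vf \<omega> f x = u"
  unfolding ham_vf_def
proof (rule the_equality)
  show "\<forall>v. \<omega> u v = frechet_derivative f (at x) v" using assms by (simp add: dderiv_def)
  show "w = u" if "\<forall>v. \<omega> w v = frechet_derivative f (at x) v" for w
    using that assms eq_iff[of w u] by (simp add: dderiv_def)
qed

text \<open>Replaces the definite description by a formula linear in the partial derivatives, from
  which smoothness and vanishing order can be read off.\<close>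

lemma ham_vf_sharp:
  assumes "f differentiable at x"
  shows "ham_vf \<omega> f x = (\<Sum>b\<in>Basis. dderiv b f x *\<^sub>R sharp b)"
proof (rule ham_vf_unique)
  fix v
  show "\<omega> (\<Sum>b\<in>Basis. dderiv b f x *\<^sub>R sharp b) v = dderiv v f x"
    unfolding dderiv_expand[OF assms, of v] linear_sum[OF linear_left]
    by (simp add: scale_left sharp mult.commute)
qed

lemma omega_ham_vf: "f differentiable at x \<Longrightarrow> \<omega> (ham_vf \<omega> f x) v = dderiv v f x"
  unfolding ham_vf_sharp linear_sum[OF linear_left] dderiv_expand[of f x v]
  by (simp add: scale_left sharp mult.commute)

lemma ham_vf_add:
  "f differentiable at x \<Longrightarrow> g differentiable at x \<Longrightarrow>
    ham_vf \<omega> (\<lambda>y. f y + g y) x = ham_vf \<omega> f x + ham_vf \<omega> g x"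
  by (rule ham_vf_unique) (simp add: add_left omega_ham_vf dderiv_add)

lemma ham_vf_sum:
  "(\<And>i. i \<in> I \<Longrightarrow> f i differentiable at x) \<Longrightarrow>
    ham_vf \<omega> (\<lambda>y. \<Sum>i\<in>I. f i y) x = (\<Sum>i\<in>I. ham_vf \<omega> (f i) x)"
  by (rule ham_vf_unique) (simp add: linear_sum[OF linear_left] omega_ham_vf dderiv_sum)

lemma smooth_ham_vf:
  assumes S: "open S" and f: "smooth_on S f"
  shows "smooth_on S (ham_vf \<omega> f)"
  by (rule smooth_on_cong[OF S smooth_on_sum[OF S smooth_on_scaleR[OF S smooth_on_dderiv[OF f] smooth_on_const]]])
    (rule ham_vf_sharp[OF smooth_onD[OF f], symmetric])

lemma flat_ham_vf:
  assumes S: "open S" "0 \<in> S" and f: "smooth_on S f" and fl: "flat (Suc p) f"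
  shows "flat p (ham_vf \<omega> f)"
proof (rule flat_cong[of p "\<lambda>x. \<Sum>b\<in>Basis. dderiv b f x *\<^sub>R sharp b"])
  show "flat p (\<lambda>x. \<Sum>b\<in>Basis. dderiv b f x *\<^sub>R sharp b)"
    by (rule flat_sum[OF flat_linear_compose[OF bounded_linear_scaleR_left flat_dderiv[OF S f fl]]])
  show "\<forall>\<^sub>F x in nhds 0. (\<Sum>b\<in>Basis. dderiv b f x *\<^sub>R sharp b) = ham_vf \<omega> f x"
    by (rule eventually_cong_on[OF S]) (rule ham_vf_sharp[OF smooth_onD[OF f], symmetric])
qed

lemma semisymplectic_surj:
  assumes "linear h" "\<And>u v. \<omega> (h u) (h v) = c * \<omega> u v" "c * c = 1"
  shows "surj h"
proof (rule linear_inj_imp_surj[OF assms(1)])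
  show "inj h"
    unfolding linear_injective_0[OF assms(1)]
  proof (intro allI impI)
    fix u assume "h u = 0"
    then have "c * \<omega> u v = 0" for v
      using assms(2)[of u v] linear_0[OF linear_left] by simp
    moreover have "c \<noteq> 0" using assms(3) by auto
    ultimately show "u = 0" using nondeg by simp
  qed
qed

text \<open>As \<open>h\<close> is surjective, it suffices to pair with vectors \<open>h v\<close>.
  For \<open>d = c\<close> the factor is 1: the field then commutes with \<open>h\<close> even when
  \<open>h\<close> reverses \<open>\<omega>\<close>.\<close>

lemma ham_vf_equivariant:
  assumes h: "linear h" and c: "\<And>u v. \<omega> (h u) (h v) = c * \<omega> u v" "c * c = 1"
    and f: "smooth_on UNIV f" and fh: "\<And>x. f (h x) = d * f x"
  shows "ham_vf \<omega> f (h x) = (d * c) *\<^sub>R h (ham_vf \<omega> f x)"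
proof (rule ham_vf_unique)
  fix w
  have fd: "f differentiable at y" for y by (rule smooth_onD[OF f UNIV_I])
  have bl: "bounded_linear h" using h by (simp add: linear_conv_bounded_linear)
  from surjD[OF semisymplectic_surj[OF h c], of w] obtain v where w: "w = h v" ..
  have "dderiv w f (h x) = dderiv v (\<lambda>x. f (h x)) x"
    using dderiv_compose[OF bounded_linear_imp_differentiable[OF bl] fd, of v x]
    by (simp add: dderiv_bounded_linear[OF bl] w)
  also have "\<dots> = d * dderiv v f x"
    unfolding fh by (rule dderiv_linear_compose[OF bounded_linear_mult_right fd])
  finally show "\<omega> ((d * c) *\<^sub>R h (ham_vf \<omega> f x)) w = dderiv w f (h x)"
    using c(2) by (simp add: scale_left w c(1) omega_ham_vf[OF fd] mult.assoc[symmetric] mult.commute)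
qed

text \<open>Pairing the derivative of the field with a vector gives a second derivative of
  \<open>f\<close>, so the claim is the symmetry of the Hessian combined with the antisymmetry of
  \<open>\<omega>\<close>.\<close>

lemma infinitesimally_symplectic:
  assumes f: "smooth_on UNIV f"
  shows "\<omega> (dderiv u (ham_vf \<omega> f) x) v = - \<omega> u (dderiv v (ham_vf \<omega> f) x)"
proof -
  have X: "ham_vf \<omega> f differentiable at y" for y
    by (rule smooth_onD[OF smooth_ham_vf[OF open_UNIV f] UNIV_I])
  have d: "\<omega> (dderiv u (ham_vf \<omega> f) x) v = dderiv u (dderiv v f) x" for u v
  proof -
    have "(\<lambda>y. \<omega> (ham_vf \<omega> f y) v) = dderiv v f"
      using omega_ham_vf[OF smooth_onD[OF f UNIV_I]] by (simp add: fun_eq_iff)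
    then show ?thesis
      using dderiv_linear_compose[OF bounded_bilinear.bounded_linear_left[OF bilin] X, of u v x] by simp
  qed
  show ?thesis
    unfolding antisym[of u] d by (simp add: dderiv_commute[OF open_UNIV f UNIV_I, of u v])
qed

end

section \<open>Construction of the normal form\<close>

text \<open>\<open>sym h c s\<close> stands for a group element acting by \<open>h\<close>, with
  \<open>c\<close> and \<open>s\<close> its values under the two characters. This separates the
  construction from the group structure.\<close>

locale ham_setting = symplectic e \<omega>
  for e :: "'m::finite \<Rightarrow> 'v::euclidean_space" and \<omega> :: "'v \<Rightarrow> 'v \<Rightarrow> real" +
  fixes H :: "'v \<Rightarrow> real" and X L N :: "'v \<Rightarrow> 'v" and sym :: "('v \<Rightarrow> 'v) \<Rightarrow> real \<Rightarrow> real \<Rightarrow> bool"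
  assumes smooth_H: "smooth_on UNIV H" and X_def: "X = ham_vf \<omega> H" and X_0: "X 0 = 0"
    and L_def: "L = (\<lambda>v. dderiv v X 0)" and H_0: "H 0 = 0"
    and N_def: "N = matrix_act e (transpose (matrix_wrt e L))"
    and sym_linear: "sym h c s \<Longrightarrow> linear h"
    and sym_signs: "sym h c s \<Longrightarrow> c * c = 1 \<and> s * s = 1"
    and sym_omega: "sym h c s \<Longrightarrow> \<omega> (h u) (h v) = c * \<omega> u v"
    and sym_X: "sym h c s \<Longrightarrow> X (h x) = s *\<^sub>R h (X x)"
    and sym_N: "sym h c s \<Longrightarrow> N (h x) = s *\<^sub>R h (N x)"
begin

lemma H_diff: "H differentiable at x"
  by (rule smooth_onD[OF smooth_H UNIV_I])

lemma smooth_X: "smooth_on UNIV X"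
  unfolding X_def by (rule smooth_ham_vf[OF open_UNIV smooth_H])

lemma X_diff: "X differentiable at x"
  by (rule smooth_onD[OF smooth_X UNIV_I])

lemma omega_X: "\<omega> (X x) v = dderiv v H x"
  unfolding X_def by (rule omega_ham_vf[OF H_diff])

lemma linear_L: "linear L"
  unfolding L_def by (rule linear_dderiv[OF X_diff])

lemma sym_L:
  assumes "sym h c s"
  shows "L (h x) = s *\<^sub>R h (L x)"
proof -
  have bl: "bounded_linear h" using sym_linear[OF assms] by (simp add: linear_conv_bounded_linear)
  have "dderiv x (\<lambda>y. X (h y)) 0 = L (h x)"
    using dderiv_compose[OF bounded_linear_imp_differentiable[OF bl] X_diff, of x 0]
    by (simp add: dderiv_bounded_linear[OF bl] L_def linear_0[OF sym_linear[OF assms]])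
  moreover have "dderiv x (\<lambda>y. X (h y)) 0 = s *\<^sub>R h (L x)"
    unfolding sym_X[OF assms] L_def
    by (rule dderiv_linear_compose[OF bounded_linear_compose[OF bounded_linear_scaleR_right bl] X_diff])
  ultimately show ?thesis by simp
qed

sublocale adjoint_pair e L N
proof (intro adjoint_pair.intro adjoint_pair_axioms.intro based_axioms linear_L)
  show "linear N" unfolding N_def by (rule linear_matrix_act)
  show "coords e (L (e i)) $ j = coords e (N (e j)) $ i" for i j
    unfolding N_def coords_matrix_act
    by (simp add: matrix_vector_mult_def coords_e transpose_def matrix_wrt_def if_distrib cong: if_cong)
qed

definition H2 :: "'v \<Rightarrow> real" where "H2 = hess_quad e H"

text \<open>The Hessian is given by coordinates, the Taylor component by directions; expanding
  \<open>x\<close> twice in the basis connects them.\<close>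

lemma H2_taylor: "H2 = taylor H 2"
proof
  fix x
  have dd: "dderiv (e i) (dderiv x H) 0 = (\<Sum>j\<in>UNIV. coords e x $ j * dderiv (e i) (dderiv (e j) H) 0)" for i
  proof -
    have "dderiv (e i) (dderiv x H) 0 = dderiv x (dderiv (e i) H) 0"
      by (rule dderiv_commute[OF open_UNIV smooth_H UNIV_I])
    also have "\<dots> = (\<Sum>j\<in>UNIV. coords e x $ j *\<^sub>R dderiv (e j) (dderiv (e i) H) 0)"
      by (rule dderiv_coords[OF smooth_onD[OF smooth_on_dderiv[OF smooth_H] UNIV_I]])
    finally show ?thesis
      by (simp add: dderiv_commute[OF open_UNIV smooth_H UNIV_I, of _ "e i"])
  qed
  have "dderiv x (dderiv x H) 0 = (\<Sum>i\<in>UNIV. coords e x $ i *\<^sub>R dderiv (e i) (dderiv x H) 0)"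
    by (rule dderiv_coords[OF smooth_onD[OF smooth_on_dderiv[OF smooth_H] UNIV_I]])
  also have "\<dots> = coords e x \<bullet> (hessian_wrt e H 0 *v coords e x)"
    by (simp add: dd inner_vec_def hessian_wrt_def matrix_vector_mult_def mult.commute)
  finally show "H2 x = taylor H 2 x"
    by (simp add: H2_def hess_quad_def taylor_def numeral_2_eq_2)
qed

lemma hom_poly_H2: "H2 \<in> hom_poly 2"
  unfolding H2_taylor hom_poly_iff real_polynomial_function_eq
  using polynomial_taylor[OF open_UNIV UNIV_I smooth_H] homog_taylor[OF open_UNIV UNIV_I smooth_H] by blast

lemma smooth_H2: "smooth_on UNIV H2"
  by (rule hom_polyD(3)[OF hom_poly_H2])

lemma dderiv_H2: "dderiv v H2 x = \<omega> (L x) v"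
proof -
  have "dderiv v H2 x = taylor (dderiv v H) 1 x"
    using dderiv_taylor[OF open_UNIV UNIV_I smooth_H, of v 1] by (simp add: H2_taylor numeral_2_eq_2)
  also have "\<dots> = dderiv x (dderiv v H) 0" by (simp add: taylor_def)
  also have "dderiv v H = (\<lambda>y. \<omega> (X y) v)" by (simp add: omega_X fun_eq_iff)
  also have "dderiv x (\<lambda>y. \<omega> (X y) v) 0 = \<omega> (dderiv x X 0) v"
    by (rule dderiv_linear_compose[OF bounded_bilinear.bounded_linear_left[OF bilin] X_diff])
  finally show ?thesis by (simp add: L_def)
qed

lemma ham_vf_H2: "ham_vf \<omega> H2 x = L x"
  by (rule ham_vf_unique) (simp add: dderiv_H2)

lemma poisson_H2:
  assumes "f \<in> hom_poly k"
  shows "poisson \<omega> f H2 = lie L f"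
  unfolding poisson_def ham_vf_H2 omega_ham_vf[OF hom_polyD(4)[OF assms]] lie_def[abs_def] ..

text \<open>\<open>X 0 = 0\<close> removes the linear term, since the derivative of \<open>H\<close>
  at 0 is \<open>\<omega>\<close> paired with \<open>X 0\<close>.\<close>

lemma flat_H_H2: "flat 3 (\<lambda>x. H x - H2 x)"
proof -
  have t0: "taylor H 0 x = 0" for x by (simp add: taylor_def H_0)
  have t1: "taylor H (Suc 0) x = 0" for x
    using omega_X[of 0 x] by (simp add: taylor_def X_0 linear_0[OF linear_left])
  have "(\<Sum>j<3. taylor H j x) = H2 x" for x
    by (simp add: numeral_3_eq_3 t0 t1 H2_taylor numeral_2_eq_2)
  then show ?thesis using taylor_remainder[OF open_UNIV UNIV_I smooth_H, of 3] by simp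
qed

text \<open>The form contributes \<open>c\<close> and the equivariance of \<open>X\<close>
  contributes \<open>s\<close>: both sides have the same derivative, and both vanish at 0.\<close>

lemma sym_H:
  assumes sy: "sym h c s"
  shows "H (h x) = c * s * H x"
proof -
  have bl: "bounded_linear h" using sym_linear[OF sy] by (simp add: linear_conv_bounded_linear)
  define D where "D x = H (h x) - c * s * H x" for x
  have sm: "smooth_on UNIV (\<lambda>x. H (h x))"
    by (rule smooth_on_compose[OF open_UNIV open_UNIV subset_UNIV smooth_on_linear[OF bl] smooth_H])
  have sm2: "smooth_on UNIV (\<lambda>x. c * s * H x)"
    by (rule smooth_on_linear_compose[OF open_UNIV bounded_linear_mult_right smooth_H])
  have smD: "smooth_on UNIV D"
    unfolding D_def[abs_def] by (rule smooth_on_diff[OF open_UNIV sm sm2])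
  have "dderiv v D x = 0" for v x
  proof -
    have "dderiv v D x = dderiv v (\<lambda>x. H (h x)) x - dderiv v (\<lambda>x. c * s * H x) x"
      unfolding D_def[abs_def] by (rule dderiv_diff[OF smooth_onD[OF sm UNIV_I] smooth_onD[OF sm2 UNIV_I]])
    also have "dderiv v (\<lambda>x. H (h x)) x = \<omega> (X (h x)) (h v)"
      using dderiv_compose[OF bounded_linear_imp_differentiable[OF bl] H_diff, of v x]
      by (simp add: dderiv_bounded_linear[OF bl] omega_X)
    also have "\<dots> = c * s * dderiv v H x"
      by (simp add: sym_X[OF sy] scale_left sym_omega[OF sy] omega_X)
    also have "dderiv v (\<lambda>x. c * s * H x) x = c * s * dderiv v H x"
      by (rule dderiv_linear_compose[OF bounded_linear_mult_right H_diff])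
    finally show ?thesis by simp
  qed
  then have "(D has_derivative (\<lambda>h. 0)) (at x within UNIV)" for x
    using has_derivative_dderiv[OF smooth_onD[OF smD UNIV_I], of x] by simp
  then obtain d where d: "\<And>x. D x = d"
    using has_derivative_zero_constant[OF convex_UNIV, of D] by auto
  have "D 0 = 0" by (simp add: D_def linear_0[OF sym_linear[OF sy]] H_0)
  then have "D x = 0" using d by metis
  then show ?thesis by (simp add: D_def)
qed

lemma sym_H2:
  assumes sy: "sym h c s"
  shows "H2 (h x) = c * s * H2 x"
proof -
  have "H2 (h x) = taylor (\<lambda>x. H (h x)) 2 x"
    unfolding H2_taylor by (rule taylor_compose_linear[OF smooth_H sym_linear[OF sy], symmetric])
  also have "\<dots> = c * s * taylor H 2 x"
    unfolding sym_H[OF sy]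
    by (rule taylor_linear_compose[OF open_UNIV UNIV_I smooth_H bounded_linear_mult_right])
  finally show ?thesis by (simp add: H2_taylor)
qed

lemma flat_1_near_id:
  assumes "flat 2 (\<lambda>z. u z - z)"
  shows "flat 1 (u :: 'v \<Rightarrow> 'v)"
proof -
  have "flat 1 (\<lambda>z. (u z - z) + z)"
    by (rule flat_add[OF flat_mono[OF assms]]) (simp_all add: flatI[of _ 1])
  then show ?thesis by simp
qed

text \<open>Three errors of order \<open>m + 2\<close>: the part of \<open>f\<close> beyond
  \<open>H2\<close> has derivatives of order 2; replacing \<open>u z\<close> by \<open>z\<close>
  inside \<open>L\<close> costs order 2; the term quadratic in \<open>h\<close> has order
  \<open>2 * m\<close>. The last one is where \<open>m \<ge> 2\<close> enters.\<close>

lemma quadratic_increment: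
  assumes f: "smooth_on UNIV f" and f2: "flat 3 (\<lambda>x. f x - H2 x)"
    and u: "flat 2 (\<lambda>z. u z - z)" and h: "flat m h" and m: "m \<ge> 2"
  shows "flat (m + 2) (\<lambda>z. f (u z + h z) - f (u z) - \<omega> (L z) (h z))"
proof -
  have u1: "flat 1 u" by (rule flat_1_near_id[OF u])
  have uh1: "flat 1 (\<lambda>z. u z + h z)"
    by (rule flat_add[OF u1 flat_mono[OF h]]) (use m in simp)
  have sm: "smooth_on UNIV (\<lambda>x. f x - H2 x)"
    by (rule smooth_on_diff[OF open_UNIV f smooth_H2])
  have "flat (2 + m) (\<lambda>z. (f (u z + h z) - H2 (u z + h z)) - (f (u z) - H2 (u z)))"
    using flat_mean_value[OF open_UNIV UNIV_I sm flat_dderiv[OF open_UNIV UNIV_I sm] uh1 u1, of 2 m]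
      f2 h by (simp add: numeral_3_eq_3 numeral_2_eq_2)
  then have A: "flat (m + 2) (\<lambda>z. (f (u z + h z) - H2 (u z + h z)) - (f (u z) - H2 (u z)))"
    by (simp add: add.commute)
  have blL: "bounded_linear L" using linear_L by (simp add: linear_conv_bounded_linear)
  have "flat (2 + m) (\<lambda>z. \<omega> (L (u z - z)) (h z))"
    by (rule bounded_bilinear.flat[OF bilin flat_linear_compose[OF blL u] h])
  then have B: "flat (m + 2) (\<lambda>z. \<omega> (L (u z - z)) (h z))" by (simp add: add.commute)
  have C: "flat (m + 2) (\<lambda>z. \<omega> (L (h z)) (h z) / 2)"
    by (rule flat_linear_compose[OF bounded_linear_divide
          flat_mono[OF bounded_bilinear.flat[OF bilin flat_linear_compose[OF blL h] h]]]) (use m in simp)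
  have symm: "\<omega> (L x) y = \<omega> (L y) x" for x y
  proof -
    have "\<omega> (L x) y = taylor (dderiv y H) 1 x" for x y
      using dderiv_taylor[OF open_UNIV UNIV_I smooth_H, of y 1] dderiv_H2[of y x]
      by (simp add: H2_taylor numeral_2_eq_2)
    then show ?thesis
      by (simp add: taylor_def dderiv_commute[OF open_UNIV smooth_H UNIV_I, of x y])
  qed
  have H2q: "H2 x = \<omega> (L x) x / 2" for x
    using euler_homog[OF hom_poly_H2, of x] by (simp add: dderiv_H2)
  have "H2 (x + y) = H2 x + \<omega> (L x) y + \<omega> (L y) y / 2" for x y
    unfolding H2q by (simp add: linear_add[OF linear_L] add_left add_right symm[of y x])
  then have eq: "f (u z + h z) - f (u z) - \<omega> (L z) (h z)
    = ((f (u z + h z) - H2 (u z + h z)) - (f (u z) - H2 (u z))) + \<omega> (L (u z - z)) (h z) + \<omega> (L (h z)) (h z) / 2" for z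
    by (simp add: linear_diff[OF linear_L] diff_left)
  show ?thesis unfolding eq by (rule flat_add[OF flat_add[OF A B] C])
qed

text \<open>The character is \<open>c\<close> and not \<open>c * s\<close>, so that the field of
  \<open>F\<close> commutes with the symmetries. Order 3 makes \<open>mid t F\<close> tangent to the
  identity.\<close>

definition gen_ok :: "('v \<Rightarrow> real) \<Rightarrow> bool"
  where "gen_ok F \<longleftrightarrow> real_polynomial_function F \<and> flat 3 F \<and>
    (\<forall>h c s x. sym h c s \<longrightarrow> F (h x) = c * F x)"

text \<open>The kernel of \<open>lie N\<close> encodes invariance under \<open>S_set e L\<close>;
  \<open>c * s\<close> is the character of \<open>H\<close>.\<close>

definition nf_ok :: "nat \<Rightarrow> (nat \<Rightarrow> 'v \<Rightarrow> real) \<Rightarrow> bool"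
  where "nf_ok m K \<longleftrightarrow> (\<forall>k\<in>{3..m}. K k \<in> hom_poly k \<and> lie N (K k) = (\<lambda>x. 0) \<and>
    (\<forall>h c s x. sym h c s \<longrightarrow> K k (h x) = c * s * K k x))"

definition nf :: "nat \<Rightarrow> (nat \<Rightarrow> 'v \<Rightarrow> real) \<Rightarrow> 'v \<Rightarrow> real"
  where "nf m K x = H2 x + (\<Sum>k=3..m. K k x)"

lemma nf_okD:
  assumes "nf_ok m K" "k \<in> {3..m}"
  shows "K k \<in> hom_poly k" "lie N (K k) = (\<lambda>x. 0)" "sym h c s \<Longrightarrow> K k (h x) = c * s * K k x"
  using assms unfolding nf_ok_def by blast+

lemma smooth_nf:
  assumes "nf_ok m K"
  shows "smooth_on UNIV (nf m K)"
  unfolding nf_def[abs_def]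
  by (rule smooth_on_add[OF open_UNIV smooth_H2 smooth_on_sum[OF open_UNIV hom_polyD(3)[OF nf_okD(1)[OF assms]]]])

lemma flat_hom_poly:
  fixes f :: "'v \<Rightarrow> real"
  assumes "f \<in> hom_poly k"
  shows "flat k f"
  by (rule flat_homog[OF hom_polyD(2)[OF assms] smooth_on_continuous[OF hom_polyD(3)[OF assms]]])

lemma flat_nf_H2:
  assumes "nf_ok m K"
  shows "flat 3 (\<lambda>x. nf m K x - H2 x)"
proof -
  have "flat 3 (\<lambda>x. \<Sum>k=3..m. K k x)"
    by (rule flat_sum[OF flat_mono[OF flat_hom_poly[OF nf_okD(1)[OF assms]]]]) auto
  then show ?thesis by (simp add: nf_def)
qed

lemma sym_nf:
  assumes "nf_ok m K" "sym h c s"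
  shows "nf m K (h x) = c * s * nf m K x"
  unfolding nf_def sym_H2[OF assms(2)] distrib_left sum_distrib_left
  by (simp add: nf_okD(3)[OF assms(1) _ assms(2)])

lemma smooth_gen: "gen_ok F \<Longrightarrow> smooth_on UNIV F"
  by (simp add: gen_ok_def smooth_on_real_polynomial)

lemma smooth_ham_gen: "gen_ok F \<Longrightarrow> smooth_on UNIV (ham_vf \<omega> F)"
  by (rule smooth_ham_vf[OF open_UNIV smooth_gen])

lemma flat_ham_gen:
  assumes "gen_ok F"
  shows "flat 2 (ham_vf \<omega> F)"
  by (rule flat_ham_vf[OF open_UNIV UNIV_I smooth_gen[OF assms]])
    (use assms in \<open>simp add: gen_ok_def numeral_3_eq_3 numeral_2_eq_2\<close>)

text \<open>Used with \<open>t = 1/2\<close> and \<open>t = -1/2\<close>: the two halves of the implicit midpoint map.\<close>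

definition mid :: "real \<Rightarrow> ('v \<Rightarrow> real) \<Rightarrow> 'v \<Rightarrow> 'v"
  where "mid t F z = z + t *\<^sub>R ham_vf \<omega> F z"

lemma smooth_mid: "gen_ok F \<Longrightarrow> smooth_on UNIV (mid t F)"
  unfolding mid_def[abs_def]
  by (rule smooth_on_add[OF open_UNIV smooth_on_linear[OF bounded_linear_ident]
        smooth_on_linear_compose[OF open_UNIV bounded_linear_scaleR_right smooth_ham_gen]])

lemma flat_mid_id: "gen_ok F \<Longrightarrow> flat 2 (\<lambda>z. mid t F z - z)"
  unfolding mid_def using flat_linear_compose[OF bounded_linear_scaleR_right flat_ham_gen] by simp

lemma sym_mid:
  assumes F: "gen_ok F" and sy: "sym h c s"
  shows "mid t F (h z) = h (mid t F z)"
proof -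
  have c: "c * c = 1" using sym_signs[OF sy] by simp
  have "F (h x) = c * F x" for x using F sy unfolding gen_ok_def by blast
  from ham_vf_equivariant[OF sym_linear[OF sy] sym_omega[OF sy] c smooth_gen[OF F] this, of z]
  have "ham_vf \<omega> F (h z) = h (ham_vf \<omega> F z)" by (simp add: c)
  then show ?thesis
    by (simp add: mid_def linear_add[OF sym_linear[OF sy]] linear_scale[OF sym_linear[OF sy]])
qed

text \<open>Adding \<open>G\<close> to \<open>F\<close> and \<open>Q\<close> to \<open>K\<close> in
  degree \<open>Suc m\<close> changes the defect by \<open>- lie L G - Q\<close> up to order
  \<open>m + 2\<close>. The homological equation for its leading part therefore raises the order by
  one.\<close>

lemma normal_form_exists:
  assumes "m \<ge> 2"
  shows "\<exists>F K. gen_ok F \<and> nf_ok m K \<and> flat (Suc m) (\<lambda>z. H (mid (1/2) F z) - nf m K (mid (-1/2) F z))"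
  using assms
proof (induction m rule: dec_induct)
  \<comment> \<open>With \<open>F = 0\<close> both halves are the identity, and \<open>H\<close>
    agrees with its quadratic part to order 3.\<close>
  case base
  have "gen_ok (\<lambda>x. 0)" by (simp add: gen_ok_def real_polynomial_function.intros(2))
  moreover have "nf_ok 2 (\<lambda>k x. 0)" by (simp add: nf_ok_def)
  moreover have "mid t (\<lambda>x. 0) z = z" for t z
  proof -
    have "ham_vf \<omega> (\<lambda>x. 0) z = 0" by (rule ham_vf_unique) (simp add: linear_0[OF linear_left])
    then show ?thesis by (simp add: mid_def)
  qed
  then have "flat (Suc 2) (\<lambda>z. H (mid (1/2) (\<lambda>x. 0) z) - nf 2 (\<lambda>k x. 0) (mid (-1/2) (\<lambda>x. 0) z))"
    using flat_H_H2 by (simp add: nf_def numeral_3_eq_3 numeral_2_eq_2)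
  ultimately show ?case by blast
next
  case (step m)
  then obtain F K where F: "gen_ok F" and K: "nf_ok m K"
    and W: "flat (Suc m) (\<lambda>z. H (mid (1/2) F z) - nf m K (mid (-1/2) F z))" by blast
  define a b where "a = mid (1/2) F" and "b = mid (-1/2) F"
  define w where "w z = H (a z) - nf m K (b z)" for z
  define w' where "w' = taylor w (Suc m)"
  have sa: "smooth_on UNIV (\<lambda>z. H (a z))"
    unfolding a_def by (rule smooth_on_compose[OF open_UNIV open_UNIV subset_UNIV smooth_mid[OF F] smooth_H])
  have sb: "smooth_on UNIV (\<lambda>z. nf m K (b z))"
    unfolding b_def by (rule smooth_on_compose[OF open_UNIV open_UNIV subset_UNIV smooth_mid[OF F] smooth_nf[OF K]])
  have sw: "smooth_on UNIV w"
    unfolding w_def[abs_def] by (rule smooth_on_diff[OF open_UNIV sa sb])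
  have fw: "flat (Suc m) w" using W by (simp add: w_def[abs_def] a_def b_def)
  have w': "w' \<in> hom_poly (Suc m)"
    unfolding w'_def hom_poly_iff real_polynomial_function_eq
    using polynomial_taylor[OF open_UNIV UNIV_I sw] homog_taylor[OF open_UNIV UNIV_I sw] by blast
  have ww': "flat (m + 2) (\<lambda>z. w z - w' z)"
  proof -
    have "taylor w j z = 0" if "j < Suc m" for j z
      using fw that unfolding flat_iff_taylor[OF open_UNIV UNIV_I sw] by simp
    then have "(\<Sum>j<m + 2. taylor w j z) = w' z" for z
      by (simp add: w'_def)
    then show ?thesis using taylor_remainder[OF open_UNIV UNIV_I sw, of "m + 2"] by simp
  qed
  have symw': "w' (h x) = c * s * w' x" if sy: "sym h c s" for h c s x
  proof -
    have "w (h z) = c * s * w z" for z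
      unfolding w_def a_def b_def sym_mid[OF F sy] sym_H[OF sy] sym_nf[OF K sy] by (simp add: algebra_simps)
    then have "taylor (\<lambda>z. w (h z)) (Suc m) x = c * s * taylor w (Suc m) x"
      using taylor_linear_compose[OF open_UNIV UNIV_I sw bounded_linear_mult_right, of "c * s" "Suc m" x] by simp
    then show ?thesis
      unfolding w'_def taylor_compose_linear[OF sw sym_linear[OF sy]] .
  qed
  obtain G Q where G: "G \<in> hom_poly (Suc m)" and Q: "Q \<in> hom_poly (Suc m)"
    and GQ: "w' = (\<lambda>x. lie L G x + Q x)" and NQ: "lie N Q = (\<lambda>x. 0)"
    and eqv: "\<forall>h s c. linear h \<longrightarrow> s * s = 1 \<longrightarrow> (\<forall>x. L (h x) = s *\<^sub>R h (L x)) \<longrightarrow> (\<forall>x. N (h x) = s *\<^sub>R h (N x)) \<longrightarrow>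
      (\<forall>x. w' (h x) = c * w' x) \<longrightarrow> (\<forall>x. Q (h x) = c * Q x) \<and> (\<forall>x. G (h x) = c * s * G x)"
    by (rule equivariant_decomposition[OF w'])
  have symGQ: "Q (h x) = c * s * Q x" "G (h x) = c * G x" if sy: "sym h c s" for h c s x
  proof -
    have ss: "s * s = 1" using sym_signs[OF sy] by simp
    \<comment> \<open>Equivariance is applied with the character \<open>c * s\<close> of the defect;
      the generator then has \<open>(c * s) * s = c\<close>, as \<open>gen_ok\<close>
      demands.\<close>
    have *: "(\<forall>x. Q (h x) = c * s * Q x) \<and> (\<forall>x. G (h x) = (c * s) * s * G x)"
      using eqv[rule_format, OF sym_linear[OF sy] ss sym_L[OF sy] sym_N[OF sy] symw'[OF sy]] by blast
    then show "Q (h x) = c * s * Q x" by blast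
    show "G (h x) = c * G x" using * ss by (simp add: mult.assoc)
  qed
  define F' where "F' x = F x + G x" for x
  define K' where "K' = K(Suc m := Q)"
  have m3: "3 \<le> Suc m" using step.hyps by simp
  have F': "gen_ok F'"
    unfolding gen_ok_def
  proof (intro conjI allI impI)
    show "real_polynomial_function F'"
      unfolding F'_def[abs_def] using F hom_polyD(1)[OF G] by (simp add: gen_ok_def real_polynomial_function.intros(3))
    show "flat 3 F'"
      unfolding F'_def[abs_def] using F flat_mono[OF flat_hom_poly[OF G] m3] by (intro flat_add) (simp_all add: gen_ok_def)
    show "F' (h x) = c * F' x" if "sym h c s" for h c s x
    proof -
      have "F (h x) = c * F x" using F that unfolding gen_ok_def by blast
      then show ?thesis by (simp add: F'_def symGQ(2)[OF that] distrib_left)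
    qed
  qed
  have K': "nf_ok (Suc m) K'"
    unfolding nf_ok_def
  proof (intro ballI)
    fix k assume k: "k \<in> {3..Suc m}"
    show "K' k \<in> hom_poly k \<and> lie N (K' k) = (\<lambda>x. 0) \<and> (\<forall>h c s x. sym h c s \<longrightarrow> K' k (h x) = c * s * K' k x)"
    proof (cases "k = Suc m")
      case True
      then show ?thesis using Q NQ symGQ(1) by (simp add: K'_def)
    next
      case False
      then have "k \<in> {3..m}" using k by simp
      then show ?thesis using nf_okD[OF K] False by (simp add: K'_def)
    qed
  qed
  have nfK': "nf (Suc m) K' x = nf m K x + Q x" for x
  proof -
    have "(\<Sum>k=3..m. K' k x) = (\<Sum>k=3..m. K k x)"
      by (rule sum.cong) (simp_all add: K'_def)
    then show ?thesis using m3 by (simp add: nf_def K'_def)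
  qed
  have midF': "mid t F' z = mid t F z + t *\<^sub>R ham_vf \<omega> G z" for t z
    unfolding mid_def F'_def[abs_def]
    by (simp add: ham_vf_add[OF smooth_onD[OF smooth_gen[OF F] UNIV_I] hom_polyD(4)[OF G]] scaleR_right_distrib)
  have fXG: "flat m (\<lambda>z. t *\<^sub>R ham_vf \<omega> G z)" for t
    by (rule flat_linear_compose[OF bounded_linear_scaleR_right
          flat_ham_vf[OF open_UNIV UNIV_I hom_polyD(3)[OF G] flat_hom_poly[OF G]]])
  define A where "A z = (1/2) *\<^sub>R ham_vf \<omega> G z" for z
  define B where "B z = (-1/2) *\<^sub>R ham_vf \<omega> G z" for z
  have fA: "flat m A" and fB: "flat m B"
    using fXG unfolding A_def[abs_def] B_def[abs_def] by blast+
  have fa: "flat 2 (\<lambda>z. a z - z)" and fb: "flat 2 (\<lambda>z. b z - z)"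
    unfolding a_def b_def using flat_mid_id[OF F] by blast+
  have 1: "flat (m + 2) (\<lambda>z. H (a z + A z) - H (a z) - \<omega> (L z) (A z))"
    by (rule quadratic_increment[OF smooth_H flat_H_H2 fa fA step.hyps(1)])
  have 2: "flat (m + 2) (\<lambda>z. nf m K (b z + B z) - nf m K (b z) - \<omega> (L z) (B z))"
    by (rule quadratic_increment[OF smooth_nf[OF K] flat_nf_H2[OF K] fb fB step.hyps(1)])
  have fbB: "flat 2 (\<lambda>z. (b z + B z) - z)"
    using flat_add[OF fb flat_mono[OF fB step.hyps(1)]] by (simp add: algebra_simps)
  \<comment> \<open>The derivative of \<open>Q\<close> has order \<open>m\<close>, and its argument
    moves by order 2.\<close>
  have 3: "flat (m + 2) (\<lambda>z. Q (b z + B z) - Q z)"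
    by (rule flat_mean_value[OF open_UNIV UNIV_I hom_polyD(3)[OF Q] flat_hom_poly[OF hom_poly_dderiv[OF Q]]
          flat_1_near_id[OF fbB] _ fbB]) (simp add: flatI[of _ 1])
  \<comment> \<open>The steps \<open>1/2\<close> and \<open>-1/2\<close> add up to one full bracket,
    and antisymmetry supplies the minus sign that cancels \<open>lie L G\<close> in
    \<open>w'\<close>.\<close>
  have lin: "\<omega> (L z) (A z) - \<omega> (L z) (B z) = - lie L G z" for z
  proof -
    have "\<omega> (L z) (ham_vf \<omega> G z) = - lie L G z"
      using antisym[of "L z" "ham_vf \<omega> G z"] omega_ham_vf[OF hom_polyD(4)[OF G]] by (simp add: lie_def)
    then show ?thesis by (simp add: A_def B_def scale_right linear_neg[OF linear_right])
  qed
  have "H (mid (1/2) F' z) - nf (Suc m) K' (mid (-1/2) F' z)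
    = (H (a z + A z) - H (a z) - \<omega> (L z) (A z)) - (nf m K (b z + B z) - nf m K (b z) - \<omega> (L z) (B z))
      - (Q (b z + B z) - Q z) + (w z - w' z)" for z
    using lin[of z] unfolding midF' nfK' a_def[symmetric] b_def[symmetric] A_def[symmetric] B_def[symmetric] GQ w_def
    by linarith
  then have "flat (Suc (Suc m)) (\<lambda>z. H (mid (1/2) F' z) - nf (Suc m) K' (mid (-1/2) F' z))"
    using flat_add[OF flat_diff[OF flat_diff[OF 1 2] 3] ww'] by simp
  then show ?case using F' K' by blast
qed

end

section \<open>Formal conjugacy and the main theorem\<close>

text \<open>Both sides of the formal identity are the Taylor series of \<open>Y\<close> composed
  with \<open>\<xi>\<close>: for one side \<open>Y\<close> and \<open>\<xi>\<close> are replaced by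
  truncations, for the other the conjugacy gives a sum of products, to which the Cauchy product
  applies.\<close>

lemma formally_conjugatedI:
  fixes X Y \<xi> :: "'v::euclidean_space \<Rightarrow> 'v"
  assumes S: "open S" "0 \<in> S" and V: "open V" "0 \<in> V"
    and X: "smooth_on S X" and Y: "smooth_on V Y" and \<xi>: "smooth_on S \<xi>"
    and \<xi>0: "\<xi> 0 = 0" and d\<xi>0: "\<And>v. dderiv v \<xi> 0 = v" and \<xi>V: "\<xi> ` S \<subseteq> V"
    and conj: "\<And>x. x \<in> S \<Longrightarrow> dderiv (X x) \<xi> x = Y (\<xi> x)"
  shows "formally_conjugated X Y"
  unfolding formally_conjugated_def
proof (intro exI conjI)
  show "formal_map (taylor \<xi>)"
    unfolding formal_map_def
    using polynomial_taylor[OF S \<xi>] homogD[OF homog_taylor[OF S \<xi>]] by blast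
  show "taylor \<xi> 0 = (\<lambda>_. 0)" by (simp add: taylor_def \<xi>0)
  have "taylor \<xi> 1 = id" by (simp add: taylor_def d\<xi>0 fun_eq_iff)
  then show "bij (taylor \<xi> 1)" by simp
  have sZ: "smooth_on S (\<lambda>x. Y (\<xi> x))" by (rule smooth_on_compose[OF S(1) V(1) \<xi>V \<xi> Y])
  have f1: "flat 1 \<xi>" by (rule flat_1_smooth[OF S \<xi> \<xi>0])
  show "formal_deriv_apply (taylor \<xi>) (taylor X) = formal_compose (taylor Y) (taylor \<xi>)"
  proof
    fix k
    define T where "T y = (\<Sum>j<Suc k. taylor Y j y)" for y
    define u where "u y = (\<Sum>j<Suc k. taylor \<xi> j y)" for y
    have sT: "smooth_on UNIV T"
      unfolding T_def[abs_def] by (rule smooth_on_sum[OF open_UNIV smooth_taylor[OF V Y]])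
    have su: "smooth_on U u" if "open U" for U
      unfolding u_def[abs_def] by (rule smooth_on_sum[OF that smooth_taylor[OF S \<xi>]])
    have fu: "flat (Suc k) (\<lambda>x. \<xi> x - u x)"
      unfolding u_def by (rule taylor_remainder[OF S \<xi>])
    have "flat 1 (\<lambda>x. \<xi> x - (\<xi> x - u x))"
      by (rule flat_diff[OF f1 flat_mono[OF fu]]) simp
    then have fu1: "flat 1 u" by simp
    have 1: "flat (Suc k) (\<lambda>x. Y (\<xi> x) - T (\<xi> x))"
      unfolding T_def by (rule flat_compose[OF taylor_remainder[OF V Y] f1])
    \<comment> \<open>The derivative of \<open>T\<close> contributes only order 0; the gain comes
      from the closeness of \<open>\<xi>\<close> to its truncation.\<close>
    have 2: "flat (0 + Suc k) (\<lambda>x. T (\<xi> x) - T (u x))"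
      by (rule flat_mean_value[OF open_UNIV UNIV_I sT flat_0_smooth[OF open_UNIV UNIV_I smooth_on_dderiv[OF sT]] f1 fu1 fu])
    have "flat (Suc k) (\<lambda>x. Y (\<xi> x) - T (u x))"
      using flat_add[OF 1 2[simplified]] by simp
    then have "taylor (\<lambda>x. Y (\<xi> x)) k = taylor (\<lambda>x. T (u x)) k"
      by (rule taylor_eqI[OF S sZ smooth_on_compose[OF S(1) open_UNIV subset_UNIV su[OF S(1)] sT]])
    then have comp: "formal_compose (taylor Y) (taylor \<xi>) k = taylor (\<lambda>x. Y (\<xi> x)) k"
      by (simp only: formal_compose_def T_def u_def lessThan_Suc_atMost)
    have Xb: "smooth_on S (\<lambda>x. X x \<bullet> b)" for b
      by (rule smooth_on_linear_compose[OF S(1) bounded_linear_inner_left X])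
    have prod: "smooth_on S (\<lambda>x. (X x \<bullet> b) *\<^sub>R dderiv b \<xi> x)" for b
      by (rule smooth_on_scaleR[OF S(1) Xb smooth_on_dderiv[OF \<xi>]])
    have "taylor (\<lambda>x. Y (\<xi> x)) k = taylor (\<lambda>x. \<Sum>b\<in>Basis. (X x \<bullet> b) *\<^sub>R dderiv b \<xi> x) k"
      by (rule taylor_cong[OF S smooth_on_sum[OF S(1) prod]])
        (simp only: conj[symmetric] dderiv_expand[OF smooth_onD[OF \<xi>], of _ "X _"])
    also have "\<dots> = (\<lambda>y. \<Sum>b\<in>Basis. \<Sum>j\<le>k. (taylor X (k - j) y \<bullet> b) *\<^sub>R taylor (dderiv b \<xi>) j y)"
      by (rule ext) (simp only: taylor_sum[OF S prod] taylor_scaleR[OF S Xb smooth_on_dderiv[OF \<xi>]]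
          taylor_linear_compose[OF S X bounded_linear_inner_left])
    also have "\<dots> = formal_deriv_apply (taylor \<xi>) (taylor X) k"
    proof
      fix y
      have "frechet_derivative (taylor \<xi> (Suc j)) (at y) v = (\<Sum>b\<in>Basis. (v \<bullet> b) *\<^sub>R taylor (dderiv b \<xi>) j y)" for j v
      proof -
        have "frechet_derivative (taylor \<xi> (Suc j)) (at y) v = dderiv v (taylor \<xi> (Suc j)) y"
          by (simp only: dderiv_def)
        also have "\<dots> = (\<Sum>b\<in>Basis. (v \<bullet> b) *\<^sub>R dderiv b (taylor \<xi> (Suc j)) y)"
          by (rule dderiv_expand[OF smooth_onD[OF smooth_taylor[OF S \<xi>] UNIV_I]])
        finally show ?thesis by (simp only: dderiv_taylor[OF S \<xi>])
      qed
      then show "(\<Sum>b\<in>Basis. \<Sum>j\<le>k. (taylor X (k - j) y \<bullet> b) *\<^sub>R taylor (dderiv b \<xi>) j y)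
        = formal_deriv_apply (taylor \<xi>) (taylor X) k y"
        unfolding formal_deriv_apply_def by (simp only:) (rule sum.swap)
    qed
    finally show "formal_deriv_apply (taylor \<xi>) (taylor X) k = formal_compose (taylor Y) (taylor \<xi>) k"
      unfolding comp ..
  qed
qed

section \<open>Conjugacy by the midpoint map\<close>

context ham_setting
begin

lemma dderiv_mid:
  assumes "gen_ok F"
  shows "dderiv v (mid t F) x = v + t *\<^sub>R dderiv v (ham_vf \<omega> F) x"
proof -
  have d: "ham_vf \<omega> F differentiable at x"
    by (rule smooth_onD[OF smooth_ham_gen[OF assms] UNIV_I])
  show ?thesis
    unfolding mid_def[abs_def]
    by (rule dderiv_eq[OF has_derivative_add[OF has_derivative_ident
            has_derivative_scaleR_right[OF has_derivative_dderiv[OF d]]]])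
qed

lemma mid_0:
  assumes "gen_ok F"
  shows "mid t F 0 = 0" "dderiv v (mid t F) 0 = v"
proof -
  have f: "flat (Suc 1) (ham_vf \<omega> F)" using flat_ham_gen[OF assms] by (simp add: numeral_2_eq_2)
  have "ham_vf \<omega> F 0 = 0" by (rule flat_1_at_0[OF f])
  then show "mid t F 0 = 0" by (simp add: mid_def)
  have "flat (Suc 0) (dderiv v (ham_vf \<omega> F))"
    using flat_dderiv[OF open_UNIV UNIV_I smooth_ham_gen[OF assms] f] by simp
  then show "dderiv v (mid t F) 0 = v"
    unfolding dderiv_mid[OF assms] by (simp add: flat_1_at_0)
qed

text \<open>The terms of first order in \<open>t\<close> cancel by
  \<open>infinitesimally_symplectic\<close>; what remains is even in \<open>t\<close>.\<close>

lemma mid_symplectic: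
  assumes "gen_ok F"
  shows "\<omega> (dderiv u (mid t F) x) (dderiv v (mid t F) x) = \<omega> (dderiv u (mid (- t) F) x) (dderiv v (mid (- t) F) x)"
  unfolding dderiv_mid[OF assms]
  using infinitesimally_symplectic[OF smooth_gen[OF assms], of u x v]
  by (simp add: add_left add_right diff_left diff_right scale_left scale_right algebra_simps)

text \<open>The field \<open>Y\<close> belongs to \<open>H\<close> composed with
  \<open>a \<circ> gb\<close>, and the inverse of that map, \<open>b \<circ> ga\<close>, carries
  \<open>X\<close> to \<open>Y\<close>. Substituting \<open>gb y\<close> for \<open>z\<close> in
  \<open>fl\<close> compares the Hamiltonians; passing to their fields costs one order.\<close>

lemma normal_form_conjugate:
  assumes F: "gen_ok F" and K: "nf_ok r K" and r: "r \<ge> 1"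
    and fl: "flat (Suc r) (\<lambda>z. H (mid (1/2) F z) - nf r K (mid (-1/2) F z))"
  shows "\<exists>Y U. open U \<and> 0 \<in> U \<and> smooth_on U Y \<and> Y 0 = 0 \<and>
    flat r (\<lambda>y. Y y - ham_vf \<omega> (nf r K) y) \<and> formally_conjugated X Y"
proof -
  define a b where "a = mid (1/2) F" and "b = mid (-1/2) F"
  have a: "smooth_on UNIV a" "a 0 = 0" "\<And>v. dderiv v a 0 = v"
    and b: "smooth_on UNIV b" "b 0 = 0" "\<And>v. dderiv v b 0 = v"
    unfolding a_def b_def using smooth_mid[OF F] mid_0[OF F] by simp_all
  have ab: "\<omega> (dderiv u a x) (dderiv v a x) = \<omega> (dderiv u b x) (dderiv v b x)" for u v x
    using mid_symplectic[OF F, of u "1/2" x v] by (simp add: a_def b_def)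
  have ad: "a differentiable at x" and bd: "b differentiable at x" for x
    using a(1) b(1) by (auto intro: smooth_onD)
  obtain Ua Va ga where A: "open Ua" "0 \<in> Ua" "open Va" "0 \<in> Va" "homeomorphism Ua Va a ga" "smooth_on Va ga"
    "\<And>x. x \<in> Ua \<Longrightarrow> bij (\<lambda>v. dderiv v a x)"
    by (rule smooth_local_inverse[OF a]) metis
  obtain Ub Vb gb where B: "open Ub" "0 \<in> Ub" "open Vb" "0 \<in> Vb" "homeomorphism Ub Vb b gb" "smooth_on Vb gb"
    "\<And>x. x \<in> Ub \<Longrightarrow> bij (\<lambda>v. dderiv v b x)"
    by (rule smooth_local_inverse[OF b]) metis
  have ga: "ga x \<in> Ua" "a (ga x) = x" if "x \<in> Va" for x using A(5) that unfolding homeomorphism_def by auto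
  have gaa: "ga (a z) = z" "a z \<in> Va" if "z \<in> Ua" for z using A(5) that unfolding homeomorphism_def by auto
  have gb: "gb x \<in> Ub" "b (gb x) = x" if "x \<in> Vb" for x using B(5) that unfolding homeomorphism_def by auto
  have gbb: "gb (b z) = z" "b z \<in> Vb" if "z \<in> Ub" for z using B(5) that unfolding homeomorphism_def by auto
  have ga0: "ga 0 = 0" using gaa(1)[OF A(2)] a(2) by simp
  have gb0: "gb 0 = 0" using gbb(1)[OF B(2)] b(2) by simp
  define H' where "H' y = H (a (gb y))" for y
  define Y where "Y = ham_vf \<omega> H'"
  have sHa: "smooth_on UNIV (\<lambda>z. H (a z))"
    by (rule smooth_on_compose[OF open_UNIV open_UNIV subset_UNIV a(1) smooth_H])
  have sH': "smooth_on Vb H'"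
    unfolding H'_def[abs_def] by (rule smooth_on_compose[OF B(3) open_UNIV subset_UNIV B(6) sHa])
  have H'd: "H' differentiable at y" if "y \<in> Vb" for y by (rule smooth_onD[OF sH' that])
  have sY: "smooth_on Vb Y" unfolding Y_def by (rule smooth_ham_vf[OF B(3) sH'])
  have sK: "smooth_on Vb (nf r K)" by (rule smooth_on_subset[OF smooth_nf[OF K] subset_UNIV])
  have "flat (Suc r) (\<lambda>y. H (a (gb y)) - nf r K (b (gb y)))"
    using flat_compose[OF fl flat_1_smooth[OF B(3,4,6) gb0]] unfolding a_def b_def .
  then have "flat (Suc r) (\<lambda>y. H' y - nf r K y)"
    by (rule flat_cong) (rule eventually_cong_on[OF B(3,4)], simp add: H'_def gb)
  from flat_ham_vf[OF B(3,4) smooth_on_diff[OF B(3) sH' sK] this]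
  have "flat r (ham_vf \<omega> (\<lambda>y. H' y - nf r K y))" .
  then have flY: "flat r (\<lambda>y. Y y - ham_vf \<omega> (nf r K) y)"
  proof (rule flat_cong)
    have "ham_vf \<omega> (\<lambda>y. H' y - nf r K y) y = Y y - ham_vf \<omega> (nf r K) y" if "y \<in> Vb" for y
    proof (rule ham_vf_unique)
      fix v
      show "\<omega> (Y y - ham_vf \<omega> (nf r K) y) v = dderiv v (\<lambda>y. H' y - nf r K y) y"
        unfolding dderiv_diff[OF H'd[OF that] smooth_onD[OF sK that]] diff_left Y_def
        by (simp add: omega_ham_vf[OF H'd[OF that]] omega_ham_vf[OF smooth_onD[OF sK that]])
    qed
    then show "\<forall>\<^sub>F y in nhds 0. ham_vf \<omega> (\<lambda>y. H' y - nf r K y) y = Y y - ham_vf \<omega> (nf r K) y"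
      by (rule eventually_cong_on[OF B(3,4)])
  qed
  \<comment> \<open>Here \<open>r \<ge> 1\<close> matters: agreement to positive order includes
    agreement at the origin.\<close>
  have "flat (Suc (r - 1)) (\<lambda>y. Y y - ham_vf \<omega> (nf r K) y)" using flY r by simp
  from flat_1_at_0[OF this] have "Y 0 = ham_vf \<omega> (nf r K) 0" by simp
  moreover have "ham_vf \<omega> (nf r K) 0 = 0"
  proof (rule ham_vf_unique)
    fix v
    have "flat (Suc 1) (\<lambda>x. nf r K x - H2 x)"
      by (rule flat_mono[OF flat_nf_H2[OF K]]) simp
    moreover have "flat (Suc 1) H2"
      using flat_hom_poly[OF hom_poly_H2] by (simp add: numeral_2_eq_2)
    ultimately have "flat (Suc 1) (\<lambda>x. (nf r K x - H2 x) + H2 x)" by (rule flat_add)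
    then have "flat (Suc 0) (dderiv v (nf r K))"
      using flat_dderiv[OF open_UNIV UNIV_I smooth_nf[OF K], of 1 v] by simp
    from flat_1_at_0[OF this] show "\<omega> 0 v = dderiv v (nf r K) 0"
      by (simp add: linear_0[OF linear_left])
  qed
  ultimately have Y0: "Y 0 = 0" by simp
  \<comment> \<open>For \<open>x\<close> in this set \<open>ga x\<close> lies in both
    \<open>Ua\<close> and \<open>Ub\<close>, so that \<open>a\<close> and \<open>b\<close> have
    bijective derivatives there.\<close>
  define S where "S = Va \<inter> ga -` Ub"
  have S: "open S" "0 \<in> S"
    unfolding S_def
    using continuous_open_preimage[OF smooth_on_continuous[OF A(6)] A(3) B(1)] A(4) ga0 B(2) by auto
  have SVa: "S \<subseteq> Va" by (auto simp: S_def)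
  define \<xi> where "\<xi> x = b (ga x)" for x
  have s\<xi>: "smooth_on S \<xi>"
    unfolding \<xi>_def[abs_def]
    by (rule smooth_on_compose[OF S(1) open_UNIV subset_UNIV smooth_on_subset[OF A(6) SVa] b(1)])
  \<comment> \<open>Differentiating \<open>\<xi> (a z) = b z\<close> avoids any formula for the
    derivative of \<open>ga\<close>.\<close>
  have \<xi>a: "dderiv (dderiv w a z) \<xi> (a z) = dderiv w b z" if "a z \<in> S" "z \<in> Ua" for z w
  proof -
    have \<xi>d: "\<xi> differentiable at (a z)" by (rule smooth_onD[OF s\<xi> that(1)])
    have "dderiv w (\<lambda>z. \<xi> (a z)) z = dderiv (dderiv w a z) \<xi> (a z)"
      by (rule dderiv_compose[OF ad \<xi>d])
    moreover have "dderiv w (\<lambda>z. \<xi> (a z)) z = dderiv w b z"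
      by (rule differentiable_transform_open(2)[OF A(1) that(2) _ bd]) (simp add: \<xi>_def gaa)
    ultimately show ?thesis by simp
  qed
  have "formally_conjugated X Y"
  proof (rule formally_conjugatedI[OF S B(3,4) smooth_on_subset[OF smooth_X subset_UNIV] sY s\<xi>])
    show "\<xi> 0 = 0" by (simp add: \<xi>_def ga0 b)
    show "dderiv v \<xi> 0 = v" for v using \<xi>a[of 0 v] S(2) A(2) by (simp add: a b)
    show "\<xi> ` S \<subseteq> Vb" using gbb(2) by (auto simp: \<xi>_def S_def)
    fix x assume x: "x \<in> S"
    define z where "z = ga x"
    have z: "z \<in> Ua" "z \<in> Ub" "a z = x" using x ga unfolding S_def z_def by auto
    \<comment> \<open>\<open>X x\<close> is pulled back by \<open>a\<close> to \<open>w\<close>,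
      which \<open>b\<close> pushes forward to the candidate value of \<open>Y\<close>. Every test
      vector is some \<open>dderiv v b z\<close>, and \<open>ab\<close> turns the pairing with it
      into one with \<open>X\<close>.\<close>
    from surjD[OF bij_is_surj[OF A(7)[OF z(1)]], of "X x"] obtain w where w: "X x = dderiv w a z" ..
    have "Y (b z) = dderiv w b z"
      unfolding Y_def
    proof (rule ham_vf_unique)
      fix v'
      from surjD[OF bij_is_surj[OF B(7)[OF z(2)]], of v'] obtain v where v: "v' = dderiv v b z" ..
      have "\<omega> (dderiv w b z) v' = \<omega> (X (a z)) (dderiv v a z)"
        unfolding v ab[symmetric] z(3) w ..
      also have "\<dots> = dderiv v (\<lambda>z. H (a z)) z"
        unfolding omega_X by (rule dderiv_compose[OF ad H_diff, symmetric])
      also have "\<dots> = dderiv v (\<lambda>z. H' (b z)) z"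
        by (rule differentiable_transform_open(2)[OF B(1) z(2) _ smooth_onD[OF sHa UNIV_I], symmetric])
          (simp add: H'_def gbb)
      also have "\<dots> = dderiv v' H' (b z)"
        unfolding v by (rule dderiv_compose[OF bd H'd[OF gbb(2)[OF z(2)]]])
      finally show "\<omega> (dderiv w b z) v' = dderiv v' H' (b z)" .
    qed
    moreover have "dderiv (X x) \<xi> x = dderiv w b z" using \<xi>a[of z w] x z w by simp
    ultimately show "dderiv (X x) \<xi> x = Y (\<xi> x)" by (simp add: \<xi>_def z_def)
  qed
  then show ?thesis using B(3,4) sY Y0 flY by blast
qed

lemma ham_vf_nf:
  assumes K: "nf_ok r K"
  shows "ham_vf \<omega> (nf r K) y = L y + (\<Sum>k=3..r. ham_vf \<omega> (K k) y)"
proof -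
  have d: "K k differentiable at y" if "k \<in> {3..r}" for k
    by (rule hom_polyD(4)[OF nf_okD(1)[OF K that]])
  have "(\<lambda>y. \<Sum>k=3..r. K k y) differentiable at y"
    by (rule smooth_onD[OF smooth_on_sum[OF open_UNIV hom_polyD(3)[OF nf_okD(1)[OF K]]] UNIV_I])
  moreover have "ham_vf \<omega> (\<lambda>y. \<Sum>k=3..r. K k y) y = (\<Sum>k=3..r. ham_vf \<omega> (K k) y)"
    by (rule ham_vf_sum) (rule d)
  ultimately show ?thesis
    unfolding nf_def[abs_def]
    by (simp add: ham_vf_add[OF hom_polyD(4)[OF hom_poly_H2]] ham_vf_H2)
qed

lemma hom_poly_inv_S: "hom_poly_inv (S_group e L) (matrix_act e) k = {q \<in> hom_poly k. lie N q = (\<lambda>x. 0)}"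
proof -
  have "f \<in> hom_poly_inv (S_group e L) (matrix_act e) k \<longleftrightarrow> f \<in> hom_poly k \<and> lie N f = (\<lambda>x. 0)" for f
    using invariant_iff_lie[of f k L] unfolding N_def hom_poly_inv_def hom_poly_semi_def S_group_def by auto
  then show ?thesis by blast
qed

lemma normal_form_componentsI:
  assumes F: "gen_ok F" and K: "nf_ok r K" and r: "r \<ge> 1"
    and fl: "flat (Suc r) (\<lambda>z. H (mid (1/2) F z) - nf r K (mid (-1/2) F z))"
  shows "normal_form_components \<omega> e (hom_poly_inv (S_group e L) (matrix_act e)) H r K"
proof -
  obtain Y U where Y: "open U" "0 \<in> U" "smooth_on U Y" "Y 0 = 0"
    "flat r (\<lambda>y. Y y - ham_vf \<omega> (nf r K) y)" "formally_conjugated X Y"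
    using normal_form_conjugate[OF assms] by blast
  have frL: "frechet_derivative (ham_vf \<omega> H) (at 0) y = L y" for y
    by (simp add: L_def X_def[symmetric] dderiv_def)
  obtain C where C: "C > 0" "\<forall>\<^sub>F y in nhds 0. norm (Y y - ham_vf \<omega> (nf r K) y) \<le> C * norm y ^ r"
    using Y(5) by (rule flatE)
  \<comment> \<open>\<open>flat\<close> controls a full neighbourhood, the order symbol in the
    definition a punctured one.\<close>
  then have ev: "\<forall>\<^sub>F y in at 0. norm (Y y - ham_vf \<omega> (nf r K) y) \<le> C * norm y ^ r"
    by (simp add: eventually_nhds_conv_at)
  have bigo: "(\<lambda>y. norm (Y y - (frechet_derivative (ham_vf \<omega> H) (at 0) y + (\<Sum>k=3..r. ham_vf \<omega> (K k) y))))
      \<in> O[at 0](\<lambda>y. norm y ^ r)"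
    unfolding frL ham_vf_nf[OF K, symmetric]
    by (rule bigoI[of _ C]) (use ev in simp)
  have img: "(\<lambda>F. poisson \<omega> F (hess_quad e H)) ` hom_poly k = lie L ` hom_poly k" for k
    by (rule image_cong[OF refl]) (simp only: H2_def[symmetric] poisson_H2)
  show ?thesis
    unfolding normal_form_components_def hom_poly_inv_S img
  proof (intro conjI ballI)
    show "linear_complement (hom_poly k) (lie L ` hom_poly k) {q \<in> hom_poly k. lie N q = (\<lambda>x. 0)}" for k
      by (rule linear_complement_ker)
    show "K k \<in> {q \<in> hom_poly k. lie N q = (\<lambda>x. 0)}" if "k \<in> {3..r}" for k
      using nf_okD[OF K that] by simp
    show "\<exists>Y. (\<exists>U. open U \<and> 0 \<in> U \<and> smooth_on U Y) \<and> Y 0 = 0 \<and>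
       (\<lambda>y. norm (Y y - (frechet_derivative (ham_vf \<omega> H) (at 0) y + (\<Sum>k=3..r. ham_vf \<omega> (K k) y))))
         \<in> O[at 0](\<lambda>y. norm y ^ r) \<and> formally_conjugated (ham_vf \<omega> H) Y"
      using Y bigo X_def by blast
  qed
qed

end

text \<open>In an orthonormal basis the transposed matrix represents the adjoint of \<open>L\<close>
  for \<open>ip\<close>. As \<open>h\<close> is orthogonal, the relation between \<open>L\<close>
  and \<open>h\<close> passes to the adjoint.\<close>

lemma (in based) transpose_commute:
  fixes L h :: "'v \<Rightarrow> 'v"
  assumes ip: "inner_product ip" and orth: "\<And>i j. ip (e i) (e j) = (if i = j then 1 else 0)"
    and h: "linear h" and ip_h: "\<And>u v. ip (h u) (h v) = ip u v"
    and L: "linear L" and Lh: "\<And>x. L (h x) = s *\<^sub>R h (L x)"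
  defines "N \<equiv> matrix_act e (transpose (matrix_wrt e L))"
  shows "N (h x) = s *\<^sub>R h (N x)"
proof -
  have lin: "linear (ip u)" and sym: "ip u v = ip v u" and pos: "v \<noteq> 0 \<Longrightarrow> ip v v > 0" for u v
    using ip by (auto simp: inner_product_def)
  have comp: "ip u (e i) = coords e u $ i" for u i
    unfolding sym[of u] linear_expand[OF lin, of "e i" u] by (simp add: orth if_distrib cong: if_cong)
  have dot: "ip u v = coords e u \<bullet> coords e v" for u v
    unfolding linear_expand[OF lin, of u v] comp by (simp add: inner_vec_def mult.commute)
  have adj: "ip (N u) v = ip u (L v)" for u v
    unfolding dot N_def coords_matrix_act matrix_wrt_coords[OF L, symmetric]
    by (simp only: transpose_matrix_vector dot_lmul_matrix)
  have sL: "ip (c *\<^sub>R u) v = c * ip u v" for c u v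
    unfolding sym[of _ v] by (simp add: linear_scale[OF lin])
  have "inj h"
    unfolding linear_injective_0[OF h]
  proof (intro allI impI)
    fix u assume "h u = 0"
    then have "ip u u = 0" using ip_h[of u u] linear_0[OF lin] by simp
    then show "u = 0" using pos[of u] by force
  qed
  then have surj: "surj h" by (rule linear_inj_imp_surj[OF h])
  \<comment> \<open>Since \<open>h\<close> is surjective, \<open>d\<close> need only be tested
    against vectors \<open>h z\<close>, where the invariance of \<open>ip\<close> applies.\<close>
  define d where "d = N (h x) - s *\<^sub>R h (N x)"
  have "ip d (h z) = 0" for z
  proof -
    have "ip d (h z) = ip (N (h x)) (h z) - ip (s *\<^sub>R h (N x)) (h z)"
      unfolding d_def sym[of _ "h z"] by (rule linear_diff[OF lin])
    also have "ip (N (h x)) (h z) = s * ip (N x) z"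
      unfolding adj Lh by (simp add: linear_scale[OF lin] ip_h)
    also have "ip (s *\<^sub>R h (N x)) (h z) = s * ip (N x) z"
      by (simp add: sL ip_h)
    finally show ?thesis by simp
  qed
  moreover from surjD[OF surj, of d] obtain z where "d = h z" ..
  ultimately have "ip d d = 0" by metis
  then have "d = 0" using pos[of d] by force
  then show ?thesis by (simp add: d_def)
qed

theorem corollary6p4:
  fixes n r :: nat
    and \<omega> :: "'v::euclidean_space \<Rightarrow> 'v \<Rightarrow> real"
    and \<Gamma> :: "'g monoid" and T :: "'g topology"
    and E :: "'e::euclidean_space set" and \<A> :: "('g set \<times> ('g \<Rightarrow> 'e)) set"
    and \<rho> :: "'g \<Rightarrow> 'v \<Rightarrow> 'v"
    and \<sigma>\<^sub>1 \<sigma>\<^sub>2 :: "'g \<Rightarrow> real"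
    and e :: "'m::finite \<Rightarrow> 'v"
    and X L :: "'v \<Rightarrow> 'v"
    and H :: "'v \<Rightarrow> real"
  assumes "DIM('v) = 2 * n"
    and "symplectic_form \<omega>"
    and "compact_lie_group \<Gamma> T E \<A>"
    and "linear_group_action \<Gamma> T \<rho>"
    and "\<sigma>\<^sub>1 \<in> hom \<Gamma> Z2" and "\<sigma>\<^sub>2 \<in> hom \<Gamma> Z2"
    and "semisymplectic \<Gamma> \<rho> \<sigma>\<^sub>1 \<omega>"
    and "is_basis e" and "orthonormal_for_invariant \<Gamma> \<rho> e"
    and "smooth_on UNIV X" and "smooth_on UNIV H" and "X = ham_vf \<omega> H"
    and "equivariant_vf \<Gamma> \<rho> \<sigma>\<^sub>2 X"
    and "X 0 = 0" and "L = frechet_derivative X (at 0)"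
    and "\<forall>A\<in>S_set e L. \<forall>u v. \<omega> (matrix_act e A u) (matrix_act e A v) = \<omega> u v"
    and "r \<ge> 3"
    and "H 0 = 0" and "gradient_wrt e H 0 = 0"
  shows "\<exists>Kc. (\<forall>k\<in>{3..r}. Kc k \<in> hom_poly_semi (semidirect e L \<Gamma> \<rho>) (semidirect_act e \<rho>)
              (\<lambda>(A, \<gamma>). \<sigma>\<^sub>1 \<gamma> * \<sigma>\<^sub>2 \<gamma>) k) \<and>
          (let K = (\<lambda>x. hess_quad e H x + (\<Sum>k=3..r. Kc k x));
               D = hom_poly_inv (S_group e L) (matrix_act e)
           in hamiltonian_normal_form \<omega> e D H r K \<and>
              vf_normal_form \<omega> e D X (r - 1) (ham_vf \<omega> K) \<and>
              equivariant_vf \<Gamma> \<rho> \<sigma>\<^sub>2 (ham_vf \<omega> K))"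
proof -
  interpret symplectic e \<omega>
    by unfold_locales (rule assms)+
  have smX: "smooth_on UNIV X" by (rule assms)
  have Xd: "X differentiable at x" for x by (rule smooth_onD[OF smX UNIV_I])
  have L: "L = (\<lambda>v. dderiv v X 0)" using assms(15) by (simp add: dderiv_def fun_eq_iff)
  have linL: "linear L" unfolding L by (rule linear_dderiv[OF Xd])
  have lin: "linear (\<rho> g)" if "g \<in> carrier \<Gamma>" for g
    using assms(4) that by (simp add: linear_group_action_def)
  have sign: "\<sigma> g * \<sigma> g = 1" if "\<sigma> \<in> hom \<Gamma> Z2" "g \<in> carrier \<Gamma>" for \<sigma> g
    using that by (auto simp: hom_def Z2_def Pi_iff)
  have equiv: "X (\<rho> g x) = \<sigma>\<^sub>2 g *\<^sub>R \<rho> g (X x)" if "g \<in> carrier \<Gamma>" for g x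
    using assms(13) that by (simp add: equivariant_vf_def)
  have semi: "\<omega> (\<rho> g u) (\<rho> g v) = \<sigma>\<^sub>1 g * \<omega> u v" if "g \<in> carrier \<Gamma>" for g u v
    using assms(7) that by (simp add: semisymplectic_def)
  obtain ip where ip: "inner_product ip" "\<And>g u v. g \<in> carrier \<Gamma> \<Longrightarrow> ip (\<rho> g u) (\<rho> g v) = ip u v"
    "\<And>i j. ip (e i) (e j) = (if i = j then 1 else 0)"
    using assms(9) by (auto simp: orthonormal_for_invariant_def)
  have Lg: "L (\<rho> g x) = \<sigma>\<^sub>2 g *\<^sub>R \<rho> g (L x)" if g: "g \<in> carrier \<Gamma>" for g x
  proof -
    have bl: "bounded_linear (\<rho> g)" using lin[OF g] by (simp add: linear_conv_bounded_linear)
    have "dderiv x (\<lambda>y. X (\<rho> g y)) 0 = L (\<rho> g x)"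
      using dderiv_compose[OF bounded_linear_imp_differentiable[OF bl] Xd, of x 0]
      by (simp add: dderiv_bounded_linear[OF bl] L linear_0[OF lin[OF g]])
    moreover have "dderiv x (\<lambda>y. X (\<rho> g y)) 0 = \<sigma>\<^sub>2 g *\<^sub>R \<rho> g (L x)"
      unfolding equiv[OF g] L
      by (rule dderiv_linear_compose[OF bounded_linear_compose[OF bounded_linear_scaleR_right bl] Xd])
    ultimately show ?thesis by simp
  qed
  define N where "N = matrix_act e (transpose (matrix_wrt e L))"
  have Ng: "N (\<rho> g x) = \<sigma>\<^sub>2 g *\<^sub>R \<rho> g (N x)" if g: "g \<in> carrier \<Gamma>" for g x
    unfolding N_def by (rule transpose_commute[OF ip(1,3) lin[OF g] ip(2)[OF g] linL Lg[OF g]])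
  \<comment> \<open>A relation, because \<open>s\<close> need not be a function of \<open>h\<close>:
    the action may fail to be faithful.\<close>
  define sym where "sym h c s \<longleftrightarrow> (\<exists>g\<in>carrier \<Gamma>. h = \<rho> g \<and> c = \<sigma>\<^sub>1 g \<and> s = \<sigma>\<^sub>2 g)" for h c s
  interpret ham_setting e \<omega> H X L N sym
  proof (intro ham_setting.intro ham_setting_axioms.intro symplectic_axioms)
    show "linear h" if "sym h c s" for h c s using that lin by (auto simp: sym_def)
    show "c * c = 1 \<and> s * s = 1" if "sym h c s" for h c s
      using that sign[OF assms(5)] sign[OF assms(6)] by (auto simp: sym_def)
    show "\<omega> (h u) (h v) = c * \<omega> u v" if "sym h c s" for h c s u v using that semi by (auto simp: sym_def)
    show "X (h x) = s *\<^sub>R h (X x)" if "sym h c s" for h c s x using that equiv by (auto simp: sym_def)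
    show "N (h x) = s *\<^sub>R h (N x)" if "sym h c s" for h c s x using that Ng by (auto simp: sym_def)
  qed (fact assms L N_def)+
  have symI: "sym (\<rho> g) (\<sigma>\<^sub>1 g) (\<sigma>\<^sub>2 g)" if "g \<in> carrier \<Gamma>" for g
    using that by (auto simp: sym_def)
  \<comment> \<open>Order \<open>r - 1\<close> of the field corresponds to degree \<open>r\<close>
    of the Hamiltonian, which \<open>vf_normal_form\<close> restores by \<open>Suc\<close>.\<close>
  have r: "r \<ge> 2" "r \<ge> 1" "Suc (r - 1) = r" using assms(17) by simp_all
  obtain F K where F: "gen_ok F" and K: "nf_ok r K"
    and fl: "flat (Suc r) (\<lambda>z. H (mid (1/2) F z) - nf r K (mid (-1/2) F z))"
    using normal_form_exists[OF r(1)] by blast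
  have comps: "normal_form_components \<omega> e (hom_poly_inv (S_group e L) (matrix_act e)) H r K"
    by (rule normal_form_componentsI[OF F K r(2) fl])
  have nf: "(\<lambda>x. hess_quad e H x + (\<Sum>k=3..r. K k x)) = nf r K"
    by (simp add: nf_def H2_def fun_eq_iff)
  show ?thesis
    unfolding Let_def
  proof (intro exI[of _ K] conjI ballI)
    fix k assume k: "k \<in> {3..r}"
    have inv: "K k (matrix_act e A x) = K k x" if "A \<in> S_set e L" for A x
      using invariant_iff_lie[OF nf_okD(1)[OF K k], of L] nf_okD(2)[OF K k] that unfolding N_def by blast
    have "K k (matrix_act e A (\<rho> g x)) = \<sigma>\<^sub>1 g * \<sigma>\<^sub>2 g * K k x"
      if "A \<in> S_set e L" "g \<in> carrier \<Gamma>" for A g x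
      unfolding inv[OF that(1)] by (rule nf_okD(3)[OF K k symI[OF that(2)]])
    then show "K k \<in> hom_poly_semi (semidirect e L \<Gamma> \<rho>) (semidirect_act e \<rho>) (\<lambda>(A, \<gamma>). \<sigma>\<^sub>1 \<gamma> * \<sigma>\<^sub>2 \<gamma>) k"
      unfolding hom_poly_semi_def semidirect_def semidirect_act_def using nf_okD(1)[OF K k] by auto
  next
    show "hamiltonian_normal_form \<omega> e (hom_poly_inv (S_group e L) (matrix_act e)) H r
        (\<lambda>x. hess_quad e H x + (\<Sum>k=3..r. K k x))"
      unfolding hamiltonian_normal_form_def using comps by blast
    have "ham_vf \<omega> (nf r K) = (\<lambda>y. frechet_derivative X (at 0) y + (\<Sum>k=3..r. ham_vf \<omega> (K k) y))"
      by (rule ext) (simp only: ham_vf_nf[OF K] assms(15))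
    then show "vf_normal_form \<omega> e (hom_poly_inv (S_group e L) (matrix_act e)) X (r - 1)
        (ham_vf \<omega> (\<lambda>x. hess_quad e H x + (\<Sum>k=3..r. K k x)))"
      unfolding vf_normal_form_def r(3) nf
      using assms(11,12,18,19) comps by blast
    show "equivariant_vf \<Gamma> \<rho> \<sigma>\<^sub>2 (ham_vf \<omega> (\<lambda>x. hess_quad e H x + (\<Sum>k=3..r. K k x)))"
      unfolding equivariant_vf_def nf
    proof (intro ballI allI)
      fix g x assume g: "g \<in> carrier \<Gamma>"
      have c: "\<sigma>\<^sub>1 g * \<sigma>\<^sub>1 g = 1" by (rule sign[OF assms(5) g])
      have "ham_vf \<omega> (nf r K) (\<rho> g x) = (\<sigma>\<^sub>1 g * \<sigma>\<^sub>2 g * \<sigma>\<^sub>1 g) *\<^sub>R \<rho> g (ham_vf \<omega> (nf r K) x)"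
        by (rule ham_vf_equivariant[OF lin[OF g] semi[OF g] c smooth_nf[OF K] sym_nf[OF K symI[OF g]]])
      \<comment> \<open>One factor \<open>\<sigma>\<^sub>1 g\<close> comes from \<open>K\<close> and
        one from \<open>\<omega>\<close>; they cancel and leave the character of
        \<open>X\<close>.\<close>
      also have "\<sigma>\<^sub>1 g * \<sigma>\<^sub>2 g * \<sigma>\<^sub>1 g = \<sigma>\<^sub>2 g" using c by (simp add: mult.assoc mult.left_commute)
      finally show "ham_vf \<omega> (nf r K) (\<rho> g x) = \<sigma>\<^sub>2 g *\<^sub>R \<rho> g (ham_vf \<omega> (nf r K) x)" .
    qed
  qed
qed


end
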